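(* Let $\alpha\in\operatorname{D}^\sigma_\pi$ with $\sigma\in[0,1)$. The operators $-A_\alpha$ and $-\mathcal{A}_\alpha$ generate strongly continuous analytic contraction semigroups on $\operatorname{L}^2_\pi(B)$ and on $\operatorname{H}^{-1}_{\pi,\alpha}(B)$, respectively. In particular: (a) for any $u_0\in \operatorname{L}^2_\pi(B)$ there is a unique solution $u\in \operatorname{C}([0,\infty),\operatorname{L}^2_\pi(B))$ of the abstract Cauchy problem $\dot u=-A_\alpha u$ in $\operatorname{L}^2_\pi(B)$ for $t>0$, $u(0)=u_0$, satisfying $$u\in\operatorname{C}^1((0,\infty),\operatorname{L}^2_\pi(B))\cap\operatorname{C}((0,\infty),\operatorname{H}^2_{\pi,\alpha}(B));$$ (b) for any $u_0\in \operatorname{H}^{-1}_{\pi,\alpha}(B)$ there is a unique solution $u\in \operatorname{C}([0,\infty),\operatorname{H}^{-1}_{\pi,\alpha}(B))$ of the abstract Cauchy problem $\dot u=-\mathcal{A}_\alpha u$ in $\operatorname{H}^{-1}_{\pi,\alpha}(B)$ for $t>0$, $u(0)=u_0$, satisfying $$u\in\operatorname{C}^1((0,\infty),\operatorname{H}^{-1}_{\pi,\alpha}(B))\cap\operatorname{C}((0,\infty),\operatorname{H}^{1}_{\pi,\alpha}(B)).$$ Moreover, one always has that $$u(t,u_0)\longrightarrow\frac{1}{2^n}\langle u_0,\mathbf{1}\rangle\quad\text{as }t\to\infty$$ in $\operatorname{L}^2_\pi(B)$ in case (a), and in $\operatorname{H}^{-1}_{\pi,\alpha}(B)$ in case (b),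 where $u(\cdot,u_0)$ denotes the solution with initial datum $u_0$ and the limit is understood as a constant function.
   Context: Let $n\in\{1,2\}$ and let $B=[-1,1)^n$ be the periodicity box: functions on $B$ are identified with functions on $\mathbb{R}^n$ that are $2$-periodic in each variable, and the subscript $\pi$ indicates spaces of periodic functions. If $n=1$, $\Gamma=\{-1/2,1/2\}$; if $n=2$, $\Gamma\subset B$ is a smooth closed curve bounding a smooth domain $\Omega$. Put $d(x,\Gamma)=\inf_{y\in\Gamma}|x-y|$. For $\sigma\in[0,1)$, $\operatorname{D}^\sigma_\pi$ is the set of bounded periodic functions $\alpha:B\to[0,\infty)$ which vanish exactly on $\Gamma$ (no vanishing is required if $\sigma=0$), satisfy $\frac1c d(x,\Gamma)^\sigma\le\alpha(x)\le c\,d(x,\Gamma)^\sigma$ for $x\in B$ and some constant $1\le c<\infty$, and are otherwise smooth on $B\setminus\Gamma$ (at least Hölder continuous of exponent $\sigma$). $\operatorname{H}^1_{\pi,\alpha}(B)=\{u\in\operatorname{L}^2_\pi(B): |\nabla u|\in\operatorname{L}^1_\pi(B),\ \int_B\alpha|\nabla u|^2dx<\infty\}$ (distributional periodic gradient), with norm $(\|u\|_2^2+\|\sqrt\alpha\,\nabla u\|_2^2)^{1/2}$. Its dual is $\operatorname{H}^{-1}_{\pi,\alpha}(B)$; $\operatorname{L}^2_\pi(B)$ is embedded in it via the $\operatorname{L}^2$ inner product; $\langle\cdot,\cdot\rangle$ is the duality pairing (so $\langle u_0,\mathbf 1\rangle=\int_Bu_0\,dx$ for $u_0\in\operatorname{L}^2_\pi(B)$)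 and $\mathbf 1$ is the constant function $1$. Let $a_\alpha(u,v)=\int_B\alpha\nabla u\cdot\nabla v\,dx$ for $u,v\in\operatorname{H}^1_{\pi,\alpha}(B)$. The operator $\mathcal{A}_\alpha:\operatorname{H}^1_{\pi,\alpha}(B)\to\operatorname{H}^{-1}_{\pi,\alpha}(B)$ is $\mathcal{A}_\alpha u=a_\alpha(u,\cdot)$, viewed as an unbounded operator on $\operatorname{H}^{-1}_{\pi,\alpha}(B)$ with domain $\operatorname{H}^1_{\pi,\alpha}(B)$. The operator $A_\alpha$ is its $\operatorname{L}^2_\pi(B)$-realization: $A_\alpha u=\mathcal{A}_\alpha u$ for $u$ in $\operatorname{dom}(A_\alpha)=\{u\in\operatorname{H}^1_{\pi,\alpha}(B): a_\alpha(u,\cdot)\text{ is }\operatorname{L}^2_\pi(B)\text{-continuous}\}=\{u\in\operatorname{H}^1_{\pi,\alpha}(B):\operatorname{div}(\alpha\nabla u)\in\operatorname{L}^2_\pi(B)\}=:\operatorname{H}^2_{\pi,\alpha}(B)$, endowed with the graph norm; thus $A_\alpha u=-\operatorname{div}(\alpha\nabla u)$. *)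

theory Defs
  imports "HOL-Analysis.Analysis" "HOL-Library.Function_Algebras"
begin

section \<open>The space of square integrable periodic functions\<close>

text \<open>
  Periodic functions are identified with their restriction to the box \<open>[-1,1)\<^sup>n\<close>, where
  \<open>n = CARD('n)\<close>. Elements of \<open>'n l2\<close> are real-valued square integrable functions on
  the box modulo equality almost everywhere.
\<close>

definition pbox :: "(real ^ 'n) set" where
  "pbox = {x. \<forall>i. -1 \<le> x $ i \<and> x $ i < 1}"

abbreviation boxm :: "(real ^ 'n) measure" where
  "boxm \<equiv> lebesgue_on pbox"

definition sq_integrable :: "(real ^ 'n \<Rightarrow> real) \<Rightarrow> bool" where
  "sq_integrable f \<longleftrightarrow> f \<in> borel_measurable boxm \<and> integrable boxm (\<lambda>x. (f x)\<^sup>2)"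

definition l2_rel :: "(real ^ 'n \<Rightarrow> real) \<Rightarrow> (real ^ 'n \<Rightarrow> real) \<Rightarrow> bool" where
  "l2_rel f g \<longleftrightarrow> sq_integrable f \<and> sq_integrable g \<and> (AE x in boxm. f x = g x)"

lemma emeasure_pbox_finite: "emeasure lebesgue (pbox :: (real ^ 'n) set) < \<infinity>"
proof -
  have sub: "(pbox :: (real ^ 'n) set) \<subseteq> cbox (\<chi> i. -1) (\<chi> i. 1)"
    by (auto simp: pbox_def mem_box_cart less_imp_le)
  have "emeasure lebesgue (pbox :: (real ^ 'n) set)
      \<le> emeasure lebesgue (cbox (\<chi> i. -1) (\<chi> i. 1) :: (real ^ 'n) set)"
    by (rule emeasure_mono[OF sub]) simp
  also have "\<dots> < \<infinity>"
    by (simp add: emeasure_lborel_cbox_eq)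
  finally show ?thesis .
qed

lemma sets_pbox: "(pbox :: (real ^ 'n) set) \<in> sets lebesgue"
proof -
  have "(pbox :: (real ^ 'n) set) = (\<Inter>i. {x. -1 \<le> x $ i} \<inter> {x. x $ i < 1})"
    by (auto simp: pbox_def)
  also have "\<dots> \<in> sets borel"
    by measurable
  finally show ?thesis by simp
qed

lemma finite_measure_boxm: "finite_measure (boxm :: (real ^ 'n) measure)"
  using emeasure_pbox_finite[where 'n = 'n] sets_pbox[where 'n = 'n]
  by (intro finite_measureI) (simp add: emeasure_restrict_space space_restrict_space)

lemma sq_integrable_mult:
  assumes "sq_integrable f" "sq_integrable g"
  shows "integrable boxm (\<lambda>x. f x * g x)"
proof (rule Bochner_Integration.integrable_bound)
  show "integrable boxm (\<lambda>x. (f x)\<^sup>2 + (g x)\<^sup>2)"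
    using assms by (auto simp: sq_integrable_def)
  show "(\<lambda>x. f x * g x) \<in> borel_measurable boxm"
    using assms by (auto simp: sq_integrable_def)
  have "\<bar>f x * g x\<bar> \<le> (f x)\<^sup>2 + (g x)\<^sup>2" for x
  proof -
    have "2 * (\<bar>f x\<bar> * \<bar>g x\<bar>) \<le> (f x)\<^sup>2 + (g x)\<^sup>2"
      using sum_squares_bound[of "\<bar>f x\<bar>" "\<bar>g x\<bar>"] by (simp add: mult.assoc)
    moreover have "0 \<le> \<bar>f x\<bar> * \<bar>g x\<bar>" by simp
    ultimately show ?thesis unfolding abs_mult by linarith
  qed
  then show "AE x in boxm. norm (f x * g x) \<le> norm ((f x)\<^sup>2 + (g x)\<^sup>2)"
    by (intro AE_I2) simp
qed

lemma sq_integrable_add: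
  assumes "sq_integrable f" "sq_integrable g"
  shows "sq_integrable (\<lambda>x. f x + g x)"
proof -
  have "integrable boxm (\<lambda>x. (f x)\<^sup>2 + (g x)\<^sup>2 + 2 * (f x * g x))"
    using assms sq_integrable_mult[OF assms] by (auto simp: sq_integrable_def)
  then have "integrable boxm (\<lambda>x. (f x + g x)\<^sup>2)"
    by (simp add: power2_sum mult.assoc)
  then show ?thesis
    using assms by (auto simp: sq_integrable_def)
qed

lemma sq_integrable_scale: "sq_integrable f \<Longrightarrow> sq_integrable (\<lambda>x. c * f x)"
  by (auto simp: sq_integrable_def power_mult_distrib)

lemma sq_integrable_const: "sq_integrable (\<lambda>x. c)"
  using finite_measure.integrable_const[OF finite_measure_boxm]
  by (auto simp: sq_integrable_def)

quotient_type 'n l2 = "real ^ 'n \<Rightarrow> real" / partial: l2_rel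
proof (rule part_equivpI)
  show "\<exists>f :: real ^ 'n \<Rightarrow> real. l2_rel f f"
    by (rule exI[of _ "\<lambda>x. 0"]) (simp add: l2_rel_def sq_integrable_const)
  show "symp (l2_rel :: (real ^ 'n \<Rightarrow> real) \<Rightarrow> _)"
    by (auto simp: symp_def l2_rel_def elim: AE_mp)
  show "transp (l2_rel :: (real ^ 'n \<Rightarrow> real) \<Rightarrow> _)"
    unfolding transp_def l2_rel_def by (auto elim: AE_mp)
qed

instantiation l2 :: (finite) real_vector
begin

lift_definition zero_l2 :: "'a l2" is "\<lambda>x. 0"
  by (simp add: l2_rel_def sq_integrable_const)

lift_definition plus_l2 :: "'a l2 \<Rightarrow> 'a l2 \<Rightarrow> 'a l2" is "\<lambda>f g x. f x + g x"
  by (auto simp: l2_rel_def intro: sq_integrable_add elim: AE_mp)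

lift_definition uminus_l2 :: "'a l2 \<Rightarrow> 'a l2" is "\<lambda>f x. - f x"
  using sq_integrable_scale[where c = "-1"] by (auto simp: l2_rel_def elim: AE_mp)

lift_definition scaleR_l2 :: "real \<Rightarrow> 'a l2 \<Rightarrow> 'a l2" is "\<lambda>c f x. c * f x"
  by (auto simp: l2_rel_def intro: sq_integrable_scale elim: AE_mp)

definition minus_l2 :: "'a l2 \<Rightarrow> 'a l2 \<Rightarrow> 'a l2" where
  "minus_l2 u v = u + - v"

instance
proof
  fix u v w :: "'a l2" and a b :: real
  show "u + v + w = u + (v + w)"
    by transfer (auto simp: l2_rel_def add.assoc intro!: sq_integrable_add)
  show "u + v = v + u"
    by transfer (auto simp: l2_rel_def add.commute intro!: sq_integrable_add)
  show "0 + u = u"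
    by transfer (auto simp: l2_rel_def)
  show "- u + u = 0"
    by transfer (auto simp: l2_rel_def intro: sq_integrable_const)
  show "u - v = u + - v"
    by (rule minus_l2_def)
  show "a *\<^sub>R (u + v) = a *\<^sub>R u + a *\<^sub>R v"
    by transfer (auto simp: l2_rel_def distrib_left[symmetric] intro!: sq_integrable_add sq_integrable_scale)
  show "(a + b) *\<^sub>R u = a *\<^sub>R u + b *\<^sub>R u"
    by transfer (auto simp: l2_rel_def distrib_right[symmetric] intro!: sq_integrable_add sq_integrable_scale)
  show "a *\<^sub>R b *\<^sub>R u = (a * b) *\<^sub>R u"
    by transfer (auto simp: l2_rel_def mult.assoc[symmetric] intro!: sq_integrable_scale)
  show "1 *\<^sub>R u = u"
    by transfer (auto simp: l2_rel_def)
qed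

end

instantiation l2 :: (finite) real_inner
begin

lift_definition inner_l2 :: "'a l2 \<Rightarrow> 'a l2 \<Rightarrow> real" is "\<lambda>f g. LINT x|boxm. f x * g x"
proof -
  fix f f' g g' :: "real ^ 'a \<Rightarrow> real"
  assume *: "l2_rel f f'" "l2_rel g g'"
  show "(LINT x|boxm. f x * g x) = (LINT x|boxm. f' x * g' x)"
    using * by (intro integral_cong_AE) (auto simp: l2_rel_def sq_integrable_def elim: AE_mp)
qed

definition norm_l2 :: "'a l2 \<Rightarrow> real" where
  "norm_l2 u = sqrt (inner u u)"

definition sgn_l2 :: "'a l2 \<Rightarrow> 'a l2" where
  "sgn_l2 u = u /\<^sub>R norm u"

definition dist_l2 :: "'a l2 \<Rightarrow> 'a l2 \<Rightarrow> real" where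
  "dist_l2 u v = norm (u - v)"

definition uniformity_l2 :: "('a l2 \<times> 'a l2) filter" where
  "uniformity_l2 = (INF e\<in>{0<..}. principal {(u, v). dist u v < e})"

definition open_l2 :: "'a l2 set \<Rightarrow> bool" where
  "open_l2 U = (\<forall>u\<in>U. eventually (\<lambda>(u', v). u' = u \<longrightarrow> v \<in> U) uniformity)"

instance
proof
  fix u v w :: "'a l2" and r :: real and U :: "'a l2 set"
  show "dist u v = norm (u - v)" by (rule dist_l2_def)
  show "sgn u = u /\<^sub>R norm u" by (rule sgn_l2_def)
  show "uniformity = (INF e\<in>{0<..}. principal {(x :: 'a l2, y). dist x y < e})"
    by (rule uniformity_l2_def)
  show "open U = (\<forall>x\<in>U. \<forall>\<^sub>F (x', y) in uniformity. x' = x \<longrightarrow> y \<in> U)"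
    by (rule open_l2_def)
  show "inner u v = inner v u"
    by transfer (simp add: mult.commute)
  show "inner (u + v) w = inner u w + inner v w"
    by transfer (auto simp: l2_rel_def distrib_right sq_integrable_mult
        intro!: Bochner_Integration.integral_add)
  show "inner (r *\<^sub>R u) v = r * inner u v"
    by transfer (simp add: mult.assoc)
  show "0 \<le> inner u u"
    by transfer (simp add: integral_nonneg_AE)
  show "inner u u = 0 \<longleftrightarrow> u = 0"
  proof transfer
    fix f :: "real ^ 'a \<Rightarrow> real"
    assume "l2_rel f f"
    then have f: "sq_integrable f" by (simp add: l2_rel_def)
    have "((LINT x|boxm. f x * f x) = 0) \<longleftrightarrow> (AE x in boxm. f x * f x = 0)"
      by (rule integral_nonneg_eq_0_iff_AE) (use sq_integrable_mult[OF f f] in auto)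
    then show "((LINT x|boxm. f x * f x) = 0) \<longleftrightarrow> l2_rel f (\<lambda>x. 0)"
      using f by (simp add: l2_rel_def sq_integrable_const)
  qed
  show "norm u = sqrt (inner u u)" by (rule norm_l2_def)
qed

end

lift_definition l2_const :: "real \<Rightarrow> 'n::finite l2" is "\<lambda>c x. c"
  by (simp add: l2_rel_def sq_integrable_const)


section \<open>Interfaces and weights\<close>

text \<open>For total functions: all iterated partial derivatives up to order \<open>k\<close> exist and are
  continuous.\<close>

primrec Ck :: "nat \<Rightarrow> ('a::euclidean_space \<Rightarrow> 'b::real_normed_vector) \<Rightarrow> bool" where
  "Ck 0 f \<longleftrightarrow> continuous_on UNIV f"
| "Ck (Suc k) f \<longleftrightarrow> (\<forall>x. f differentiable (at x)) \<and>
     (\<forall>b\<in>Basis. Ck k (\<lambda>x. frechet_derivative f (at x) b))"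

definition smooth :: "('a::euclidean_space \<Rightarrow> 'b::real_normed_vector) \<Rightarrow> bool" where
  "smooth f \<longleftrightarrow> (\<forall>k. Ck k f)"

definition box_periodic :: "(real ^ 'n \<Rightarrow> 'b) \<Rightarrow> bool" where
  "box_periodic f \<longleftrightarrow> (\<forall>x i. f (x + 2 *\<^sub>R axis i 1) = f x)"

definition smooth_closed_curve :: "(real ^ 'n) set \<Rightarrow> bool" where
  "smooth_closed_curve \<Gamma> \<longleftrightarrow> (\<exists>\<gamma> :: real \<Rightarrow> real ^ 'n.
     smooth \<gamma> \<and> (\<forall>t. \<gamma> (t + 1) = \<gamma> t) \<and> inj_on \<gamma> {0..<1} \<and>
     (\<forall>t. vector_derivative \<gamma> (at t) \<noteq> 0) \<and> range \<gamma> = \<Gamma>)"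

definition admissible_interface :: "(real ^ 'n) set \<Rightarrow> bool" where
  "admissible_interface \<Gamma> \<longleftrightarrow>
     (CARD('n) = 1 \<and> \<Gamma> = {\<chi> i. - 1/2, \<chi> i. 1/2}) \<or>
     (CARD('n) = 2 \<and> \<Gamma> \<subseteq> pbox \<and> smooth_closed_curve \<Gamma> \<and>
        (\<exists>\<Omega>. open \<Omega> \<and> connected \<Omega> \<and> bounded \<Omega> \<and> frontier \<Omega> = \<Gamma>))"

definition periodic_translates :: "(real ^ 'n) set \<Rightarrow> (real ^ 'n) set" where
  "periodic_translates \<Gamma> = {x. \<exists>y\<in>\<Gamma>. \<forall>i. (x $ i - y $ i) / 2 \<in> \<int>}"

text \<open>
  \<open>dist_power \<sigma> \<Gamma> x\<close> is \<open>d(x,\<Gamma>)\<^sup>\<sigma>\<close> with the convention that the power is 1 everywhere for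
  \<open>\<sigma> = 0\<close>; note that \<open>0 powr 0 = 0\<close>.
\<close>

definition dist_power :: "real \<Rightarrow> (real ^ 'n) set \<Rightarrow> real ^ 'n \<Rightarrow> real" where
  "dist_power \<sigma> \<Gamma> x = (if \<sigma> = 0 then 1 else infdist x \<Gamma> powr \<sigma>)"

text \<open>
  The class of weights \<open>D\<^sup>\<sigma>\<^sub>\<pi>\<close>. The last two conjuncts render ``otherwise smooth off \<open>\<Gamma>\<close>
  (at least Hoelder continuous of exponent \<open>\<sigma>\<close>)'' by the minimal regularity: local Hoelder
  continuity of exponent \<open>\<sigma>\<close> off \<open>\<Gamma>\<close>, and mere continuity there for \<open>\<sigma> = 0\<close>. Every function
  that is smooth off \<open>\<Gamma>\<close> has it, and so has every function that is continuous off \<open>\<Gamma>\<close> and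
  Hoelder continuous of exponent \<open>\<sigma>\<close> on the whole box.
\<close>

definition weights :: "real \<Rightarrow> (real ^ 'n) set \<Rightarrow> (real ^ 'n \<Rightarrow> real) set" where
  "weights \<sigma> \<Gamma> = {\<alpha>.
     box_periodic \<alpha> \<and> bounded (range \<alpha>) \<and> (\<forall>x. 0 \<le> \<alpha> x) \<and>
     (\<sigma> \<noteq> 0 \<longrightarrow> (\<forall>x\<in>pbox. \<alpha> x = 0 \<longleftrightarrow> x \<in> \<Gamma>)) \<and>
     (\<exists>c\<ge>1. \<forall>x\<in>pbox. (1 / c) * dist_power \<sigma> \<Gamma> x \<le> \<alpha> x \<and> \<alpha> x \<le> c * dist_power \<sigma> \<Gamma> x) \<and>
     continuous_on (- periodic_translates \<Gamma>) \<alpha> \<and>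
     (\<forall>x\<in>- periodic_translates \<Gamma>. \<exists>r>0. \<exists>C. \<forall>y\<in>ball x r. \<forall>z\<in>ball x r.
        \<bar>\<alpha> y - \<alpha> z\<bar> \<le> C * dist y z powr \<sigma>)}"


section \<open>Weighted Sobolev spaces and the operators\<close>

lemma l2_rel_test_integral:
  fixes f f' \<phi> :: "real ^ 'n \<Rightarrow> real"
  assumes rel: "l2_rel f f'" and "smooth \<phi>"
  shows "(LINT x|boxm. f x * frechet_derivative \<phi> (at x) (axis i 1))
      = (LINT x|boxm. f' x * frechet_derivative \<phi> (at x) (axis i 1))"
proof -
  have "Ck (Suc 0) \<phi>" using \<open>smooth \<phi>\<close> unfolding smooth_def by blast
  then have "continuous_on UNIV (\<lambda>x. frechet_derivative \<phi> (at x) (axis i 1))"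
    by (auto simp: axis_in_Basis_iff)
  then have "(\<lambda>x. frechet_derivative \<phi> (at x) (axis i 1)) \<in> borel_measurable borel"
    by (rule borel_measurable_continuous_onI)
  then have "(\<lambda>x. frechet_derivative \<phi> (at x) (axis i 1)) \<in> borel_measurable boxm"
    by (intro measurable_restrict_space1 measurable_completion) simp
  then show ?thesis
    using rel by (intro integral_cong_AE)
      (auto simp: l2_rel_def sq_integrable_def elim: AE_mp)
qed

text \<open>\<open>g\<close> is an integrable function representing the distributional gradient on the torus;
  test functions are smooth periodic functions.\<close>

lift_definition has_weak_gradient :: "'n::finite l2 \<Rightarrow> (real ^ 'n \<Rightarrow> real ^ 'n) \<Rightarrow> bool" is
  "\<lambda>u g. integrable boxm g \<and>
     (\<forall>\<phi> :: real ^ 'n \<Rightarrow> real. smooth \<phi> \<and> box_periodic \<phi> \<longrightarrow>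
        (\<forall>i. (LINT x|boxm. u x * frechet_derivative \<phi> (at x) (axis i 1))
              = - (LINT x|boxm. g x $ i * \<phi> x)))"
  subgoal for f f'
    using l2_rel_test_integral[of f f'] by (auto simp: fun_eq_iff)
  done

text \<open>The gradient is determined up to null sets only; all uses below are under integrals.\<close>

definition grad :: "'n::finite l2 \<Rightarrow> real ^ 'n \<Rightarrow> real ^ 'n" where
  "grad u = (SOME g. has_weak_gradient u g)"

definition H1 :: "(real ^ 'n \<Rightarrow> real) \<Rightarrow> 'n::finite l2 set" where
  "H1 \<alpha> = {u. (\<exists>g. has_weak_gradient u g) \<and> integrable boxm (\<lambda>x. \<alpha> x * (norm (grad u x))\<^sup>2)}"

definition H1_norm :: "(real ^ 'n \<Rightarrow> real) \<Rightarrow> 'n::finite l2 \<Rightarrow> real" where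
  "H1_norm \<alpha> u = sqrt ((norm u)\<^sup>2 + (LINT x|boxm. \<alpha> x * (norm (grad u x))\<^sup>2))"

definition form :: "(real ^ 'n \<Rightarrow> real) \<Rightarrow> 'n::finite l2 \<Rightarrow> 'n l2 \<Rightarrow> real" where
  "form \<alpha> u v = (LINT x|boxm. \<alpha> x * (grad u x \<bullet> grad v x))"

instantiation "fun" :: (type, real_vector) real_vector
begin

definition scaleR_fun :: "real \<Rightarrow> ('a \<Rightarrow> 'b) \<Rightarrow> 'a \<Rightarrow> 'b" where
  "scaleR_fun c f = (\<lambda>x. c *\<^sub>R f x)"

instance
  by standard (auto simp: scaleR_fun_def plus_fun_def fun_eq_iff algebra_simps)

end

definition linear_map_on :: "'x::real_vector set \<Rightarrow> ('x \<Rightarrow> 'y::real_vector) \<Rightarrow> bool" where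
  "linear_map_on S f \<longleftrightarrow>
     (\<forall>x\<in>S. \<forall>y\<in>S. f (x + y) = f x + f y) \<and> (\<forall>c. \<forall>x\<in>S. f (c *\<^sub>R x) = c *\<^sub>R f x)"

text \<open>The dual of \<open>H1 \<alpha>\<close>. Functionals are extended by zero outside \<open>H1 \<alpha>\<close>, so that equality
  in the dual is equality of functions.\<close>

definition Hm1 :: "(real ^ 'n \<Rightarrow> real) \<Rightarrow> ('n::finite l2 \<Rightarrow> real) set" where
  "Hm1 \<alpha> = {F. linear_map_on (H1 \<alpha>) F \<and> (\<exists>C. \<forall>v\<in>H1 \<alpha>. \<bar>F v\<bar> \<le> C * H1_norm \<alpha> v) \<and>
                (\<forall>v. v \<notin> H1 \<alpha> \<longrightarrow> F v = 0)}"

definition Hm1_norm :: "(real ^ 'n \<Rightarrow> real) \<Rightarrow> ('n::finite l2 \<Rightarrow> real) \<Rightarrow> real" where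
  "Hm1_norm \<alpha> F = (SUP v\<in>{v \<in> H1 \<alpha>. H1_norm \<alpha> v \<le> 1}. \<bar>F v\<bar>)"

definition embed_l2 :: "(real ^ 'n \<Rightarrow> real) \<Rightarrow> 'n::finite l2 \<Rightarrow> ('n l2 \<Rightarrow> real)" where
  "embed_l2 \<alpha> u = (\<lambda>v. if v \<in> H1 \<alpha> then u \<bullet> v else 0)"

definition calA :: "(real ^ 'n \<Rightarrow> real) \<Rightarrow> 'n::finite l2 \<Rightarrow> ('n l2 \<Rightarrow> real)" where
  "calA \<alpha> u = (\<lambda>v. if v \<in> H1 \<alpha> then form \<alpha> u v else 0)"

definition H2 :: "(real ^ 'n \<Rightarrow> real) \<Rightarrow> 'n::finite l2 set" where
  "H2 \<alpha> = {u \<in> H1 \<alpha>. \<exists>C. \<forall>v\<in>H1 \<alpha>. \<bar>form \<alpha> u v\<bar> \<le> C * norm v}"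

definition opA :: "(real ^ 'n \<Rightarrow> real) \<Rightarrow> 'n::finite l2 \<Rightarrow> 'n l2" where
  "opA \<alpha> u = (THE f. embed_l2 \<alpha> f = calA \<alpha> u)"

definition H2_norm :: "(real ^ 'n \<Rightarrow> real) \<Rightarrow> 'n::finite l2 \<Rightarrow> real" where
  "H2_norm \<alpha> u = norm u + norm (opA \<alpha> u)"

text \<open>Unbounded operators are given by their graphs. These are the graphs of \<open>- A\<close> and \<open>- \<A>\<close>;
  the domain \<open>H1 \<alpha>\<close> of the latter is regarded as a subspace of the dual via \<open>embed_l2\<close>.\<close>

definition minus_A_graph :: "(real ^ 'n \<Rightarrow> real) \<Rightarrow> ('n::finite l2 \<times> 'n l2) set" where
  "minus_A_graph \<alpha> = {(u, - opA \<alpha> u) | u. u \<in> H2 \<alpha>}"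

definition minus_calA_graph ::
    "(real ^ 'n \<Rightarrow> real) \<Rightarrow> (('n::finite l2 \<Rightarrow> real) \<times> ('n l2 \<Rightarrow> real)) set" where
  "minus_calA_graph \<alpha> = {(embed_l2 \<alpha> u, - calA \<alpha> u) | u. u \<in> H1 \<alpha>}"


section \<open>Semigroups and abstract Cauchy problems\<close>

text \<open>In this section a real normed space is a linear subspace \<open>S\<close> of a real vector space with a
  norm \<open>N\<close> on \<open>S\<close>.\<close>

definition continuous_in ::
    "('x::real_vector \<Rightarrow> real) \<Rightarrow> real set \<Rightarrow> (real \<Rightarrow> 'x) \<Rightarrow> bool" where
  "continuous_in N I u \<longleftrightarrow> (\<forall>t\<in>I. ((\<lambda>s. N (u s - u t)) \<longlongrightarrow> 0) (at t within I))"

definition has_derivative_in ::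
    "('x::real_vector \<Rightarrow> real) \<Rightarrow> (real \<Rightarrow> 'x) \<Rightarrow> 'x \<Rightarrow> real \<Rightarrow> bool" where
  "has_derivative_in N u y t \<longleftrightarrow> ((\<lambda>h. N ((1 / h) *\<^sub>R (u (t + h) - u t) - y)) \<longlongrightarrow> 0) (at 0)"

definition C1_in ::
    "'x::real_vector set \<Rightarrow> ('x \<Rightarrow> real) \<Rightarrow> (real \<Rightarrow> 'x) \<Rightarrow> bool" where
  "C1_in S N u \<longleftrightarrow> (\<exists>u'. (\<forall>t>0. u t \<in> S \<and> u' t \<in> S \<and> has_derivative_in N u (u' t) t) \<and>
     continuous_in N {0<..} u')"

definition C0_semigroup ::
    "'x::real_vector set \<Rightarrow> ('x \<Rightarrow> real) \<Rightarrow> (real \<Rightarrow> 'x \<Rightarrow> 'x) \<Rightarrow> bool" where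
  "C0_semigroup S N T \<longleftrightarrow>
     (\<forall>t\<ge>0. T t ` S \<subseteq> S \<and> linear_map_on S (T t) \<and> (\<exists>K. \<forall>x\<in>S. N (T t x) \<le> K * N x)) \<and>
     (\<forall>x\<in>S. T 0 x = x) \<and>
     (\<forall>s\<ge>0. \<forall>t\<ge>0. \<forall>x\<in>S. T (s + t) x = T s (T t x)) \<and>
     (\<forall>x\<in>S. ((\<lambda>t. N (T t x - x)) \<longlongrightarrow> 0) (at_right 0))"

definition contraction_semigroup ::
    "'x::real_vector set \<Rightarrow> ('x \<Rightarrow> real) \<Rightarrow> (real \<Rightarrow> 'x \<Rightarrow> 'x) \<Rightarrow> bool" where
  "contraction_semigroup S N T \<longleftrightarrow> (\<forall>t\<ge>0. \<forall>x\<in>S. N (T t x) \<le> N x)"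

definition generator ::
    "'x::real_vector set \<Rightarrow> ('x \<Rightarrow> real) \<Rightarrow> (real \<Rightarrow> 'x \<Rightarrow> 'x) \<Rightarrow> ('x \<times> 'x) set" where
  "generator S N T = {(x, y). x \<in> S \<and> y \<in> S \<and>
     ((\<lambda>h. N ((1 / h) *\<^sub>R (T h x - x) - y)) \<longlongrightarrow> 0) (at_right 0)}"

text \<open>The complexification of \<open>S\<close> is \<open>S \<times> S\<close>, the pair \<open>(x, y)\<close> standing for \<open>x + i y\<close>. The
  norm below is the complex Hilbert norm when \<open>N\<close> is a real Hilbert norm.\<close>

definition cscale :: "complex \<Rightarrow> 'x::real_vector \<times> 'x \<Rightarrow> 'x \<times> 'x" where
  "cscale z p = (Re z *\<^sub>R fst p - Im z *\<^sub>R snd p, Im z *\<^sub>R fst p + Re z *\<^sub>R snd p)"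

definition cnorm :: "('x \<Rightarrow> real) \<Rightarrow> 'x \<times> 'x \<Rightarrow> real" where
  "cnorm N p = sqrt ((N (fst p))\<^sup>2 + (N (snd p))\<^sup>2)"

definition bounded_clinear_on ::
    "'x::real_vector set \<Rightarrow> ('x \<Rightarrow> real) \<Rightarrow> ('x \<times> 'x \<Rightarrow> 'x \<times> 'x) \<Rightarrow> bool" where
  "bounded_clinear_on S N L \<longleftrightarrow>
     L ` (S \<times> S) \<subseteq> S \<times> S \<and>
     (\<forall>p\<in>S \<times> S. \<forall>q\<in>S \<times> S. L (p + q) = L p + L q) \<and>
     (\<forall>z. \<forall>p\<in>S \<times> S. L (cscale z p) = cscale z (L p)) \<and>
     (\<exists>K. \<forall>p\<in>S \<times> S. cnorm N (L p) \<le> K * cnorm N p)"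

definition sector :: "real \<Rightarrow> complex set" where
  "sector \<delta> = {z. z \<noteq> 0 \<and> \<bar>Arg z\<bar> < \<delta>}"

text \<open>An analytic semigroup extends, on the complexification, to a sector around the positive
  half-line, holomorphically with respect to the operator norm.\<close>

definition analytic_semigroup ::
    "'x::real_vector set \<Rightarrow> ('x \<Rightarrow> real) \<Rightarrow> (real \<Rightarrow> 'x \<Rightarrow> 'x) \<Rightarrow> bool" where
  "analytic_semigroup S N T \<longleftrightarrow> (\<exists>\<delta> Tc. 0 < \<delta> \<and> \<delta> \<le> pi / 2 \<and>
     (\<forall>z\<in>insert 0 (sector \<delta>). bounded_clinear_on S N (Tc z)) \<and>
     (\<forall>t\<ge>0. \<forall>x\<in>S. \<forall>y\<in>S. Tc (complex_of_real t) (x, y) = (T t x, T t y)) \<and>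
     (\<forall>z\<in>insert 0 (sector \<delta>). \<forall>w\<in>insert 0 (sector \<delta>). \<forall>p\<in>S \<times> S. Tc (z + w) p = Tc z (Tc w p)) \<and>
     (\<forall>p\<in>S \<times> S. ((\<lambda>z. cnorm N (Tc z p - p)) \<longlongrightarrow> 0) (at 0 within sector \<delta>)) \<and>
     (\<forall>z\<in>sector \<delta>. \<exists>L. bounded_clinear_on S N L \<and>
        (\<forall>\<epsilon>>0. \<exists>r>0. \<forall>h. h \<noteq> 0 \<and> cmod h < r \<longrightarrow>
          (\<forall>p\<in>S \<times> S. cnorm N (cscale (1 / h) (Tc (z + h) p - Tc z p) - L p) \<le> \<epsilon> * cnorm N p))))"

definition generates_analytic_contraction_semigroup ::
    "'x::real_vector set \<Rightarrow> ('x \<Rightarrow> real) \<Rightarrow> ('x \<times> 'x) set \<Rightarrow> bool" where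
  "generates_analytic_contraction_semigroup S N G \<longleftrightarrow> (\<exists>T.
     C0_semigroup S N T \<and> contraction_semigroup S N T \<and> analytic_semigroup S N T \<and>
     generator S N T = G)"

text \<open>\<open>u \<in> C([0,\<infinity>), S)\<close> solves \<open>u' = G u\<close> for \<open>t > 0\<close> with \<open>u(0) = u\<^sub>0\<close>, where the operator is
  given by its graph \<open>G\<close>. Values of \<open>u\<close> at negative times are irrelevant.\<close>

definition acp_solution ::
    "'x::real_vector set \<Rightarrow> ('x \<Rightarrow> real) \<Rightarrow> ('x \<times> 'x) set \<Rightarrow> 'x \<Rightarrow> (real \<Rightarrow> 'x) \<Rightarrow> bool" where
  "acp_solution S N G u0 u \<longleftrightarrow>
     (\<forall>t\<ge>0. u t \<in> S) \<and> continuous_in N {0..} u \<and> u 0 = u0 \<and>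
     (\<forall>t>0. \<exists>y. (u t, y) \<in> G \<and> has_derivative_in N u y t)"

end

theory Submission
  imports Defs "HOL-Computational_Algebra.Polynomial" "HOL-Real_Asymp.Real_Asymp"
begin

text \<open>
  Everything is a function of the resolvent \<open>R = (1 + A)\<^sup>-\<^sup>1\<close>, a symmetric operator with \<open>0 \<le> R \<le> 1\<close>.
  Since \<open>A = 1 / R - 1\<close>, the semigroup is \<open>e\<^sup>-\<^sup>z\<^sup>A = f\<^sub>z(R)\<close> with \<open>f\<^sub>z(r) = exp (- z (1 / r - 1))\<close>, and for
  \<open>Re z > 0\<close> this symbol extends continuously by \<open>0\<close> to \<open>r = 0\<close>. The continuous functional calculus
  of \<open>R\<close> thus turns contractivity, the semigroup law, holomorphy and decay into scalar estimates on
  \<open>[0, 1]\<close>; the unbounded operator never enters.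

  The hypothesis \<open>\<sigma> < 1\<close> makes \<open>1 / \<alpha>\<close> integrable, because an \<open>r\<close>-neighbourhood of the interface has
  measure \<open>O(r)\<close>. Hence \<open>u \<mapsto> (u, \<surd>\<alpha> \<nabla>u)\<close> identifies the weighted Sobolev space with a closed subspace \<open>W\<close>
  of a Hilbert space, and both resolvents are compressions of the orthogonal projection onto \<open>W\<close>. The
  dual of the Sobolev space is a unitary copy of \<open>W\<close>, so one abstract theorem covers both cases.
  As \<open>t \<rightarrow> \<infinity>\<close> the semigroup converges to the projection onto the kernel of \<open>1 - R\<close>, which consists
  of the constants since a function with vanishing gradient is orthogonal to all nonconstant waves.
\<close>

subsection \<open>Riesz representation and projections\<close>

text \<open>At r = 0 the symbol of the semigroup jumps from 1 at z = 0 to 0 for z \<noteq> 0, so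
  strong continuity is not a sup-norm estimate on [0, 1]. Strong limits at small times therefore go
  through a dense subspace: on vectors R w the symbol gains a factor r, which cancels the singular 1
  / r - 1, and R has dense range because it is symmetric and injective. The long-time limit uses the
  range of 1 - R in the same way.

  Integrability of 1 / \<alpha> acts twice. Test functions divided by sqrt \<alpha> are square
  integrable, so the weak relation between u and w = sqrt \<alpha> grad u is a family of equalities
  between bounded functionals and survives limits; and w / sqrt \<alpha> is integrable, hence a
  genuine weak gradient.

  On the dual side the functional represented by the pair of u is (1 + A) u. The operator 1 + A thus
  becomes an isometry from the Sobolev space onto its dual, and the resolvent there inverts it and
  embeds the result back into the dual.\<close>

lemma riesz_on_subspace:
  fixes D :: "'k::{real_inner,complete_space} set" and F :: "'k \<Rightarrow> real"
  assumes D: "subspace D"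
    and add: "\<And>x y. x \<in> D \<Longrightarrow> y \<in> D \<Longrightarrow> F (x + y) = F x + F y"
    and scale: "\<And>c x. x \<in> D \<Longrightarrow> F (c *\<^sub>R x) = c * F x"
    and bound: "\<And>x. x \<in> D \<Longrightarrow> \<bar>F x\<bar> \<le> C * norm x"
  obtains f where "f \<in> closure D" "\<And>x. x \<in> D \<Longrightarrow> F x = f \<bullet> x"
proof -
  \<comment> \<open>The representer is the minimiser of this energy. A minimising sequence inside
    \<open>D\<close> allows \<open>D\<close> to be incomplete; only the limit may leave it.\<close>
  define Q where "Q x = x \<bullet> x - 2 * F x" for x
  define m where "m = Inf (Q ` D)"
  have lower: "- C\<^sup>2 \<le> Q x" if "x \<in> D" for x
  proof -
    have "F x \<le> C * norm x" using bound[OF that] by auto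
    moreover have "0 \<le> (norm x - C)\<^sup>2" by simp
    ultimately show ?thesis
      unfolding Q_def by (simp add: power2_norm_eq_inner[symmetric] power2_diff algebra_simps)
  qed
  have bdd: "bdd_below (Q ` D)" using lower by (auto intro!: bdd_belowI2)
  have ne: "Q ` D \<noteq> {}" using subspace_0[OF D] by auto
  have m_le: "m \<le> Q x" if "x \<in> D" for x
    unfolding m_def using bdd that by (auto intro: cInf_lower)
  have "\<exists>x\<in>D. Q x < m + 1 / Suc n" for n
    using cInf_lessD[OF ne, of "m + 1 / Suc n"] unfolding m_def[symmetric] by auto
  then obtain X where X: "\<And>n. X n \<in> D" "\<And>n. Q (X n) < m + 1 / Suc n" by metis
  \<comment> \<open>Parallelogram law at the midpoint: the linear terms cancel, so near-minimisers
    are close to each other.\<close>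
  have midpoint: "(norm (x - y))\<^sup>2 \<le> 2 * (Q x - m) + 2 * (Q y - m)" if "x \<in> D" "y \<in> D" for x y
  proof -
    define z where "z = (1/2) *\<^sub>R (x + y)"
    have "z \<in> D" unfolding z_def using that D by (auto intro: subspace_scale subspace_add)
    then have "m \<le> Q z" by (rule m_le)
    moreover have "F z = (F x + F y) / 2" unfolding z_def using that D
      by (simp add: scale[of "x + y"] subspace_add add)
    moreover have "(norm (x - y))\<^sup>2 = 2 * (x \<bullet> x) + 2 * (y \<bullet> y) - 4 * (z \<bullet> z)"
      unfolding z_def by (simp add: power2_norm_eq_inner inner_diff inner_add inner_commute algebra_simps)
    ultimately show ?thesis unfolding Q_def by (simp add: field_simps)
  qed
  have "Cauchy X"
  proof (rule CauchyI')
    fix e :: real assume "0 < e"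
    then obtain N where N: "4 / (e\<^sup>2) < real (Suc N)"
      using reals_Archimedean2 by (metis less_trans lessI of_nat_less_iff)
    have "norm (X i - X j) < e" if "N \<le> i" "N \<le> j" for i j
    proof -
      have "(norm (X i - X j))\<^sup>2 \<le> 2 * (1 / Suc i) + 2 * (1 / Suc j)"
        using midpoint[OF X(1) X(1), of i j] X(2)[of i] X(2)[of j] by argo
      also have "\<dots> \<le> 4 * (1 / Suc N)"
        using that frac_le[of 1 1 "Suc N" "Suc i"] frac_le[of 1 1 "Suc N" "Suc j"] by simp
      also have "\<dots> < e\<^sup>2" using N \<open>0 < e\<close> by (simp add: field_simps)
      finally show ?thesis using \<open>0 < e\<close> by (meson less_imp_le power2_less_imp_less)
    qed
    then show "\<exists>M. \<forall>m\<ge>M. \<forall>n>m. dist (X m) (X n) < e"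
      unfolding dist_norm by (meson less_imp_le order_trans)
  qed
  then obtain f where f: "X \<longlonglongrightarrow> f" using Cauchy_convergent convergent_def by blast
  have "f \<in> closure D" using f X(1) by (auto simp: closure_sequential)
  moreover have "F v = f \<bullet> v" if v: "v \<in> D" for v
  proof -
    define d where "d = f \<bullet> v - F v"
    \<comment> \<open>First variation of the energy: expand it along the line through
      \<open>X n\<close> in direction v, then let n grow.\<close>
    have key: "0 \<le> 2 * t * d + t\<^sup>2 * (v \<bullet> v)" for t
    proof -
      have "- (1 / Suc n) \<le> 2 * t * (X n \<bullet> v - F v) + t\<^sup>2 * (v \<bullet> v)" for n
      proof -
        have "X n + t *\<^sub>R v \<in> D" using X(1) v D by (auto intro: subspace_scale subspace_add)
        then have "m \<le> Q (X n + t *\<^sub>R v)" by (rule m_le)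
        also have "\<dots> = Q (X n) + 2 * t * (X n \<bullet> v - F v) + t\<^sup>2 * (v \<bullet> v)"
          unfolding Q_def using X(1)[of n] v D
          by (simp add: add scale subspace_scale inner_add inner_commute power2_eq_square algebra_simps)
        finally show ?thesis using X(2)[of n] by linarith
      qed
      moreover have "(\<lambda>n. 2 * t * (X n \<bullet> v - F v) + t\<^sup>2 * (v \<bullet> v)) \<longlonglongrightarrow> 2 * t * d + t\<^sup>2 * (v \<bullet> v)"
        unfolding d_def by (intro tendsto_intros f)
      moreover have "(\<lambda>n. - (1 / real (Suc n))) \<longlonglongrightarrow> - 0"
        by (intro tendsto_minus LIMSEQ_Suc[OF lim_1_over_n])
      ultimately show ?thesis
        by (metis (no_types, lifting) LIMSEQ_le minus_zero)
    qed
    have "d = 0"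
    proof (rule ccontr)
      assume "d \<noteq> 0"
      \<comment> \<open>Since b exceeds \<open>v \<bullet> v\<close> and is never 0, the choice t =
        - d / b makes the quadratic negative even for v = 0.\<close>
      define b where "b = v \<bullet> v + 1"
      have b: "b > 0" "v \<bullet> v < b" unfolding b_def by (auto simp: add_nonneg_pos)
      have "0 \<le> 2 * (- d / b) * d + (- d / b)\<^sup>2 * (v \<bullet> v)" by (rule key)
      also have "\<dots> = (d / b)\<^sup>2 * (v \<bullet> v - 2 * b)"
        using b by (simp add: power2_eq_square field_simps)
      also have "\<dots> < 0" using b \<open>d \<noteq> 0\<close> by (intro mult_pos_neg) auto
      finally show False by simp
    qed
    then show ?thesis unfolding d_def by simp
  qed
  ultimately show ?thesis using that by blast
qed

definition proj :: "'k::{real_inner,complete_space} set \<Rightarrow> 'k \<Rightarrow> 'k" where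
  "proj W x = (SOME p. p \<in> W \<and> (\<forall>v\<in>W. p \<bullet> v = x \<bullet> v))"

text \<open>Riesz applied to the functional \<open>\<lambda>v. x \<bullet> v\<close>. The point p is
  the projection of x onto the closure of D, so D itself may fail to be closed.\<close>

lemma inner_witness:
  fixes D :: "'k::{real_inner,complete_space} set"
  assumes "subspace D"
  obtains p where "p \<in> closure D" "\<And>v. v \<in> D \<Longrightarrow> p \<bullet> v = x \<bullet> v"
  using riesz_on_subspace[OF assms, of "\<lambda>v. x \<bullet> v" "norm x"]
  by (metis inner_add_right inner_scaleR_right Cauchy_Schwarz_ineq2)

lemma
  fixes W :: "'k::{real_inner,complete_space} set"
  assumes "subspace W" "closed W"
  shows proj_in: "proj W x \<in> W" and proj_inner: "v \<in> W \<Longrightarrow> proj W x \<bullet> v = x \<bullet> v"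
proof -
  have "\<exists>p. p \<in> W \<and> (\<forall>v\<in>W. p \<bullet> v = x \<bullet> v)"
    using inner_witness[OF assms(1)] assms(2) by (metis closure_closed)
  then have "proj W x \<in> W \<and> (\<forall>v\<in>W. proj W x \<bullet> v = x \<bullet> v)" unfolding proj_def by (rule someI_ex)
  then show "proj W x \<in> W" "v \<in> W \<Longrightarrow> proj W x \<bullet> v = x \<bullet> v" by auto
qed

lemma proj_unique:
  fixes W :: "'k::{real_inner,complete_space} set"
  assumes "subspace W" "closed W" "p \<in> W" "\<And>v. v \<in> W \<Longrightarrow> p \<bullet> v = x \<bullet> v"
  shows "proj W x = p"
proof -
  have d: "proj W x - p \<in> W" using assms by (auto intro: subspace_diff proj_in)
  have "(proj W x - p) \<bullet> (proj W x - p) = 0"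
    unfolding inner_diff_left using assms(4)[OF d] proj_inner[OF assms(1,2) d] by simp
  then show ?thesis by simp
qed

text \<open>Split off the projection onto the closure of M: the rest lies in W and is orthogonal to
  M, hence 0.\<close>

lemma dense_in_subspace:
  fixes W :: "'k::{real_inner,complete_space} set"
  assumes M: "subspace M" and W: "subspace W" "closed W" and MW: "M \<subseteq> W"
    and orth: "\<And>w. w \<in> W \<Longrightarrow> (\<And>m. m \<in> M \<Longrightarrow> w \<bullet> m = 0) \<Longrightarrow> w = 0"
  shows "W \<subseteq> closure M"
proof
  fix w assume w: "w \<in> W"
  obtain p where p: "p \<in> closure M" "\<And>v. v \<in> M \<Longrightarrow> p \<bullet> v = w \<bullet> v" using inner_witness[OF M] by blast
  have "p \<in> W" using p(1) MW W(2) closure_minimal by blast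
  then have "w - p = 0" using p(2) w W(1) by (intro orth) (auto intro: subspace_diff simp: inner_diff_left)
  then show "w \<in> closure M" using p by simp
qed

text \<open>Equiboundedness plus convergence on a dense set. It carries the limits at time 0, the
  continuity of orbits, the generator and the limit as time tends to infinity. Subtractivity is
  asked of every index, so the families it is applied to are set to 0 at parameters where the symbol
  is not continuous.\<close>

lemma tendsto_zero_on_closure:
  fixes Q :: "'i \<Rightarrow> 'k::real_normed_vector \<Rightarrow> 'm::real_normed_vector"
  assumes diff: "\<And>i x y. Q i (x - y) = Q i x - Q i y"
    and bound: "\<forall>\<^sub>F i in F. \<forall>x. norm (Q i x) \<le> C * norm x"
    and M: "\<And>x. x \<in> M \<Longrightarrow> ((\<lambda>i. Q i x) \<longlongrightarrow> 0) F" and x: "x \<in> closure M"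
  shows "((\<lambda>i. Q i x) \<longlongrightarrow> 0) F"
proof (rule tendstoI)
  fix e :: real assume e: "e > 0"
  \<comment> \<open>The factor \<open>\<bar>C\<bar> + 1\<close> is positive whatever the sign of C,
    and C * d is at most e / 2.\<close>
  define d where "d = e / (2 * (\<bar>C\<bar> + 1))"
  have "d > 0" unfolding d_def using e by simp
  then obtain y where y: "y \<in> M" "dist y x < d" using x by (meson closure_approachable)
  have "\<forall>\<^sub>F i in F. dist (Q i y) 0 < e / 2" using M[OF y(1)] e by (intro tendstoD) auto
  with bound show "\<forall>\<^sub>F i in F. dist (Q i x) 0 < e"
  proof eventually_elim
    case (elim i)
    have "norm (Q i (x - y)) \<le> C * norm (x - y)" using elim by blast
    also have "\<dots> \<le> (\<bar>C\<bar> + 1) * norm (x - y)" by (intro mult_right_mono) auto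
    also have "\<dots> \<le> (\<bar>C\<bar> + 1) * d"
      using y(2) by (intro mult_left_mono) (auto simp: dist_norm norm_minus_commute)
    also have "\<dots> = e / 2" unfolding d_def by (simp add: field_simps)
    finally have "norm (Q i x - Q i y) \<le> e / 2" by (simp add: diff)
    moreover have "norm (Q i x) \<le> norm (Q i x - Q i y) + norm (Q i y)" by norm
    ultimately show ?case using elim by simp
  qed
qed

subsection \<open>Functional calculus of a symmetric operator between 0 and 1\<close>

definition poly_op :: "('k::real_vector \<Rightarrow> 'k) \<Rightarrow> real poly \<Rightarrow> 'k \<Rightarrow> 'k" where
  "poly_op R p x = (\<Sum>i\<le>degree p. coeff p i *\<^sub>R (R ^^ i) x)"

lemma poly_op_altdef:
  assumes "degree p \<le> n"
  shows "poly_op R p x = (\<Sum>i\<le>n. coeff p i *\<^sub>R (R ^^ i) x)"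
  unfolding poly_op_def using assms
  by (intro sum.mono_neutral_left) (auto simp: coeff_eq_0)

lemma poly_op_0 [simp]: "poly_op R 0 x = 0"
  by (simp add: poly_op_def)

lemma poly_op_add: "poly_op R (p + q) x = poly_op R p x + poly_op R q x"
proof -
  let ?n = "max (degree p) (degree q)"
  show ?thesis
    using degree_add_le_max[of p q]
    by (simp add: poly_op_altdef[of _ ?n] scaleR_add_left sum.distrib)
qed

lemma poly_op_smult: "poly_op R (smult c p) x = c *\<^sub>R poly_op R p x"
  using degree_smult_le[of c p]
  by (simp add: poly_op_altdef[of _ "degree p"] scaleR_sum_right)

lemma poly_op_diff: "poly_op R (p - q) x = poly_op R p x - poly_op R q x"
  using poly_op_add[of R p "- q" x] poly_op_smult[of R "- 1" q x] by simp

locale unit_operator =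
  fixes R :: "'k::{real_inner,complete_space} \<Rightarrow> 'k"
  assumes linear: "linear R"
    and sym: "R x \<bullet> y = x \<bullet> R y"
    and nonneg: "0 \<le> R x \<bullet> x"
    and le_id: "R x \<bullet> x \<le> x \<bullet> x"
begin

lemma R_simps [simp]: "R (x + y) = R x + R y" "R (x - y) = R x - R y" "R (c *\<^sub>R x) = c *\<^sub>R R x"
  "R 0 = 0" "R (- x) = - R x" "R (sum f A) = (\<Sum>i\<in>A. R (f i))"
  using linear by (auto simp: linear_add linear_diff linear_scale linear_0 linear_neg linear_sum)

lemma norm_R_le: "norm (R x) \<le> norm x"
proof -
  have "0 \<le> R (x - R x) \<bullet> (x - R x)" "R (R x) \<bullet> R x \<le> R x \<bullet> R x" by (rule nonneg le_id)+
  moreover have "R (x - R x) \<bullet> (x - R x) = R x \<bullet> x - 2 * (R x \<bullet> R x) + R (R x) \<bullet> R x"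
    using sym[of "R x" x] by (simp add: inner_diff)
  ultimately have "R x \<bullet> R x \<le> x \<bullet> x" using le_id[of x] by linarith
  then show ?thesis by (simp add: norm_le)
qed

text \<open>The same two tests, read as R^2 \<le> R. This is the weight t (1 - t) in the positivity
  argument for polynomials, and later the dissipativity of the generator.\<close>

lemma quadratic_nonneg: "0 \<le> (R x - R (R x)) \<bullet> x"
proof -
  have "0 \<le> R (x - R x) \<bullet> (x - R x)" by (rule nonneg)
  moreover have "R (R x) \<bullet> R x \<le> R x \<bullet> R x" by (rule le_id)
  moreover have "R (x - R x) \<bullet> (x - R x) = R x \<bullet> x - 2 * (R x \<bullet> R x) + R (R x) \<bullet> R x"
    using sym[of "R x" x] by (simp add: inner_diff)
  moreover have "(R x - R (R x)) \<bullet> x = R x \<bullet> x - R x \<bullet> R x"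
    by (simp add: inner_diff sym)
  ultimately show ?thesis by linarith
qed

lemma pow_linear: "linear (R ^^ i)"
proof (induction i)
  case (Suc i)
  then show ?case using linear_compose[OF Suc linear] by (simp add: o_def)
qed (simp add: linear_id[unfolded id_def])

lemma poly_op_linear: "linear (poly_op R p)"
  unfolding poly_op_def
  by (intro linear_compose_sum ballI linear_compose_scale_right pow_linear finite_atMost)

lemma poly_op_simps [simp]: "poly_op R p (x + y) = poly_op R p x + poly_op R p y"
  "poly_op R p (x - y) = poly_op R p x - poly_op R p y" "poly_op R p (c *\<^sub>R x) = c *\<^sub>R poly_op R p x"
  "poly_op R p 0 = 0"
  using poly_op_linear by (auto simp: linear_add linear_diff linear_scale linear_0)

lemma poly_op_R: "poly_op R p (R x) = R (poly_op R p x)"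
  unfolding poly_op_def by (simp add: funpow_swap1)

lemma poly_op_pCons: "poly_op R (pCons a p) x = a *\<^sub>R x + R (poly_op R p x)"
proof -
  have "poly_op R (pCons a p) x = (\<Sum>i\<le>Suc (degree p). coeff (pCons a p) i *\<^sub>R (R ^^ i) x)"
    by (intro poly_op_altdef degree_pCons_le)
  also have "\<dots> = a *\<^sub>R x + (\<Sum>i\<le>degree p. coeff p i *\<^sub>R R ((R ^^ i) x))"
    by (subst sum.atMost_Suc_shift) simp
  finally show ?thesis by (simp add: poly_op_def)
qed

lemma poly_op_mult: "poly_op R (p * q) x = poly_op R p (poly_op R q x)"
  by (induction p) (auto simp: poly_op_pCons poly_op_add poly_op_smult)

lemma poly_op_sym: "poly_op R p x \<bullet> y = x \<bullet> poly_op R p y"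
  by (induction p arbitrary: x y) (auto simp: poly_op_pCons inner_add sym poly_op_R)

lemma poly_op_const [simp]: "poly_op R [:c:] x = c *\<^sub>R x"
  by (simp add: poly_op_pCons)

text \<open>Dividing out a root leaves the sign at the root itself undetermined; continuity recovers
  it, as [0, 1] has no isolated points.\<close>

lemma poly_nonneg_punctured:
  fixes p :: "real poly"
  assumes "\<And>t. t \<in> {0..1} \<Longrightarrow> t \<noteq> a \<Longrightarrow> 0 \<le> poly p t" and t: "t \<in> {0..1}"
  shows "0 \<le> poly p t"
proof (cases "t = a")
  case True
  have "trivial_limit (at a within {0..1})  = False"
    using t True by (simp add: trivial_limit_within islimpt_Icc)
  moreover have "((\<lambda>s. poly p s) \<longlongrightarrow> poly p a) (at a within {0..1})"
    by (intro tendsto_intros)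
  moreover have "\<forall>\<^sub>F s in at a within {0..1}. 0 \<le> poly p s"
    using assms(1) by (auto simp: eventually_at_filter)
  ultimately show ?thesis using tendsto_lowerbound True by blast
qed (use assms in auto)

text \<open>The statement is strengthened to the four weights \<open>1, t, 1 - t, t (1 - t)\<close> so that it is
  stable under division by the factor of \<open>q\<close> minus its minimum at the minimum point.\<close>

lemma poly_op_weights_nonneg:
  assumes "\<And>t. t \<in> {0..1} \<Longrightarrow> 0 \<le> poly q t"
  shows "0 \<le> poly_op R q x \<bullet> x \<and> 0 \<le> poly_op R q (R x) \<bullet> x \<and> 0 \<le> poly_op R q (x - R x) \<bullet> x \<and>
    0 \<le> poly_op R q (R x - R (R x)) \<bullet> x"
  using assms
proof (induction "degree q" arbitrary: q x rule: less_induct)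
  case less
  have "\<exists>r\<in>{0..1}. \<forall>t\<in>{0..1}. poly q r \<le> poly q t"
    by (intro continuous_attains_inf) (auto intro: continuous_intros)
  then obtain r where r: "r \<in> {0..1}" and r_min: "\<And>t. t \<in> {0..1} \<Longrightarrow> poly q r \<le> poly q t" by blast
  define m where "m = poly q r"
  have m: "0 \<le> m" unfolding m_def using less.prems r by blast
  have base: "0 \<le> m * (x \<bullet> x)" "0 \<le> m * (R x \<bullet> x)" "0 \<le> m * ((x - R x) \<bullet> x)" "0 \<le> m * ((R x - R (R x)) \<bullet> x)"
    using m nonneg le_id[of x] quadratic_nonneg by (auto simp: inner_diff_left intro!: mult_nonneg_nonneg)
  show ?case
  proof (cases "degree q = 0")
    case True
    then have "q = [:m:]" unfolding m_def by (elim degree_eq_zeroE) simp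
    then show ?thesis using base by (simp add: inner_diff_left right_diff_distrib)
  next
    case False
    have "poly (q - [:m:]) r = 0" unfolding m_def by simp
    then obtain p where p: "q - [:m:] = [:- r, 1:] * p" by (metis poly_eq_0_iff_dvd dvdE)
    have degq: "degree (q - [:m:]) = degree q"
      using False degree_add_eq_left[of "- [:m:]" q] by (simp only: diff_conv_add_uminus) simp
    then have p0: "p \<noteq> 0" using p False by auto
    then have degp: "degree p < degree q" using degq unfolding p by (subst (asm) degree_mult_eq) auto
    have q: "q = [:m:] + [:- r, 1:] * p" using p by (simp add: algebra_simps)
    have pt: "0 \<le> (t - r) * poly p t" if "t \<in> {0..1}" for t
      using r_min[OF that] unfolding m_def[symmetric] by (subst (asm) q) (simp add: algebra_simps)
    \<comment> \<open>After the minimum m is subtracted, the factor t at r = 0, or 1 - t at r = 1,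
      either joins the weight or completes a square that is distributed over both arguments.\<close>
    consider "r = 0" | "r = 1" | "0 < r" "r < 1" using r by fastforce
    then show ?thesis
    proof cases
      case 1
      have "0 \<le> poly p t" if "t \<in> {0..1}" for t
        proof (rule poly_nonneg_punctured[of 0, OF _ that])
        fix t :: real assume "t \<in> {0..1}" "t \<noteq> 0"
        then show "0 \<le> poly p t" using pt[of t] 1 by (auto simp: zero_le_mult_iff)
      qed
      note IH = less.hyps[OF degp this]
      have "poly_op R q y = m *\<^sub>R y + R (poly_op R p y)" for y
        by (subst q) (simp add: 1 poly_op_add poly_op_mult poly_op_pCons)
      then show ?thesis
        using IH[of x] IH[of "R x"] base
        by (auto simp: inner_add inner_diff poly_op_R sym right_diff_distrib)
    next
      case 2
      have "0 \<le> poly (- p) t" if "t \<in> {0..1}" for t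
        proof (rule poly_nonneg_punctured[of 1, OF _ that])
        fix t :: real assume "t \<in> {0..1}" "t \<noteq> 1"
        then show "0 \<le> poly (- p) t" using pt[of t] 2 by (auto simp: zero_le_mult_iff)
      qed
      note IH = less.hyps[OF _ this]
      have "poly_op R q y = m *\<^sub>R y + poly_op R (- p) (y - R y)" for y
        using poly_op_diff[of R 0 p] by (subst q) (simp add: 2 poly_op_add poly_op_diff poly_op_mult poly_op_pCons poly_op_R)
      then show ?thesis
        using IH[of x] IH[of "x - R x"] base degp
        by (auto simp: inner_add inner_diff poly_op_R sym right_diff_distrib)
    next
      case 3
      \<comment> \<open>At an interior minimum, (t - r) p(t) \<ge> 0 makes p nonnegative to the
        right of r and nonpositive to the left, so r is a double root of q - m.\<close>
      have "poly p r = 0"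
      proof -
        have "0 \<le> poly p r"
        proof (rule tendsto_lowerbound)
          show "(poly p \<longlongrightarrow> poly p r) (at_right r)" by (intro tendsto_intros)
          show "\<forall>\<^sub>F t in at_right r. 0 \<le> poly p t"
            using eventually_at_right_real[OF 3(2)]
          proof eventually_elim
            case (elim t)
            then show ?case using pt[of t] 3 by (auto simp: zero_le_mult_iff)
          qed
        qed simp
        moreover have "poly p r \<le> 0"
        proof (rule tendsto_upperbound)
          show "(poly p \<longlongrightarrow> poly p r) (at_left r)" by (intro tendsto_intros)
          show "\<forall>\<^sub>F t in at_left r. poly p t \<le> 0"
            using eventually_at_left_real[OF 3(1)]
          proof eventually_elim
            case (elim t)
            then show ?case using pt[of t] 3 by (auto simp: zero_le_mult_iff)
          qed
        qed simp
        ultimately show ?thesis by simp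
      qed
      then obtain s where s: "p = [:- r, 1:] * s" by (metis poly_eq_0_iff_dvd dvdE)
      have degs: "degree s < degree q" using degp p0 unfolding s by (subst (asm) degree_mult_eq) auto
      have "0 \<le> poly s t" if "t \<in> {0..1}" for t
        proof (rule poly_nonneg_punctured[of r, OF _ that])
        fix t :: real assume "t \<in> {0..1}" "t \<noteq> r"
        moreover from this have "0 \<le> (t - r)\<^sup>2 * poly s t"
          using pt[of t] by (simp add: s power2_eq_square algebra_simps)
        ultimately show "0 \<le> poly s t" by (simp add: zero_le_mult_iff)
      qed
      note IH = less.hyps[OF degs this]
      \<comment> \<open>By symmetry one factor of (t - r)^2 goes to each argument, which leaves s
        with the vector \<open>D x\<close> for all four weights.\<close>
      define D where "D y = R y - r *\<^sub>R y" for y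
      have lin: "poly_op R ([:- r, 1:] * u) y = D (poly_op R u y)" for u y
        by (simp add: D_def poly_op_mult poly_op_pCons del: mult_pCons_left)
      have "poly_op R q y = m *\<^sub>R y + D (D (poly_op R s y))" for y
        by (subst q, subst s) (simp only: poly_op_add lin poly_op_const)
      then have "poly_op R q y = m *\<^sub>R y + D (poly_op R s (D y))" for y
        by (simp add: D_def poly_op_R)
      moreover have "D y \<bullet> z = y \<bullet> D z" for y z by (simp add: D_def inner_diff sym)
      moreover have "D (y - z) = D y - D z" "D (R y) = R (D y)" for y z by (simp_all add: D_def algebra_simps)
      ultimately show ?thesis
        using IH[of "D x"] base by (auto simp: inner_add inner_diff right_diff_distrib)
    qed
  qed
qed

text \<open>The polynomial M^2 - p^2 is nonnegative on [0, 1], so its operator is nonnegative, and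
  symmetry turns this into the norm bound.\<close>

lemma poly_op_norm_le:
  assumes "\<And>t. t \<in> {0..1} \<Longrightarrow> \<bar>poly p t\<bar> \<le> M"
  shows "norm (poly_op R p x) \<le> M * norm x"
proof -
  have "0 \<le> M" using assms[of 0] by auto
  have "0 \<le> poly ([:M\<^sup>2:] - p * p) t" if "t \<in> {0..1}" for t
    using assms[OF that] power_mono[of "\<bar>poly p t\<bar>" M 2] by (simp add: power2_eq_square)
  from poly_op_weights_nonneg[OF this, of x]
  have "0 \<le> (M\<^sup>2 *\<^sub>R x - poly_op R p (poly_op R p x)) \<bullet> x" by (simp add: poly_op_diff poly_op_mult)
  then have "(norm (poly_op R p x))\<^sup>2 \<le> (M * norm x)\<^sup>2"
    by (simp add: inner_diff poly_op_sym power2_norm_eq_inner power_mult_distrib)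
  then show ?thesis using \<open>0 \<le> M\<close> by (meson norm_ge_zero mult_nonneg_nonneg power2_le_imp_le)
qed

lemma poly_op_invariant:
  assumes "subspace W" "\<And>x. x \<in> W \<Longrightarrow> R x \<in> W" "x \<in> W"
  shows "poly_op R p x \<in> W"
  using assms by (induction p) (auto simp: poly_op_pCons intro: subspace_0 subspace_add subspace_scale)

end

lemma polynomial_approximation:
  assumes "continuous_on {0..1::real} f" "e > 0"
  shows "\<exists>p. \<forall>t\<in>{0..1}. \<bar>poly p t - f t\<bar> \<le> e"
proof -
  obtain g where g: "real_polynomial_function g" "\<And>x. x \<in> {0..1} \<Longrightarrow> \<bar>f x - g x\<bar> < e"
    using Stone_Weierstrass_real_polynomial_function[OF compact_Icc assms] by blast
  obtain a n where "g = (\<lambda>x. \<Sum>i\<le>n. a i * x ^ i)"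
    using g(1) real_polynomial_function_iff_sum by metis
  then have "poly (\<Sum>i\<le>n. monom (a i) i) = g" by (simp add: fun_eq_iff poly_sum poly_monom)
  then have "\<bar>poly (\<Sum>i\<le>n. monom (a i) i) t - f t\<bar> \<le> e" if "t \<in> {0..1}" for t
    using g(2)[OF that] by simp
  then show ?thesis by blast
qed

section \<open>Functional calculus for continuous functions\<close>

context unit_operator
begin

text \<open>Characterised by all polynomial approximations at once, so the value depends on no
  chosen sequence and only on f restricted to [0, 1].\<close>

definition Phi :: "(real \<Rightarrow> real) \<Rightarrow> 'k \<Rightarrow> 'k" where
  "Phi f x = (THE y. \<forall>p e. (\<forall>t\<in>{0..1}. \<bar>poly p t - f t\<bar> \<le> e) \<longrightarrow> norm (poly_op R p x - y) \<le> e * norm x)"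

lemma Phi_exists:
  assumes f: "continuous_on {0..1} f"
  shows "\<exists>!y. \<forall>p e. (\<forall>t\<in>{0..1}. \<bar>poly p t - f t\<bar> \<le> e) \<longrightarrow> norm (poly_op R p x - y) \<le> e * norm x"
proof -
  have "\<forall>n. \<exists>p. \<forall>t\<in>{0..1}. \<bar>poly p t - f t\<bar> \<le> 1 / Suc n"
    by (intro allI polynomial_approximation[OF f]) simp
  then obtain P where P: "\<And>n t. t \<in> {0..1} \<Longrightarrow> \<bar>poly (P n) t - f t\<bar> \<le> 1 / Suc n" by metis
  \<comment> \<open>Two approximants differ by a polynomial of size at most
    \<open>e + 1 / Suc n\<close> on [0, 1]; this yields both the Cauchy property and the defining
    bound for the limit.\<close>
  have cmp: "norm (poly_op R p x - poly_op R (P n) x) \<le> (e + 1 / Suc n) * norm x"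
    if "\<forall>t\<in>{0..1}. \<bar>poly p t - f t\<bar> \<le> e" for p e n
  proof -
    have "\<bar>poly (p - P n) t\<bar> \<le> e + 1 / Suc n" if "t \<in> {0..1}" for t
      using P[OF that, of n] \<open>\<forall>t\<in>{0..1}. \<bar>poly p t - f t\<bar> \<le> e\<close> that by fastforce
    from poly_op_norm_le[OF this, of x] show ?thesis by (simp add: poly_op_diff)
  qed
  have lim0: "(\<lambda>n. 1 / real (Suc n)) \<longlonglongrightarrow> 0" by (intro LIMSEQ_Suc[OF lim_1_over_n])
  have "Cauchy (\<lambda>n. poly_op R (P n) x)"
  proof (rule CauchyI')
    fix e :: real assume e: "e > 0"
    have "(\<lambda>n. (1 / real (Suc n) + 1 / Suc n) * norm x) \<longlonglongrightarrow> (0 + 0) * norm x"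
      by (intro tendsto_mult tendsto_add tendsto_const lim0)
    then have "\<forall>\<^sub>F n in sequentially. (1 / real (Suc n) + 1 / Suc n) * norm x < e"
      using e by (intro order_tendstoD(2)[of _ "(0 + 0) * norm x"]) auto
    from eventually_happens'[OF sequentially_bot this]
    obtain N where N: "(1 / real (Suc N) + 1 / Suc N) * norm x < e" by blast
    have "dist (poly_op R (P m) x) (poly_op R (P n) x) < e" if "m \<ge> N" "n \<ge> N" for m n
    proof -
      have "dist (poly_op R (P m) x) (poly_op R (P n) x) \<le> (1 / Suc m + 1 / Suc n) * norm x"
        unfolding dist_norm using P by (intro cmp) auto
      also have "\<dots> \<le> (1 / Suc N + 1 / Suc N) * norm x"
        using that by (intro mult_right_mono add_mono frac_le) auto
      finally show ?thesis using N by simp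
    qed
    then show "\<exists>M. \<forall>m\<ge>M. \<forall>n>m. dist (poly_op R (P m) x) (poly_op R (P n) x) < e"
      by (meson less_imp_le order_trans)
  qed
  then obtain y where y: "(\<lambda>n. poly_op R (P n) x) \<longlonglongrightarrow> y" using Cauchy_convergent convergent_def by blast
  show ?thesis
  proof (rule ex1I[of _ y])
    show "\<forall>p e. (\<forall>t\<in>{0..1}. \<bar>poly p t - f t\<bar> \<le> e) \<longrightarrow> norm (poly_op R p x - y) \<le> e * norm x"
    proof (intro allI impI)
      fix p e assume a: "\<forall>t\<in>{0..1}. \<bar>poly p t - f t\<bar> \<le> e"
      have "(\<lambda>n. norm (poly_op R p x - poly_op R (P n) x)) \<longlonglongrightarrow> norm (poly_op R p x - y)"
        by (intro tendsto_intros y)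
      moreover have "(\<lambda>n. (e + 1 / real (Suc n)) * norm x) \<longlonglongrightarrow> (e + 0) * norm x"
        by (intro tendsto_mult tendsto_add tendsto_const lim0)
      ultimately show "norm (poly_op R p x - y) \<le> e * norm x"
        using cmp[OF a] by (intro LIMSEQ_le[of _ _ _ "e * norm x"]) auto
    qed
  next
    fix z assume z: "\<forall>p e. (\<forall>t\<in>{0..1}. \<bar>poly p t - f t\<bar> \<le> e) \<longrightarrow> norm (poly_op R p x - z) \<le> e * norm x"
    have "(\<lambda>n. 1 / real (Suc n) * norm x) \<longlonglongrightarrow> 0 * norm x"
      by (intro tendsto_mult tendsto_add tendsto_const lim0)
    moreover have "\<forall>\<^sub>F n in sequentially. norm (poly_op R (P n) x - z) \<le> 1 / Suc n * norm x"
      by (intro always_eventually allI z[rule_format] P)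
    ultimately have "(\<lambda>n. poly_op R (P n) x - z) \<longlonglongrightarrow> 0"
      by (intro Lim_null_comparison[of "\<lambda>n. poly_op R (P n) x - z" "\<lambda>n. 1 / Suc n * norm x"]) auto
    then have "(\<lambda>n. poly_op R (P n) x) \<longlonglongrightarrow> z" by (simp add: LIM_zero_iff)
    then show "z = y" by (rule LIMSEQ_unique[OF _ y])
  qed
qed

lemma Phi_approx:
  assumes "continuous_on {0..1} f" "\<And>t. t \<in> {0..1} \<Longrightarrow> \<bar>poly p t - f t\<bar> \<le> e"
  shows "norm (poly_op R p x - Phi f x) \<le> e * norm x"
proof -
  have "\<forall>p e. (\<forall>t\<in>{0..1}. \<bar>poly p t - f t\<bar> \<le> e) \<longrightarrow> norm (poly_op R p x - Phi f x) \<le> e * norm x"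
    unfolding Phi_def by (rule theI'[OF Phi_exists[OF assms(1)]])
  then show ?thesis using assms(2) by simp
qed

lemma Phi_poly: "Phi (poly p) x = poly_op R p x"
  using Phi_approx[of "poly p" p 0 x] by (simp add: continuous_on_poly[OF continuous_on_id])

lemma Phi_cong:
  assumes "\<And>t. t \<in> {0..1} \<Longrightarrow> f t = g t"
  shows "Phi f x = Phi g x"
proof -
  have "(\<forall>t\<in>{0..1}. \<bar>poly p t - f t\<bar> \<le> e) = (\<forall>t\<in>{0..1}. \<bar>poly p t - g t\<bar> \<le> e)" for p e
    by (intro ball_cong refl) (simp only: assms)
  then show ?thesis unfolding Phi_def by (simp only:)
qed

lemma Phi_1: "Phi (\<lambda>t. 1) x = x"
  using Phi_poly[of "[:1:]" x] by (simp cong: Phi_cong)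

lemma Phi_ident: "Phi (\<lambda>t. t) x = R x"
  using Phi_poly[of "[:0, 1:]" x] by (simp add: poly_op_pCons cong: Phi_cong)

lemma Phi_sequence:
  assumes f: "continuous_on {0..1} f"
  obtains P where "\<And>n t. t \<in> {0..1} \<Longrightarrow> \<bar>poly (P n) t - f t\<bar> \<le> 1 / Suc n"
    "\<And>x. (\<lambda>n. poly_op R (P n) x) \<longlonglongrightarrow> Phi f x"
proof -
  have "\<forall>n. \<exists>p. \<forall>t\<in>{0..1}. \<bar>poly p t - f t\<bar> \<le> 1 / Suc n"
    by (intro allI polynomial_approximation[OF f]) simp
  then obtain P where P: "\<And>n t. t \<in> {0..1} \<Longrightarrow> \<bar>poly (P n) t - f t\<bar> \<le> 1 / Suc n" by metis
  have "(\<lambda>n. poly_op R (P n) x) \<longlonglongrightarrow> Phi f x" for x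
  proof (rule LIM_zero_cancel, rule Lim_null_comparison)
    show "\<forall>\<^sub>F n in sequentially. norm (poly_op R (P n) x - Phi f x) \<le> 1 / Suc n * norm x"
      by (intro always_eventually allI Phi_approx[OF f P])
    show "(\<lambda>n. 1 / Suc n * norm x) \<longlonglongrightarrow> 0"
      using tendsto_mult_left_zero[OF LIMSEQ_Suc[OF lim_1_over_n]] by blast
  qed
  with P show ?thesis using that by blast
qed

text \<open>An arbitrary null sequence e is allowed because sums and products of approximants miss
  the rate \<open>1 / Suc n\<close>.\<close>

lemma Phi_unique:
  assumes f: "continuous_on {0..1} f"
    and P: "\<forall>\<^sub>F n in sequentially. \<forall>t\<in>{0..1}. \<bar>poly (P n) t - f t\<bar> \<le> e n" and e: "e \<longlonglongrightarrow> 0"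
    and y: "(\<lambda>n. poly_op R (P n) x) \<longlonglongrightarrow> y"
  shows "Phi f x = y"
proof -
  have "(\<lambda>n. poly_op R (P n) x) \<longlonglongrightarrow> Phi f x"
  proof (rule LIM_zero_cancel, rule Lim_null_comparison)
    show "\<forall>\<^sub>F n in sequentially. norm (poly_op R (P n) x - Phi f x) \<le> e n * norm x"
      using P by eventually_elim (rule Phi_approx[OF f], blast)
    show "(\<lambda>n. e n * norm x) \<longlonglongrightarrow> 0" using tendsto_mult_left_zero[OF e] .
  qed
  then show ?thesis by (rule LIMSEQ_unique[OF _ y])
qed

lemma Phi_linear:
  assumes f: "continuous_on {0..1} f"
  shows "linear (Phi f)"
proof -
  obtain P where P: "\<And>x. (\<lambda>n. poly_op R (P n) x) \<longlonglongrightarrow> Phi f x" using Phi_sequence[OF f] by metis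
  show ?thesis
  proof (rule linearI)
    fix x y c
    have "(\<lambda>n. poly_op R (P n) (x + y)) \<longlonglongrightarrow> Phi f x + Phi f y"
      unfolding poly_op_simps by (intro tendsto_intros P)
    then show "Phi f (x + y) = Phi f x + Phi f y" by (rule LIMSEQ_unique[OF P])
    have "(\<lambda>n. poly_op R (P n) (c *\<^sub>R x)) \<longlonglongrightarrow> c *\<^sub>R Phi f x"
      unfolding poly_op_simps by (intro tendsto_intros P)
    then show "Phi f (c *\<^sub>R x) = c *\<^sub>R Phi f x" by (rule LIMSEQ_unique[OF P])
  qed
qed

lemma Phi_norm_le:
  assumes f: "continuous_on {0..1} f" and M: "\<And>t. t \<in> {0..1} \<Longrightarrow> \<bar>f t\<bar> \<le> M"
  shows "norm (Phi f x) \<le> M * norm x"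
proof -
  obtain P where P: "\<And>n t. t \<in> {0..1} \<Longrightarrow> \<bar>poly (P n) t - f t\<bar> \<le> 1 / Suc n"
    "\<And>x. (\<lambda>n. poly_op R (P n) x) \<longlonglongrightarrow> Phi f x" using Phi_sequence[OF f] by metis
  have "norm (poly_op R (P n) x) \<le> (M + 1 / Suc n) * norm x" for n
    using P(1)[of _ n] M by (intro poly_op_norm_le) fastforce
  moreover have "(\<lambda>n. (M + 1 / real (Suc n)) * norm x) \<longlonglongrightarrow> (M + 0) * norm x"
    by (intro tendsto_mult tendsto_add tendsto_const LIMSEQ_Suc[OF lim_1_over_n])
  moreover have "(\<lambda>n. norm (poly_op R (P n) x)) \<longlonglongrightarrow> norm (Phi f x)" by (intro tendsto_intros P)
  ultimately show ?thesis by (intro LIMSEQ_le[of _ _ _ "M * norm x"]) auto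
qed

lemma Phi_sym:
  assumes f: "continuous_on {0..1} f"
  shows "Phi f x \<bullet> y = x \<bullet> Phi f y"
proof -
  obtain P where P: "\<And>x. (\<lambda>n. poly_op R (P n) x) \<longlonglongrightarrow> Phi f x" using Phi_sequence[OF f] by metis
  have "(\<lambda>n. poly_op R (P n) x \<bullet> y) \<longlonglongrightarrow> Phi f x \<bullet> y" "(\<lambda>n. x \<bullet> poly_op R (P n) y) \<longlonglongrightarrow> x \<bullet> Phi f y"
    by (intro tendsto_intros P)+
  then show ?thesis unfolding poly_op_sym by (rule LIMSEQ_unique)
qed

lemma Phi_add:
  assumes f: "continuous_on {0..1} f" and g: "continuous_on {0..1} g"
  shows "Phi (\<lambda>t. f t + g t) x = Phi f x + Phi g x"
proof -
  obtain P where P: "\<And>n t. t \<in> {0..1} \<Longrightarrow> \<bar>poly (P n) t - f t\<bar> \<le> 1 / Suc n"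
    "\<And>x. (\<lambda>n. poly_op R (P n) x) \<longlonglongrightarrow> Phi f x" using Phi_sequence[OF f] by metis
  obtain Q where Q: "\<And>n t. t \<in> {0..1} \<Longrightarrow> \<bar>poly (Q n) t - g t\<bar> \<le> 1 / Suc n"
    "\<And>x. (\<lambda>n. poly_op R (Q n) x) \<longlonglongrightarrow> Phi g x" using Phi_sequence[OF g] by metis
  show ?thesis
  proof (rule Phi_unique[where P = "\<lambda>n. P n + Q n"])
    show "(\<lambda>n. 1 / real (Suc n) + 1 / Suc n) \<longlonglongrightarrow> 0"
      using tendsto_add[OF LIMSEQ_Suc[OF lim_1_over_n] LIMSEQ_Suc[OF lim_1_over_n]] by simp
    show "\<forall>\<^sub>F n in sequentially. \<forall>t\<in>{0..1}. \<bar>poly (P n + Q n) t - (f t + g t)\<bar> \<le> 1 / Suc n + 1 / Suc n"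
      unfolding poly_add by (intro always_eventually allI ballI) (smt (verit) P(1) Q(1))
    show "(\<lambda>n. poly_op R (P n + Q n) x) \<longlonglongrightarrow> Phi f x + Phi g x"
      unfolding poly_op_add by (intro tendsto_intros P Q)
  qed (intro continuous_intros f g)
qed

lemma Phi_mult:
  assumes f: "continuous_on {0..1} f" and g: "continuous_on {0..1} g"
  shows "Phi (\<lambda>t. f t * g t) x = Phi f (Phi g x)"
proof -
  obtain P where P: "\<And>n t. t \<in> {0..1} \<Longrightarrow> \<bar>poly (P n) t - f t\<bar> \<le> 1 / Suc n"
    "\<And>x. (\<lambda>n. poly_op R (P n) x) \<longlonglongrightarrow> Phi f x" using Phi_sequence[OF f] by metis
  obtain Q where Q: "\<And>n t. t \<in> {0..1} \<Longrightarrow> \<bar>poly (Q n) t - g t\<bar> \<le> 1 / Suc n"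
    "\<And>x. (\<lambda>n. poly_op R (Q n) x) \<longlonglongrightarrow> Phi g x" using Phi_sequence[OF g] by metis
  have "bounded (f ` {0..1})" "bounded (g ` {0..1})"
    by (intro compact_imp_bounded compact_continuous_image f g compact_Icc)+
  then obtain A B where A: "\<And>t. t \<in> {0..1} \<Longrightarrow> \<bar>f t\<bar> \<le> A" and B: "\<And>t. t \<in> {0..1} \<Longrightarrow> \<bar>g t\<bar> \<le> B"
    unfolding bounded_iff real_norm_def by fast
  \<comment> \<open>Uniform boundedness of the approximants serves twice: for the sup-norm error of
    the product and for the norms of the operators \<open>poly_op R (P n)\<close>.\<close>
  have P_le: "\<bar>poly (P n) t\<bar> \<le> A + 1" if "t \<in> {0..1}" for n t
  proof -
    have "\<bar>poly (P n) t\<bar> \<le> A + 1 / Suc n" using P(1)[OF that, of n] A[OF that] by linarith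
    also have "\<dots> \<le> A + 1" by (intro add_left_mono) (simp add: divide_le_eq)
    finally show ?thesis .
  qed
  show ?thesis
  proof (rule Phi_unique[where P = "\<lambda>n. P n * Q n"])
    show "(\<lambda>n. (A + 1) * (1 / real (Suc n)) + 1 / Suc n * B) \<longlonglongrightarrow> 0"
      using tendsto_add[OF tendsto_mult_right_zero[OF LIMSEQ_Suc[OF lim_1_over_n]]
          tendsto_mult_left_zero[OF LIMSEQ_Suc[OF lim_1_over_n]]] by simp
    have "\<bar>poly (P n * Q n) t - f t * g t\<bar> \<le> (A + 1) * (1 / Suc n) + 1 / Suc n * B"
      if t: "t \<in> {0..1}" for n t
    proof -
      have "poly (P n * Q n) t - f t * g t
          = poly (P n) t * (poly (Q n) t - g t) + (poly (P n) t - f t) * g t"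
        by (simp add: algebra_simps)
      also have "\<bar>\<dots>\<bar> \<le> \<bar>poly (P n) t\<bar> * \<bar>poly (Q n) t - g t\<bar> + \<bar>poly (P n) t - f t\<bar> * \<bar>g t\<bar>"
        unfolding abs_mult[symmetric] by (rule abs_triangle_ineq)
      also have "\<dots> \<le> (A + 1) * (1 / Suc n) + 1 / Suc n * B"
      proof -
        have "0 \<le> A" using A[OF t] by linarith
        then show ?thesis
          by (intro add_mono mult_mono P(1) Q(1) t P_le B) auto
      qed
      finally show ?thesis .
    qed
    then show "\<forall>\<^sub>F n in sequentially. \<forall>t\<in>{0..1}. \<bar>poly (P n * Q n) t - f t * g t\<bar>
        \<le> (A + 1) * (1 / Suc n) + 1 / Suc n * B"
      by (intro always_eventually) blast
    have "(\<lambda>n. poly_op R (P n) (poly_op R (Q n) x - Phi g x)) \<longlonglongrightarrow> 0"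
    proof (rule Lim_null_comparison)
      show "\<forall>\<^sub>F n in sequentially. norm (poly_op R (P n) (poly_op R (Q n) x - Phi g x))
          \<le> (A + 1) * norm (poly_op R (Q n) x - Phi g x)"
        by (intro always_eventually allI poly_op_norm_le P_le)
      show "(\<lambda>n. (A + 1) * norm (poly_op R (Q n) x - Phi g x)) \<longlonglongrightarrow> 0"
        by (intro tendsto_mult_right_zero tendsto_norm_zero LIM_zero Q)
    qed
    from tendsto_add[OF this P(2)[of "Phi g x"]]
    show "(\<lambda>n. poly_op R (P n * Q n) x) \<longlonglongrightarrow> Phi f (Phi g x)"
      by (simp add: poly_op_mult)
  qed (intro continuous_intros f g)
qed

lemma Phi_scale:
  assumes f: "continuous_on {0..1} f"
  shows "Phi (\<lambda>t. c * f t) x = c *\<^sub>R Phi f x"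
  using Phi_mult[OF _ f, of "\<lambda>t. c"] Phi_poly[of "[:c:]" "Phi f x"] by (simp cong: Phi_cong)

lemma Phi_diff:
  assumes f: "continuous_on {0..1} f" and g: "continuous_on {0..1} g"
  shows "Phi (\<lambda>t. f t - g t) x = Phi f x - Phi g x"
  using Phi_add[OF f, of "\<lambda>t. - 1 * g t"] Phi_scale[OF g, of "- 1"] g by (simp add: continuous_intros)

lemma Phi_invariant:
  assumes f: "continuous_on {0..1} f"
    and W: "subspace W" "closed W" "\<And>x. x \<in> W \<Longrightarrow> R x \<in> W" and x: "x \<in> W"
  shows "Phi f x \<in> W"
proof -
  obtain P where P: "\<And>x. (\<lambda>n. poly_op R (P n) x) \<longlonglongrightarrow> Phi f x" using Phi_sequence[OF f] by metis
  show ?thesis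
    using closed_sequentially[OF W(2) _ P] poly_op_invariant[OF W(1,3) x] by blast
qed

end

subsection \<open>The semigroup generated through a resolvent\<close>

lemma continuous_on_extend_by_0:
  fixes g :: "real \<Rightarrow> 'b::real_normed_vector"
  assumes g: "continuous_on {0<..1} g" and lim: "(g \<longlongrightarrow> 0) (at_right 0)"
  shows "continuous_on {0..1} (\<lambda>r. if r = 0 then 0 else g r)"
  unfolding continuous_on_def
proof
  fix x :: real assume x: "x \<in> {0..1}"
  let ?f = "\<lambda>r. if r = 0 then 0 else g r"
  show "(?f \<longlongrightarrow> ?f x) (at x within {0..1})"
  proof (cases "x = 0")
    case True
    have "at 0 within {0..1} = at (0::real) within {0<..1}"
    proof -
      have "{0..1} - {0::real} = {0<..1} - {0}" by auto
      then show ?thesis by (simp add: at_within_def)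
    qed
    then have "(g \<longlongrightarrow> 0) (at 0 within {0..1})" using tendsto_within_subset[OF lim, of "{0<..1}"] by (simp add: subset_iff)
    then have "(?f \<longlongrightarrow> 0) (at 0 within {0..1})"
      by (rule Lim_transform_eventually) (auto simp: eventually_at_filter)
    then show ?thesis using True by simp
  next
    case False
    have "continuous_on {0<..1} ?f" using g by (rule continuous_on_eq) auto
    then have "(?f \<longlongrightarrow> ?f x) (at x within {0<..1})" using x False unfolding continuous_on_def by auto
    moreover have "at x within {0..1} = at x within {0<..1}"
      by (rule at_within_nhd[of _ "{0<..}"]) (use x False in auto)
    ultimately show ?thesis by simp
  qed
qed

text \<open>With \<open>R = (1 + A)\<^sup>-\<^sup>1\<close> one has \<open>A = 1 / R - 1\<close>; hence \<open>heat z\<close> and \<open>heat' z\<close> are the symbols of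
  \<open>e\<^sup>-\<^sup>z\<^sup>A\<close> and \<open>A e\<^sup>-\<^sup>z\<^sup>A\<close> as functions of \<open>R\<close>.\<close>

definition heat :: "complex \<Rightarrow> real \<Rightarrow> complex" where
  "heat z r = (if z = 0 then 1 else if r = 0 then 0 else exp (- z * of_real (1 / r - 1)))"

definition heat' :: "complex \<Rightarrow> real \<Rightarrow> complex" where
  "heat' z r = (if r = 0 then 0 else of_real (1 / r - 1) * exp (- z * of_real (1 / r - 1)))"

text \<open>The point 0 is adjoined for the identity. The rest of the imaginary axis stays out:
  there the symbol oscillates as r tends to 0.\<close>

abbreviation "half_plane \<equiv> insert 0 {z. 0 < Re z}"

lemma continuous_heat:
  assumes "z \<in> half_plane"
  shows "continuous_on {0..1} (heat z)"
proof (cases "z = 0")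
  case False
  then have z: "Re z > 0" using assms by auto
  have "((\<lambda>r. exp (- z * of_real (1 / r - 1))) \<longlongrightarrow> 0) (at_right 0)"
  proof (rule tendsto_norm_zero_cancel)
    have "((\<lambda>r::real. exp (- Re z * (1 / r - 1))) \<longlongrightarrow> 0) (at_right 0)" using z by real_asymp
    then show "((\<lambda>r. norm (exp (- z * complex_of_real (1 / r - 1)))) \<longlongrightarrow> 0) (at_right 0)"
      by (simp add: norm_exp_eq_Re)
  qed
  moreover have "continuous_on {0<..1} (\<lambda>r. exp (- z * of_real (1 / r - 1)))"
    by (intro continuous_intros) auto
  ultimately have "continuous_on {0..1} (\<lambda>r. if r = 0 then 0 else exp (- z * of_real (1 / r - 1)))"
    by (intro continuous_on_extend_by_0)
  then show ?thesis unfolding heat_def using False by simp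
qed (simp add: heat_def)

lemma continuous_heat':
  assumes "0 < Re z"
  shows "continuous_on {0..1} (heat' z)"
  unfolding heat'_def
proof (rule continuous_on_extend_by_0)
  show "((\<lambda>r. of_real (1 / r - 1) * exp (- z * of_real (1 / r - 1))) \<longlongrightarrow> 0) (at_right 0)"
  proof (rule tendsto_norm_zero_cancel)
    have "((\<lambda>r::real. \<bar>1 / r - 1\<bar> * exp (- Re z * (1 / r - 1))) \<longlongrightarrow> 0) (at_right 0)" using assms by real_asymp
    then show "((\<lambda>r. norm (of_real (1 / r - 1) * exp (- z * complex_of_real (1 / r - 1)))) \<longlongrightarrow> 0) (at_right 0)"
      by (simp add: norm_mult norm_exp_eq_Re norm_of_real del: of_real_diff of_real_divide)
  qed
  show "continuous_on {0<..1} (\<lambda>r. of_real (1 / r - 1) * exp (- z * of_real (1 / r - 1)))"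
    by (intro continuous_intros) auto
qed

lemma norm_heat_le_1:
  assumes "z \<in> half_plane" "r \<in> {0..1}"
  shows "norm (heat z r) \<le> 1"
  using assms by (auto simp: heat_def norm_exp_eq_Re mult_nonneg_nonneg)

lemma heat_add:
  assumes "z \<in> half_plane" "w \<in> half_plane"
  shows "heat (z + w) r = heat z r * heat w r"
proof (cases "z = 0 \<or> w = 0")
  case False
  then have "Re (z + w) > 0" using assms by auto
  then have "z + w \<noteq> 0" by (metis less_irrefl zero_complex.simps(1))
  have "exp (- (z + w) * c) = exp (- z * c) * exp (- w * c)" for c
    by (simp add: exp_add[symmetric] algebra_simps)
  then show ?thesis
    using False \<open>z + w \<noteq> 0\<close> by (cases "r = 0") (simp add: heat_def, simp only: heat_def if_False de_Morgan_disj)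
qed (auto simp: heat_def)

text \<open>Mean value bound on the left half-plane, where the derivative of exp has modulus at most
  1.\<close>

lemma norm_exp_diff_le:
  assumes "0 \<le> Re z"
  shows "norm (exp (- z) - 1) \<le> norm z"
proof -
  have "norm (exp (- z) - exp 0) \<le> 1 * norm (- z - 0)"
  proof (rule field_differentiable_bound[of "{w. Re w \<le> 0}" exp exp])
    show "convex {w. Re w \<le> 0}" using convex_halfspace_Re_le[of 0] .
  qed (use assms in \<open>auto intro: has_field_derivative_at_within[OF DERIV_exp] simp: norm_exp_eq_Re\<close>)
  then show ?thesis by simp
qed

text \<open>Without the factor r there is no such bound, since \<open>heat z 0 - 1\<close> is -1 for
  all z \<noteq> 0. The factor, supplied by vectors in the range of R, cancels the singularity: |z|
  (1 / r - 1) r = |z| (1 - r).\<close>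

lemma heat_diff_1:
  assumes z: "z \<in> half_plane" and r: "r \<in> {0..1}"
  shows "norm ((heat z r - 1) * of_real r) \<le> norm z"
proof (cases "z = 0 \<or> r = 0")
  case False
  then have z0: "Re z > 0" and r0: "r > 0" and s: "0 \<le> 1 / r - 1" using z r by auto
  have "norm (heat z r - 1) \<le> norm (z * of_real (1 / r - 1))"
    using norm_exp_diff_le[of "z * of_real (1 / r - 1)"] False z0 s by (simp add: heat_def)
  then have "norm ((heat z r - 1) * of_real r) \<le> norm (z * of_real (1 / r - 1)) * r"
    using r0 by (simp add: norm_mult)
  also have "\<dots> = norm z * ((1 / r - 1) * r)" using s unfolding norm_mult norm_of_real by simp
  also have "(1 / r - 1) * r = 1 - r" using r0 by (simp add: field_simps)
  also have "norm z * (1 - r) \<le> norm z * 1" using r by (intro mult_left_mono) auto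
  finally show ?thesis by simp
qed (auto simp: heat_def)

text \<open>Uniformity in r is what gives differentiability in operator norm. With s = 1 / r - 1 the
  Taylor remainder is at most |h| s^2 exp (- (Re z - |h|) s), and for |h| < Re z / 2 the exponential
  absorbs s^2.\<close>

lemma heat_has_derivative:
  assumes z: "0 < Re z" and e: "0 < e"
  obtains d where "d > 0" "d \<le> Re z / 2"
    "\<And>(h::complex) r. h \<noteq> 0 \<Longrightarrow> norm h < d \<Longrightarrow> r \<in> {0..1} \<Longrightarrow> norm ((heat (z + h) r - heat z r) / h + heat' z r) \<le> e"
proof
  define a where "a = Re z"
  \<comment> \<open>The first bound keeps half of the decay rate, and s^2 exp (- a s / 2) \<le> 8 /
    a^2; the second then makes |h| * 8 / a^2 at most e.\<close>
  define d where "d = min (a / 2) (e * a\<^sup>2 / 8)"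
  show "d > 0" "d \<le> Re z / 2" using z e by (auto simp: d_def a_def)
  fix h :: complex and r assume h: "h \<noteq> 0" "norm h < d" and r: "r \<in> {0..1::real}"
  have a: "a > 0" using z by (simp add: a_def)
  have "\<bar>Re h\<bar> < a" using abs_Re_le_cmod[of h] h a unfolding d_def by linarith
  then have "Re (z + h) > 0" by (simp add: a_def)
  then have zh: "z \<noteq> 0" "z + h \<noteq> 0" using z by (metis less_irrefl zero_complex.simps(1))+
  show "norm ((heat (z + h) r - heat z r) / h + heat' z r) \<le> e"
  proof (cases "r = 0")
    case False
    define s where "s = 1 / r - 1"
    have s: "0 \<le> s" using r False unfolding s_def by auto
    define w where "w = - h * of_real s"
    have nw: "norm w = norm h * s" using s unfolding w_def by (simp add: norm_mult)
    have "(heat (z + h) r - heat z r) / h + heat' z r = exp (- z * of_real s) * ((exp w - (1 + w)) / h)"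
      using False zh h unfolding heat_def heat'_def s_def[symmetric] w_def
      by (simp add: field_simps exp_add[symmetric])
    also have "norm \<dots> = exp (- a * s) * (norm (exp w - (1 + w)) / norm h)"
      by (simp add: norm_mult norm_divide norm_exp_eq_Re a_def)
    also have "norm (exp w - (1 + w)) \<le> exp (norm w) * norm w ^ 2"
      using Taylor_exp_field[of w 1] by (simp add: power2_eq_square)
    also have "exp (- a * s) * (exp (norm w) * norm w ^ 2 / norm h) = norm h * (s\<^sup>2 * exp (- (a - norm h) * s))"
      using h(1) unfolding nw by (simp add: power2_eq_square exp_add[symmetric] algebra_simps)
    also have "\<dots> \<le> norm h * (8 / a\<^sup>2)"
    proof (rule mult_left_mono)
      have "(a * s / 2)\<^sup>2 / 2 \<le> exp (a * s / 2)"
      proof -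
        have "0 \<le> a * s / 2" using a s by simp
        then show ?thesis using exp_lower_Taylor_quadratic[of "a * s / 2"] by linarith
      qed
      also have "\<dots> \<le> exp ((a - norm h) * s)"
      proof -
        have "a / 2 * s \<le> (a - norm h) * s" using h(2) s unfolding d_def by (intro mult_right_mono) auto
        then show ?thesis by simp
      qed
      finally have "s\<^sup>2 \<le> 8 / a\<^sup>2 * exp ((a - norm h) * s)" using a by (simp add: field_simps power2_eq_square)
      then have "s\<^sup>2 * exp (- (a - norm h) * s) \<le> 8 / a\<^sup>2 * exp ((a - norm h) * s) * exp (- (a - norm h) * s)"
        by (intro mult_right_mono) auto
      also have "\<dots> = 8 / a\<^sup>2" by (simp add: mult.assoc exp_add[symmetric] left_diff_distrib)
      finally show "s\<^sup>2 * exp (- (a - norm h) * s) \<le> 8 / a\<^sup>2" .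
    qed simp
    also have "\<dots> \<le> (e * a\<^sup>2 / 8) * (8 / a\<^sup>2)" using h(2) by (intro mult_right_mono) (auto simp: d_def)
    also have "\<dots> = e" using a by simp
    finally show ?thesis by (simp add: divide_right_mono mult_left_mono)
  qed (use zh e in \<open>auto simp: heat_def heat'_def\<close>)
qed

section \<open>Scalar estimates at real times\<close>

definition rheat :: "real \<Rightarrow> real \<Rightarrow> real" where
  "rheat t r = (if t = 0 then 1 else if r = 0 then 0 else exp (- t * (1 / r - 1)))"

lemma heat_of_real: "heat (of_real t) r = of_real (rheat t r)"
  by (simp add: heat_def rheat_def exp_of_real[symmetric])

lemma of_real_half_plane: "0 \<le> t \<Longrightarrow> complex_of_real t \<in> half_plane"
  by (auto simp: order_le_less)

lemma continuous_rheat: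
  assumes "0 \<le> t"
  shows "continuous_on {0..1} (rheat t)"
proof -
  have "continuous_on {0..1} (\<lambda>r. Re (heat (of_real t) r))"
    using assms by (intro continuous_on_Re continuous_heat) auto
  then show ?thesis by (simp add: heat_of_real)
qed

lemma rheat_bounds:
  assumes "0 \<le> t" "r \<in> {0..1}"
  shows "\<bar>rheat t r\<bar> \<le> 1"
  using norm_heat_le_1[OF of_real_half_plane assms(2)] assms(1) unfolding heat_of_real norm_of_real by blast

lemma rheat_add: "0 \<le> s \<Longrightarrow> 0 \<le> t \<Longrightarrow> rheat (s + t) r = rheat s r * rheat t r"
  using heat_add[OF of_real_half_plane of_real_half_plane, of s t r]
  unfolding of_real_add[symmetric] heat_of_real of_real_mult[symmetric] of_real_eq_iff by blast

text \<open>The semigroup law and the contraction bound reduce two times to a difference from time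
  0, where \<open>heat_diff_1\<close> applies.\<close>

lemma rheat_diff:
  assumes "0 \<le> s" "0 \<le> t" and r: "r \<in> {0..1}"
  shows "\<bar>(rheat s r - rheat t r) * r\<bar> \<le> \<bar>s - t\<bar>"
  using assms(1,2)
proof (induction s t rule: linorder_wlog)
  case (le s t)
  have "rheat t r = rheat s r * rheat (t - s) r" using rheat_add[of s "t - s" r] le by simp
  then have "\<bar>(rheat s r - rheat t r) * r\<bar> = \<bar>rheat s r\<bar> * \<bar>(rheat (t - s) r - 1) * r\<bar>"
    unfolding abs_mult[symmetric] by (simp add: algebra_simps abs_minus_commute)
  also have "\<dots> \<le> 1 * \<bar>t - s\<bar>"
  proof (intro mult_mono)
    show "\<bar>(rheat (t - s) r - 1) * r\<bar> \<le> \<bar>t - s\<bar>"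
    proof -
      have "(complex_of_real (rheat (t - s) r) - 1) * of_real r = of_real ((rheat (t - s) r - 1) * r)"
        by simp
      then have "norm ((complex_of_real (rheat (t - s) r) - 1) * of_real r) = \<bar>(rheat (t - s) r - 1) * r\<bar>"
        by (simp only: norm_of_real)
      then show ?thesis
        using heat_diff_1[OF of_real_half_plane r, of "t - s"] le(1) unfolding heat_of_real norm_of_real by simp
    qed
  qed (use rheat_bounds le r in auto)
  finally show ?case by simp
next
  case (sym s t)
  have "\<bar>(rheat t r - rheat s r) * r\<bar> \<le> \<bar>t - s\<bar>" using sym by blast
  then show ?case unfolding abs_mult by (metis abs_minus_commute)
qed

text \<open>The symbol of the difference quotient on R w is compared with r - 1, the symbol of - A
  R. The error stays bounded and becomes O(h) after one more factor r, as an approximation by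
  vectors in the range of R requires.\<close>

lemma rheat_generator:
  assumes h: "0 < h" and r: "r \<in> {0..1}"
  shows "\<bar>(rheat h r - 1) * r / h - (r - 1)\<bar> \<le> 1" "\<bar>((rheat h r - 1) * r / h - (r - 1)) * r\<bar> \<le> h"
proof -
  have "\<bar>(rheat h r - 1) * r / h - (r - 1)\<bar> \<le> 1 \<and> \<bar>((rheat h r - 1) * r / h - (r - 1)) * r\<bar> \<le> h"
  proof (cases "r = 0")
    case True
    then show ?thesis using h by (simp add: rheat_def)
  next
    case False
    define s where "s = 1 / r - 1"
    have s: "0 \<le> s" "s * r = 1 - r" using r False unfolding s_def by (auto simp: field_simps)
    \<comment> \<open>This remainder satisfies 0 \<le> q \<le> s and q \<le> h s^2. Since s r = 1 -
      r, the two upper bounds give q r \<le> 1 and q r^2 \<le> h.\<close>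
    define q where "q = (exp (- (h * s)) - 1 + h * s) / h"
    have eq: "(rheat h r - 1) * r / h - (r - 1) = q * r"
    proof -
      have "q * r = (exp (- (h * s)) - 1) * r / h + s * r" using h unfolding q_def by (simp add: field_simps)
      then show ?thesis using h False s(2) unfolding rheat_def s_def[symmetric] by simp
    qed
    have q0: "0 \<le> q" using exp_ge_add_one_self[of "- (h * s)"] h unfolding q_def by simp
    have "q \<le> s" using h s unfolding q_def by (simp add: divide_le_eq mult.commute)
    then have "q * r \<le> s * r" using r by (intro mult_right_mono) auto
    then have qr: "q * r \<le> 1" using s(2) r by auto
    \<comment> \<open>Uses exp (- x) \<le> 1 / (1 + x) \<le> 1 - x + x^2 for x \<ge> 0.\<close>
    have "exp (- (h * s)) - 1 + h * s \<le> (h * s)\<^sup>2"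
    proof -
      have "exp (- (h * s)) \<le> 1 / (1 + h * s)"
        using le_imp_inverse_le[OF exp_ge_add_one_self[of "h * s"]] h s
        by (simp add: exp_minus inverse_eq_divide add_pos_nonneg)
      moreover have "1 / (1 + h * s) \<le> 1 - h * s + (h * s)\<^sup>2"
      proof -
        have "1 \<le> (1 - x + x\<^sup>2) * (1 + x)" if "0 \<le> x" for x :: real
          using that by (simp add: algebra_simps power2_eq_square)
        from this[of "h * s"] show ?thesis using h s by (subst pos_divide_le_eq) (auto intro: add_pos_nonneg)
      qed
      ultimately show ?thesis by linarith
    qed
    then have "q \<le> h * s\<^sup>2" using h unfolding q_def by (simp add: divide_le_eq power2_eq_square algebra_simps)
    then have "q * r * r \<le> h * s\<^sup>2 * (r * r)" unfolding mult.assoc[of q] by (intro mult_right_mono) auto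
    also have "\<dots> = h * (1 - r)\<^sup>2" unfolding s(2)[symmetric] by (simp add: power2_eq_square)
    also have "\<dots> \<le> h * 1" using r h by (intro mult_left_mono power_le_one) auto
    finally have "q * r * r \<le> h" by simp
    then show ?thesis unfolding eq using q0 r qr by (simp add: abs_of_nonneg)
  qed
  then show "\<bar>(rheat h r - 1) * r / h - (r - 1)\<bar> \<le> 1" "\<bar>((rheat h r - 1) * r / h - (r - 1)) * r\<bar> \<le> h"
    by auto
qed

text \<open>1 - r is the symbol of 1 - R, on whose range the decay takes place. With s = 1 / r - 1
  one has 1 - r = s r \<le> s, and t s exp (- t s) \<le> 1.\<close>

lemma rheat_decay:
  assumes t: "0 < t" and r: "r \<in> {0..1}"
  shows "\<bar>rheat t r * (1 - r)\<bar> \<le> 1 / t"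
proof (cases "r = 0")
  case False
  define s where "s = 1 / r - 1"
  have s: "0 \<le> s" "s * r = 1 - r" using r False unfolding s_def by (auto simp: field_simps)
  have "1 - r \<le> s" using s r mult_left_le[of r s] by auto
  moreover have "t * s * exp (- (t * s)) \<le> 1"
  proof -
    have "t * s \<le> exp (t * s)" using exp_ge_add_one_self[of "t * s"] by linarith
    then show ?thesis by (simp add: exp_minus field_simps)
  qed
  ultimately have "t * (exp (- (t * s)) * (1 - r)) \<le> 1"
    using t mult_left_mono[of "1 - r" s "t * exp (- (t * s))"] by (simp add: algebra_simps)
  then show ?thesis using t r False unfolding rheat_def s_def[symmetric]
    by (simp add: abs_mult field_simps)
qed (use t in \<open>simp add: rheat_def\<close>)

lemma sector_pi_half: "sector (pi / 2) = {z. 0 < Re z}"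
  unfolding sector_def Arg_Re_pos by auto

section \<open>Complex symbols acting on the complexification\<close>

context unit_operator
begin

definition PhiC :: "(real \<Rightarrow> complex) \<Rightarrow> 'k \<times> 'k \<Rightarrow> 'k \<times> 'k" where
  "PhiC f p = (Phi (\<lambda>t. Re (f t)) (fst p) - Phi (\<lambda>t. Im (f t)) (snd p),
     Phi (\<lambda>t. Im (f t)) (fst p) + Phi (\<lambda>t. Re (f t)) (snd p))"

context
  fixes f assumes f: "continuous_on {0..1::real} (f :: real \<Rightarrow> complex)"
begin

lemma cont_Re_Im: "continuous_on {0..1} (\<lambda>t. Re (f t))" "continuous_on {0..1} (\<lambda>t. Im (f t))"
  by (intro continuous_intros f)+

lemma Phi_Re_Im_simps:
  "Phi (\<lambda>t. Re (f t)) (x + y) = Phi (\<lambda>t. Re (f t)) x + Phi (\<lambda>t. Re (f t)) y"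
  "Phi (\<lambda>t. Im (f t)) (x + y) = Phi (\<lambda>t. Im (f t)) x + Phi (\<lambda>t. Im (f t)) y"
  "Phi (\<lambda>t. Re (f t)) (x - y) = Phi (\<lambda>t. Re (f t)) x - Phi (\<lambda>t. Re (f t)) y"
  "Phi (\<lambda>t. Im (f t)) (x - y) = Phi (\<lambda>t. Im (f t)) x - Phi (\<lambda>t. Im (f t)) y"
  "Phi (\<lambda>t. Re (f t)) (c *\<^sub>R x) = c *\<^sub>R Phi (\<lambda>t. Re (f t)) x"
  "Phi (\<lambda>t. Im (f t)) (c *\<^sub>R x) = c *\<^sub>R Phi (\<lambda>t. Im (f t)) x"
  using Phi_linear[OF cont_Re_Im(1)] Phi_linear[OF cont_Re_Im(2)]
  by (simp_all add: linear_add linear_diff linear_scale)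

lemma PhiC_add: "PhiC f (p + q) = PhiC f p + PhiC f q"
  by (simp add: PhiC_def Phi_Re_Im_simps)

lemma PhiC_diff: "PhiC f (p - q) = PhiC f p - PhiC f q"
  by (simp add: PhiC_def Phi_Re_Im_simps)

lemma PhiC_cscale: "PhiC f (cscale z p) = cscale z (PhiC f p)"
  by (simp add: PhiC_def cscale_def Phi_Re_Im_simps algebra_simps)

text \<open>By symmetry the mixed terms cancel, and what remains is \<open>\<Phi>(|f|\<^sup>2)\<close>.\<close>

lemma PhiC_norm_le:
  assumes M: "\<And>t. t \<in> {0..1} \<Longrightarrow> norm (f t) \<le> M"
  shows "norm (PhiC f p) \<le> M * norm p"
proof -
  let ?a = "\<lambda>t. Re (f t)" and ?b = "\<lambda>t. Im (f t)"
  let ?n = "\<lambda>t. ?a t * ?a t + ?b t * ?b t"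
  have M0: "0 \<le> M" using order_trans[OF norm_ge_zero M[of 0]] by simp
  have n: "Phi ?n x = Phi ?a (Phi ?a x) + Phi ?b (Phi ?b x)" for x
    by (simp add: Phi_add Phi_mult cont_Re_Im continuous_on_mult)
  have comm: "Phi ?a (Phi ?b x) = Phi ?b (Phi ?a x)" for x
    using Phi_mult[OF cont_Re_Im, of x] Phi_mult[OF cont_Re_Im(2,1), of x] by (simp add: mult.commute)
  have "norm (Phi ?n x) \<le> M\<^sup>2 * norm x" for x
  proof (rule Phi_norm_le)
    fix t :: real assume "t \<in> {0..1}"
    then have "(norm (f t))\<^sup>2 \<le> M\<^sup>2" by (intro power_mono M norm_ge_zero)
    then show "\<bar>?n t\<bar> \<le> M\<^sup>2" unfolding cmod_power2 by (simp add: power2_eq_square)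
  qed (intro continuous_intros cont_Re_Im)
  then have le: "Phi ?n x \<bullet> x \<le> M\<^sup>2 * (x \<bullet> x)" for x
    using norm_cauchy_schwarz[of "Phi ?n x" x] mult_right_mono[of "norm (Phi ?n x)" "M\<^sup>2 * norm x" "norm x"]
    by (simp add: power2_norm_eq_inner[symmetric] power2_eq_square mult.assoc)
  obtain x y where p: "p = (x, y)" by fastforce
  have "(norm (PhiC f p))\<^sup>2 = Phi ?n x \<bullet> x + Phi ?n y \<bullet> y"
    by (simp add: p PhiC_def n power2_norm_eq_inner inner_add inner_diff comm
        Phi_sym[OF cont_Re_Im(1)] Phi_sym[OF cont_Re_Im(2)])
  also have "\<dots> \<le> M\<^sup>2 * (x \<bullet> x) + M\<^sup>2 * (y \<bullet> y)" by (intro add_mono le)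
  also have "\<dots> = (M * norm p)\<^sup>2" by (simp add: p power2_norm_eq_inner power_mult_distrib algebra_simps)
  finally show ?thesis using M0 by (meson norm_ge_zero mult_nonneg_nonneg power2_le_imp_le)
qed

end

lemma PhiC_mult:
  assumes f: "continuous_on {0..1} f" and g: "continuous_on {0..1} g"
  shows "PhiC (\<lambda>t. f t * g t) p = PhiC f (PhiC g p)"
proof -
  note c = cont_Re_Im[OF f] cont_Re_Im[OF g]
  show ?thesis
    by (simp add: PhiC_def Phi_diff Phi_add Phi_mult c continuous_on_mult Phi_Re_Im_simps[OF f])
qed

lemma PhiC_const: "PhiC (\<lambda>t. z) p = cscale z p"
proof -
  have "Phi (\<lambda>t. c) x = c *\<^sub>R x" for c x using Phi_scale[of "\<lambda>t. 1" c x] by (simp add: Phi_1)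
  then show ?thesis by (simp add: PhiC_def cscale_def)
qed

lemma PhiC_ident: "PhiC of_real (x, y) = (R x, R y)"
proof -
  have "Phi (\<lambda>t. 0) x = 0" for x using Phi_scale[of "\<lambda>t. 1" 0 x] by simp
  then show ?thesis by (simp add: PhiC_def Phi_ident)
qed

lemma PhiC_diff_fun:
  assumes f: "continuous_on {0..1} f" and g: "continuous_on {0..1} g"
  shows "PhiC (\<lambda>t. f t - g t) p = PhiC f p - PhiC g p"
  by (simp add: PhiC_def Phi_diff cont_Re_Im[OF f] cont_Re_Im[OF g])

lemma PhiC_of_real: "PhiC (\<lambda>t. of_real (f t)) (x, y) = (Phi f x, Phi f y)"
proof -
  have "Phi (\<lambda>t. 0) x = 0" for x using Phi_scale[of "\<lambda>t. 1" 0 x] by simp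
  then show ?thesis by (simp add: PhiC_def)
qed

text \<open>On a fixed vector every polynomial in R acts as its value at 1, and this passes to
  uniform limits.\<close>

lemma Phi_fixed_vector:
  assumes f: "continuous_on {0..1} f" and e: "R e = e"
  shows "Phi f e = f 1 *\<^sub>R e"
proof -
  have p: "poly_op R p e = poly p 1 *\<^sub>R e" for p
    by (induction p) (auto simp: poly_op_pCons e scaleR_add_left)
  obtain P where P: "\<And>n t. t \<in> {0..1} \<Longrightarrow> \<bar>poly (P n) t - f t\<bar> \<le> 1 / Suc n"
    "\<And>x. (\<lambda>n. poly_op R (P n) x) \<longlonglongrightarrow> Phi f x" using Phi_sequence[OF f] by metis
  have "(\<lambda>n. poly (P n) 1 - f 1) \<longlonglongrightarrow> 0"
    by (rule Lim_null_comparison[OF _ LIMSEQ_Suc[OF lim_1_over_n]])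
      (use P(1) in \<open>simp add: always_eventually\<close>)
  then have "(\<lambda>n. poly_op R (P n) e) \<longlonglongrightarrow> f 1 *\<^sub>R e" unfolding p by (intro tendsto_intros) (rule LIM_zero_cancel)
  then show ?thesis by (rule LIMSEQ_unique[OF P(2)])
qed

end

text \<open>The state space (S, N) is only a set with a norm function, as the dual of the Sobolev
  space is. The map \<open>U\<close> transports it isometrically from a closed subspace
  \<open>W\<close> of a Hilbert space; \<open>U\<close> is linear everywhere, but isometry of
  \<open>U\<close> and injectivity of \<open>R\<close> are asked on \<open>W\<close>.\<close>

locale evolution = unit_operator R for R :: "'k::{real_inner,complete_space} \<Rightarrow> 'k" +
  fixes W :: "'k set" and U :: "'k \<Rightarrow> 'y::real_vector" and S :: "'y set" and N :: "'y \<Rightarrow> real"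
  assumes W: "subspace W" "closed W"
    and R_W: "x \<in> W \<Longrightarrow> R x \<in> W"
    and R_inj: "x \<in> W \<Longrightarrow> R x = 0 \<Longrightarrow> x = 0"
    and U_linear: "linear U"
    and U_image: "U ` W = S"
    and U_norm: "x \<in> W \<Longrightarrow> N (U x) = norm x"
begin

lemma U_simps [simp]: "U (x + y) = U x + U y" "U (x - y) = U x - U y" "U (c *\<^sub>R x) = c *\<^sub>R U x"
  using U_linear by (auto simp: linear_add linear_diff linear_scale)

lemma W_intros: "x \<in> W \<Longrightarrow> y \<in> W \<Longrightarrow> x + y \<in> W" "x \<in> W \<Longrightarrow> y \<in> W \<Longrightarrow> x - y \<in> W" "x \<in> W \<Longrightarrow> c *\<^sub>R x \<in> W"
  using W(1) by (auto intro: subspace_add subspace_diff subspace_scale)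

lemma U_in: "x \<in> W \<Longrightarrow> U x \<in> S" using U_image by auto

lemma U_inj: "inj_on U W"
proof
  fix x y assume "x \<in> W" "y \<in> W" and eq: "U x = U y"
  then have "norm (x - y) = N (U (x - y))" by (simp add: U_norm W_intros del: U_simps)
  also have "U (x - y) = U 0" using eq U_linear by (simp add: linear_0)
  also have "N (U 0) = 0" using U_norm[OF subspace_0[OF W(1)]] by simp
  finally show "x = y" by simp
qed

definition "V = inv_into W U"

lemma V_in: "y \<in> S \<Longrightarrow> V y \<in> W" and U_V: "y \<in> S \<Longrightarrow> U (V y) = y"
  unfolding V_def U_image[symmetric] by (auto intro: inv_into_into f_inv_into_f)

lemma V_U [simp]: "x \<in> W \<Longrightarrow> V (U x) = x"
  unfolding V_def using U_inj by simp

lemma S_intros: "x \<in> S \<Longrightarrow> y \<in> S \<Longrightarrow> x + y \<in> S" "x \<in> S \<Longrightarrow> y \<in> S \<Longrightarrow> x - y \<in> S" "x \<in> S \<Longrightarrow> c *\<^sub>R x \<in> S"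
proof -
  assume x: "x \<in> S"
  show "c *\<^sub>R x \<in> S" using U_in[OF W_intros(3)[OF V_in[OF x]]] x by (simp add: U_V)
  assume y: "y \<in> S"
  show "x + y \<in> S" "x - y \<in> S"
    using U_in[OF W_intros(1)[OF V_in[OF x] V_in[OF y]]] U_in[OF W_intros(2)[OF V_in[OF x] V_in[OF y]]] x y
    by (simp_all add: U_V)
qed

lemma V_simps: "x \<in> S \<Longrightarrow> y \<in> S \<Longrightarrow> V (x + y) = V x + V y" "x \<in> S \<Longrightarrow> y \<in> S \<Longrightarrow> V (x - y) = V x - V y"
  "x \<in> S \<Longrightarrow> V (c *\<^sub>R x) = c *\<^sub>R V x"
proof -
  assume x: "x \<in> S"
  show "V (c *\<^sub>R x) = c *\<^sub>R V x" using V_U[OF W_intros(3)[OF V_in[OF x]]] x by (simp add: U_V)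
  assume y: "y \<in> S"
  show "V (x + y) = V x + V y" "V (x - y) = V x - V y"
    using V_U[OF W_intros(1)[OF V_in[OF x] V_in[OF y]]] V_U[OF W_intros(2)[OF V_in[OF x] V_in[OF y]]] x y
    by (simp_all add: U_V)
qed

lemma norm_V: "y \<in> S \<Longrightarrow> norm (V y) = N y"
  using U_norm[OF V_in] U_V by metis

lemma Phi_W: "continuous_on {0..1} f \<Longrightarrow> x \<in> W \<Longrightarrow> Phi f x \<in> W"
  by (rule Phi_invariant[OF _ W R_W])

lemma PhiC_W: "continuous_on {0..1} f \<Longrightarrow> p \<in> W \<times> W \<Longrightarrow> PhiC f p \<in> W \<times> W"
  by (auto simp: PhiC_def intro!: W_intros Phi_W cont_Re_Im)

text \<open>A vector w of W orthogonal to the image satisfies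
  \<open>R w \<bullet> R w = w \<bullet> R (R w)\<close>, which is 0, and R is injective on
  W.\<close>

lemma dense: "W \<subseteq> closure (R ` W)"
proof (rule dense_in_subspace[OF _ W])
  show "subspace (R ` W)" by (rule linear_subspace_image[OF linear W(1)])
  show "R ` W \<subseteq> W" using R_W by auto
  fix w assume w: "w \<in> W" and orth: "\<And>m. m \<in> R ` W \<Longrightarrow> w \<bullet> m = 0"
  have "R w \<bullet> R w = w \<bullet> R (R w)" by (rule sym)
  also have "\<dots> = 0" using orth w R_W by blast
  finally show "w = 0" using R_inj w by simp
qed

text \<open>With w = (1 + A) u one has u = R w and - A u = R w - w, so this is the transported graph
  of - A.\<close>

definition graph :: "('y \<times> 'y) set" where
  "graph = {(U (R w), U (R w - w)) | w. w \<in> W}"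

definition T :: "real \<Rightarrow> 'y \<Rightarrow> 'y" where
  "T t y = U (Phi (rheat t) (V y))"

definition Tc :: "complex \<Rightarrow> 'y \<times> 'y \<Rightarrow> 'y \<times> 'y" where
  "Tc z p = map_prod U U (PhiC (heat z) (map_prod V V p))"

lemma cnorm_U: "p \<in> W \<times> W \<Longrightarrow> cnorm N (map_prod U U p) = norm p"
  by (auto simp: cnorm_def U_norm norm_Pair)

lemma norm_VV: "p \<in> S \<times> S \<Longrightarrow> norm (map_prod V V p) = cnorm N p"
  by (auto simp: cnorm_def norm_V norm_Pair)

lemma VV_W: "p \<in> S \<times> S \<Longrightarrow> map_prod V V p \<in> W \<times> W"
  by (auto simp: V_in)

lemma UU_add: "map_prod U U (p + q) = map_prod U U p + map_prod U U q"
  by (simp add: map_prod_def split_beta)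

lemma UU_diff: "map_prod U U (p - q) = map_prod U U p - map_prod U U q"
  by (simp add: map_prod_def split_beta)

lemma UU_cscale: "map_prod U U (cscale z p) = cscale z (map_prod U U p)"
  by (simp add: cscale_def map_prod_def split_beta)

lemma bounded_clinear_PhiC:
  assumes f: "continuous_on {0..1} f"
  shows "bounded_clinear_on S N (\<lambda>p. map_prod U U (PhiC f (map_prod V V p)))"
proof -
  have "bounded (f ` {0..1})" by (intro compact_imp_bounded compact_continuous_image f compact_Icc)
  then obtain M where M: "\<And>t. t \<in> {0..1} \<Longrightarrow> norm (f t) \<le> M" unfolding bounded_iff by fast
  show ?thesis
    unfolding bounded_clinear_on_def
  proof (intro conjI ballI allI exI[of _ M])
    show "(\<lambda>p. map_prod U U (PhiC f (map_prod V V p))) ` (S \<times> S) \<subseteq> S \<times> S"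
      using PhiC_W[OF f VV_W] U_in by (fastforce simp: map_prod_def mem_Times_iff)
  next
    fix p q assume pq: "p \<in> S \<times> S" "q \<in> S \<times> S"
    then have "map_prod V V (p + q) = map_prod V V p + map_prod V V q"
      by (auto simp: V_simps)
    then show "map_prod U U (PhiC f (map_prod V V (p + q))) =
        map_prod U U (PhiC f (map_prod V V p)) + map_prod U U (PhiC f (map_prod V V q))"
      by (simp only: PhiC_add[OF f] UU_add)
  next
    fix z p assume p: "p \<in> S \<times> S"
    have V: "map_prod V V (cscale z p) = cscale z (map_prod V V p)"
    proof -
      obtain x y where "p = (x, y)" "x \<in> S" "y \<in> S" using p by auto
      then show ?thesis by (simp add: cscale_def V_simps S_intros)
    qed
    show "map_prod U U (PhiC f (map_prod V V (cscale z p))) = cscale z (map_prod U U (PhiC f (map_prod V V p)))"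
      unfolding V PhiC_cscale[OF f] by (simp add: cscale_def map_prod_def split_beta)
  next
    fix p assume p: "p \<in> S \<times> S"
    show "cnorm N (map_prod U U (PhiC f (map_prod V V p))) \<le> M * cnorm N p"
      using PhiC_norm_le[OF f M] by (simp add: cnorm_U PhiC_W f VV_W p norm_VV[symmetric])
  qed
qed

lemma W2_intros: "p \<in> W \<times> W \<Longrightarrow> q \<in> W \<times> W \<Longrightarrow> p - q \<in> W \<times> W" "p \<in> W \<times> W \<Longrightarrow> q \<in> W \<times> W \<Longrightarrow> p + q \<in> W \<times> W"
   "p \<in> W \<times> W \<Longrightarrow> cscale z p \<in> W \<times> W"
  by (auto simp: cscale_def intro!: W_intros)

lemma UU_VV: "p \<in> S \<times> S \<Longrightarrow> map_prod U U (map_prod V V p) = p"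
  by (auto simp: U_V)

lemma VV_UU: "p \<in> W \<times> W \<Longrightarrow> map_prod V V (map_prod U U p) = p"
  by auto

text \<open>The convergence is only strong: on the image of R it comes from
  \<open>heat_diff_1\<close>, and contractivity extends it to the closure.\<close>

lemma Tc_at_0:
  assumes p: "p \<in> S \<times> S"
  shows "((\<lambda>z. cnorm N (Tc z p - p)) \<longlongrightarrow> 0) (at 0 within sector (pi / 2))"
proof -
  let ?F = "at 0 within sector (pi / 2)"
  have sec: "\<forall>\<^sub>F z in ?F. z \<in> half_plane"
    unfolding eventually_at_filter sector_pi_half by (intro always_eventually) auto
  define Q where "Q z x = (if z \<in> half_plane then PhiC (heat z) x - x else 0)" for z x
  have Q_le: "norm (Q z x) \<le> 2 * norm x" for z x
  proof (cases "z \<in> half_plane")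
    case True
    have "norm (PhiC (heat z) x) \<le> 1 * norm x"
      by (intro PhiC_norm_le continuous_heat norm_heat_le_1 True)
    then show ?thesis unfolding Q_def using True norm_triangle_ineq4[of "PhiC (heat z) x" x] by auto
  qed (simp add: Q_def)
  have "((\<lambda>z. Q z (map_prod V V p)) \<longlongrightarrow> 0) ?F"
  proof (rule tendsto_zero_on_closure[where C = 2 and M = "R ` W \<times> R ` W"])
    show "Q z (x - y) = Q z x - Q z y" for z x y
      unfolding Q_def by (auto simp: PhiC_diff continuous_heat)
    show "\<forall>\<^sub>F z in ?F. \<forall>x. norm (Q z x) \<le> 2 * norm x" using Q_le by (intro always_eventually) auto
    show "map_prod V V p \<in> closure (R ` W \<times> R ` W)"
      unfolding closure_Times using VV_W[OF p] dense by auto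
    fix q assume "q \<in> R ` W \<times> R ` W"
    then obtain x y where q: "q = PhiC of_real (x, y)" by (auto simp: PhiC_ident)
    show "((\<lambda>z. Q z q) \<longlongrightarrow> 0) ?F"
    proof (rule Lim_null_comparison)
      show "\<forall>\<^sub>F z in ?F. norm (Q z q) \<le> norm z * norm (x, y)"
        using sec
      proof eventually_elim
        case (elim z)
        have c: "continuous_on {0..1} (\<lambda>r. heat z r * of_real r)" "continuous_on {0..1} (heat z)"
          by (intro continuous_intros continuous_heat elim)+
        have "PhiC (\<lambda>r. heat z r * of_real r - of_real r) (x, y) = Q z q"
          unfolding Q_def q using elim by (subst PhiC_diff_fun) (auto simp: PhiC_mult c continuous_intros)
        moreover have "norm (PhiC (\<lambda>r. heat z r * of_real r - of_real r) (x, y)) \<le> norm z * norm (x, y)"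
          using heat_diff_1[OF elim] by (intro PhiC_norm_le continuous_intros c) (simp add: algebra_simps)
        ultimately show ?case by simp
      qed
      show "((\<lambda>z. norm z * norm (x, y)) \<longlongrightarrow> 0) ?F"
        by (intro tendsto_mult_left_zero tendsto_norm_zero tendsto_ident_at)
    qed
  qed
  then have "((\<lambda>z. norm (Q z (map_prod V V p))) \<longlongrightarrow> 0) ?F" by (rule tendsto_norm_zero)
  moreover have "\<forall>\<^sub>F z in ?F. norm (Q z (map_prod V V p)) = cnorm N (Tc z p - p)"
    using sec
  proof eventually_elim
    case (elim z)
    have *: "PhiC (heat z) (map_prod V V p) - map_prod V V p \<in> W \<times> W"
      by (intro W2_intros PhiC_W continuous_heat VV_W p elim)
    have "Tc z p - p = map_prod U U (PhiC (heat z) (map_prod V V p) - map_prod V V p)"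
      unfolding Tc_def UU_diff by (simp add: UU_VV p)
    then show ?case using cnorm_U[OF *] elim by (simp add: Q_def)
  qed
  ultimately show ?thesis by (rule Lim_transform_eventually)
qed

lemma Tc_derivative:
  assumes z: "0 < Re z" and e: "0 < e"
  obtains d where "d > 0" "\<And>h p. h \<noteq> 0 \<Longrightarrow> cmod h < d \<Longrightarrow> p \<in> S \<times> S \<Longrightarrow>
    cnorm N (cscale (1 / h) (Tc (z + h) p - Tc z p) -
      map_prod U U (PhiC (\<lambda>r. - heat' z r) (map_prod V V p))) \<le> e * cnorm N p"
proof -
  obtain d where d: "d > 0" "d \<le> Re z / 2"
    and le: "\<And>(h::complex) r. h \<noteq> 0 \<Longrightarrow> norm h < d \<Longrightarrow> r \<in> {0..1} \<Longrightarrow>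
      norm ((heat (z + h) r - heat z r) / h + heat' z r) \<le> e"
    using heat_has_derivative[OF z e] by blast
  show ?thesis
  proof (rule that[OF d(1)])
    fix h p assume h: "h \<noteq> 0" "cmod h < d" and p: "p \<in> S \<times> S"
    let ?p = "map_prod V V p"
    \<comment> \<open>The bound d \<le> Re z / 2 keeps z + h inside the half-plane.\<close>
    have zh: "z + h \<in> half_plane" using abs_Re_le_cmod[of h] h(2) d(2) z by auto
    have zz: "z \<in> half_plane" using z by simp
    note c = continuous_heat[OF zz] continuous_heat[OF zh] continuous_heat'[OF z]
    have eq: "cscale (1 / h) (PhiC (heat (z + h)) ?p - PhiC (heat z) ?p) - PhiC (\<lambda>r. - heat' z r) ?p
       = PhiC (\<lambda>r. (1 / h) * (heat (z + h) r - heat z r) - (- heat' z r)) ?p"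
      by (simp only: PhiC_diff_fun PhiC_mult PhiC_const c continuous_intros)
    have "cscale (1 / h) (Tc (z + h) p - Tc z p) - map_prod U U (PhiC (\<lambda>r. - heat' z r) ?p)
       = map_prod U U (PhiC (\<lambda>r. (1 / h) * (heat (z + h) r - heat z r) - (- heat' z r)) ?p)"
      unfolding Tc_def eq[symmetric] by (simp only: UU_diff UU_cscale)
    also have "cnorm N \<dots> = norm (PhiC (\<lambda>r. (1 / h) * (heat (z + h) r - heat z r) - (- heat' z r)) ?p)"
      by (intro cnorm_U PhiC_W VV_W p continuous_intros c)
    also have "\<dots> \<le> e * norm ?p"
    proof (rule PhiC_norm_le)
      fix r :: real assume "r \<in> {0..1}"
      from le[OF h this] show "norm (1 / h * (heat (z + h) r - heat z r) - - heat' z r) \<le> e" by simp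
    qed (intro continuous_intros c)
    finally show "cnorm N (cscale (1 / h) (Tc (z + h) p - Tc z p) - map_prod U U (PhiC (\<lambda>r. - heat' z r) ?p))
        \<le> e * cnorm N p" by (simp add: norm_VV p)
  qed
qed

lemma Tc_of_real:
  assumes "0 \<le> t" "x \<in> S" "y \<in> S"
  shows "Tc (of_real t) (x, y) = (T t x, T t y)"
  by (simp add: Tc_def T_def heat_of_real[abs_def] PhiC_of_real)

text \<open>A is symmetric and nonnegative, so the symbols are bounded by 1 for every z with
  positive real part and the sector has the maximal half-angle pi / 2.\<close>

lemma analytic: "analytic_semigroup S N T"
  unfolding analytic_semigroup_def
proof (intro exI[of _ "pi / 2"] exI[of _ Tc] conjI ballI allI impI)
  have sec: "insert 0 (sector (pi / 2)) = half_plane" by (simp add: sector_pi_half)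
  fix z assume z: "z \<in> insert 0 (sector (pi / 2))"
  show "bounded_clinear_on S N (Tc z)"
    using bounded_clinear_PhiC[OF continuous_heat, of z] z unfolding sec Tc_def[abs_def] .
  fix w p assume w: "w \<in> insert 0 (sector (pi / 2))" and p: "p \<in> S \<times> S"
  show "Tc (z + w) p = Tc z (Tc w p)"
  proof -
    have c: "continuous_on {0..1} (heat z)" "continuous_on {0..1} (heat w)"
      using z w unfolding sec by (auto intro: continuous_heat)
    have "heat (z + w) = (\<lambda>r. heat z r * heat w r)"
      using heat_add z w unfolding sec by blast
    then show ?thesis unfolding Tc_def by (simp add: PhiC_mult c VV_UU PhiC_W VV_W p)
  qed
next
  show "0 < pi / 2" "pi / 2 \<le> pi / 2" by auto
next
  fix t x y assume "(0::real) \<le> t" "x \<in> S" "y \<in> S"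
  then show "Tc (complex_of_real t) (x, y) = (T t x, T t y)" by (rule Tc_of_real)
next
  fix p assume "p \<in> S \<times> S"
  then show "((\<lambda>z. cnorm N (Tc z p - p)) \<longlongrightarrow> 0) (at 0 within sector (pi / 2))" by (rule Tc_at_0)
next
  fix z assume "z \<in> sector (pi / 2)"
  then have z: "0 < Re z" by (simp add: sector_pi_half)
  show "\<exists>L. bounded_clinear_on S N L \<and> (\<forall>\<epsilon>>0. \<exists>r>0. \<forall>h. h \<noteq> 0 \<and> cmod h < r \<longrightarrow>
      (\<forall>p\<in>S \<times> S. cnorm N (cscale (1 / h) (Tc (z + h) p - Tc z p) - L p) \<le> \<epsilon> * cnorm N p))"
  proof (intro exI[of _ "\<lambda>p. map_prod U U (PhiC (\<lambda>r. - heat' z r) (map_prod V V p))"] conjI allI impI)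
    show "bounded_clinear_on S N (\<lambda>p. map_prod U U (PhiC (\<lambda>r. - heat' z r) (map_prod V V p)))"
      by (intro bounded_clinear_PhiC continuous_intros continuous_heat' z)
    fix e :: real assume "e > 0"
    from Tc_derivative[OF z this] obtain d where "d > 0" "\<And>h p. h \<noteq> 0 \<Longrightarrow> cmod h < d \<Longrightarrow> p \<in> S \<times> S \<Longrightarrow>
      cnorm N (cscale (1 / h) (Tc (z + h) p - Tc z p) -
      map_prod U U (PhiC (\<lambda>r. - heat' z r) (map_prod V V p))) \<le> e * cnorm N p" by metis
    then show "\<exists>r>0. \<forall>h. h \<noteq> 0 \<and> cmod h < r \<longrightarrow> (\<forall>p\<in>S \<times> S. cnorm N (cscale (1 / h) (Tc (z + h) p - Tc z p) -
      map_prod U U (PhiC (\<lambda>r. - heat' z r) (map_prod V V p))) \<le> e * cnorm N p)" by blast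
  qed
qed

lemma T_in: "0 \<le> t \<Longrightarrow> x \<in> S \<Longrightarrow> T t x \<in> S"
  unfolding T_def by (intro U_in Phi_W continuous_rheat V_in)

lemma Phi_rheat_add:
  "0 \<le> s \<Longrightarrow> 0 \<le> t \<Longrightarrow> Phi (rheat (s + t)) x = Phi (rheat s) (Phi (rheat t) x)"
  by (subst Phi_mult[symmetric]) (auto simp: continuous_rheat rheat_add intro!: Phi_cong)

lemma Phi_rheat_le: "0 \<le> t \<Longrightarrow> norm (Phi (rheat t) x) \<le> norm x"
  using Phi_norm_le[where M = 1, OF continuous_rheat rheat_bounds] by simp

text \<open>Contractivity reduces the claim to x = R w, where \<open>rheat_diff\<close> makes the
  orbit Lipschitz in time.\<close>

lemma orbit_continuous:
  assumes x: "x \<in> W"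
  shows "continuous_on {0..} (\<lambda>t. Phi (rheat t) x)"
  unfolding continuous_on_def
proof
  fix t :: real assume t: "t \<in> {0..}"
  define Q where "Q s y = (if 0 \<le> s then Phi (rheat s) y - Phi (rheat t) y else 0)" for s y
  have "((\<lambda>s. Q s x) \<longlongrightarrow> 0) (at t within {0..})"
  proof (rule tendsto_zero_on_closure[where C = 2 and M = "R ` W"])
    show "Q s (y - z) = Q s y - Q s z" for s y z
      using t linear_diff[OF Phi_linear[OF continuous_rheat]] unfolding Q_def by auto
    have "norm (Q s y) \<le> 2 * norm y" for s y
      using norm_triangle_ineq4[of "Phi (rheat s) y" "Phi (rheat t) y"] Phi_rheat_le[of s y] Phi_rheat_le[of t y] t
      unfolding Q_def by auto
    then show "\<forall>\<^sub>F s in at t within {0..}. \<forall>y. norm (Q s y) \<le> 2 * norm y" by (intro always_eventually) auto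
    show "x \<in> closure (R ` W)" using x dense by auto
    fix q assume "q \<in> R ` W"
    then obtain w where q: "q = R w" by auto
    have "norm (Q s q) \<le> \<bar>s - t\<bar> * norm w" for s
    proof (cases "0 \<le> s")
      case True
      have c: "continuous_on {0..1} (rheat s)" "continuous_on {0..1} (rheat t)"
        using True t by (auto intro: continuous_rheat)
      have "Q s q = Phi (\<lambda>r. (rheat s r - rheat t r) * r) w"
        unfolding Q_def q using True by (simp add: Phi_mult Phi_diff Phi_ident c continuous_on_diff)
      also have "norm \<dots> \<le> \<bar>s - t\<bar> * norm w"
        using t True by (intro Phi_norm_le rheat_diff continuous_intros c) auto
      finally show ?thesis .
    qed (auto simp: Q_def)
    moreover have "((\<lambda>s. \<bar>s - t\<bar> * norm w) \<longlongrightarrow> \<bar>t - t\<bar> * norm w) (at t within {0..})"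
      by (intro tendsto_intros)
    ultimately show "((\<lambda>s. Q s q) \<longlongrightarrow> 0) (at t within {0..})"
      by (intro Lim_null_comparison[of "\<lambda>s. Q s q" "\<lambda>s. \<bar>s - t\<bar> * norm w"]) (auto simp: always_eventually)
  qed
  moreover have "\<forall>\<^sub>F s in at t within {0..}. Q s x = Phi (rheat s) x - Phi (rheat t) x"
    unfolding Q_def eventually_at_filter by (intro always_eventually) auto
  ultimately have "((\<lambda>s. Phi (rheat s) x - Phi (rheat t) x) \<longlongrightarrow> 0) (at t within {0..})"
    by (rule Lim_transform_eventually)
  then show "((\<lambda>s. Phi (rheat s) x) \<longlongrightarrow> Phi (rheat t) x) (at t within {0..})" by (rule LIM_zero_cancel)
qed

lemma T_continuous_in:
  assumes y: "y \<in> S"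
  shows "continuous_in N {0..} (\<lambda>t. T t y)"
  unfolding continuous_in_def
proof
  fix t :: real assume t: "t \<in> {0..}"
  have "((\<lambda>s. Phi (rheat s) (V y) - Phi (rheat t) (V y)) \<longlongrightarrow> 0) (at t within {0..})"
    using orbit_continuous[OF V_in[OF y]] t unfolding continuous_on_def by (auto intro: LIM_zero)
  then have "((\<lambda>s. norm (Phi (rheat s) (V y) - Phi (rheat t) (V y))) \<longlongrightarrow> 0) (at t within {0..})"
    by (rule tendsto_norm_zero)
  moreover have "\<forall>\<^sub>F s in at t within {0..}. norm (Phi (rheat s) (V y) - Phi (rheat t) (V y)) = N (T s y - T t y)"
    unfolding eventually_at_filter
  proof (intro always_eventually allI impI)
    fix s :: real assume "s \<in> {0..}"
    then have "Phi (rheat s) (V y) - Phi (rheat t) (V y) \<in> W"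
      using t y by (intro W_intros Phi_W continuous_rheat V_in) auto
    from U_norm[OF this] show "norm (Phi (rheat s) (V y) - Phi (rheat t) (V y)) = N (T s y - T t y)"
      by (simp add: T_def)
  qed
  ultimately show "((\<lambda>s. N (T s y - T t y)) \<longlongrightarrow> 0) (at t within {0..})" by (rule Lim_transform_eventually)
qed

lemma T_0: "x \<in> S \<Longrightarrow> T 0 x = x"
proof -
  have "rheat 0 = (\<lambda>r. 1)" by (auto simp: rheat_def)
  then show "x \<in> S \<Longrightarrow> T 0 x = x" unfolding T_def by (simp add: Phi_1 U_V)
qed

lemma T_contraction: "0 \<le> t \<Longrightarrow> x \<in> S \<Longrightarrow> N (T t x) \<le> N x"
  unfolding T_def using Phi_rheat_le[of t "V x"] by (simp add: U_norm Phi_W continuous_rheat V_in norm_V)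

lemma C0: "C0_semigroup S N T"
  unfolding C0_semigroup_def
proof (intro conjI allI impI ballI)
  fix t :: real assume t: "0 \<le> t"
  show "T t ` S \<subseteq> S" using T_in t by auto
  show "linear_map_on S (T t)"
    unfolding linear_map_on_def T_def using linear_add[OF Phi_linear] linear_scale[OF Phi_linear] continuous_rheat[OF t]
    by (auto simp: V_simps)
  show "\<exists>K. \<forall>x\<in>S. N (T t x) \<le> K * N x" using T_contraction t by (intro exI[of _ 1]) auto
  fix s :: real and x assume s: "0 \<le> s" and x: "x \<in> S"
  have "T (t + s) x = T t (T s x)"
    unfolding T_def using s t x by (simp add: Phi_rheat_add Phi_W continuous_rheat V_in)
  then show "T (t + s) x = T t (T s x)" .
next
  fix x assume x: "x \<in> S"
  show "T 0 x = x" by (rule T_0[OF x])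
  have "((\<lambda>t. N (T t x - T 0 x)) \<longlongrightarrow> 0) (at 0 within {0..})"
    using T_continuous_in[OF x] unfolding continuous_in_def by auto
  then show "((\<lambda>t. N (T t x - x)) \<longlongrightarrow> 0) (at_right 0)"
    unfolding T_0[OF x] by (rule tendsto_within_subset) auto
qed

text \<open>If \<open>(x, y)\<close> is in the generator, applying \<open>R\<close> to the difference quotients shows
  \<open>R y = R x - x\<close>; so the generator is not larger than the graph.\<close>

lemma generator_eq: "generator S N T = graph"
proof -
  have quot: "((\<lambda>h. (1 / h) *\<^sub>R (Phi (rheat h) (R w) - R w) - (R w - w)) \<longlongrightarrow> 0) (at_right 0)" if w: "w \<in> W" for w
  proof -
    \<comment> \<open>The quotient at R w minus its expected limit R w - w, viewed as an operator in
      w: bounded by 1 on the whole space and O(h) on the image of R.\<close>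
    define Q where "Q h x = (if 0 < h then Phi (\<lambda>r. (rheat h r - 1) * r / h - (r - 1)) x else 0)" for h x
    have c: "continuous_on {0..1} (\<lambda>r. (rheat h r - 1) * r / h - (r - 1))" if "0 < h" for h
      using that by (intro continuous_intros continuous_rheat) auto
    have pos: "\<forall>\<^sub>F h in at_right (0::real). 0 < h" by (rule eventually_at_right_less)
    have "((\<lambda>h. Q h w) \<longlongrightarrow> 0) (at_right 0)"
    proof (rule tendsto_zero_on_closure[where C = 1 and M = "R ` W"])
      show "Q h (x - y) = Q h x - Q h y" for h x y
        unfolding Q_def using linear_diff[OF Phi_linear[OF c]] by auto
      show "\<forall>\<^sub>F h in at_right 0. \<forall>x. norm (Q h x) \<le> 1 * norm x"
        unfolding Q_def using Phi_norm_le[OF c rheat_generator(1)] by (intro always_eventually) auto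
      show "w \<in> closure (R ` W)" using w dense by auto
      fix q assume "q \<in> R ` W"
      then obtain x where q: "q = R x" by auto
      show "((\<lambda>h. Q h q) \<longlongrightarrow> 0) (at_right 0)"
      proof (rule Lim_null_comparison)
        show "\<forall>\<^sub>F h in at_right 0. norm (Q h q) \<le> h * norm x"
          using pos
        proof eventually_elim
          case (elim h)
          have "Q h q = Phi (\<lambda>r. ((rheat h r - 1) * r / h - (r - 1)) * r) x"
            unfolding Q_def q using elim c[OF elim] by (subst Phi_mult) (auto simp: Phi_ident)
          also have "norm \<dots> \<le> h * norm x"
            by (intro Phi_norm_le rheat_generator elim continuous_on_mult c continuous_on_id)
          finally show ?case .
        qed
        show "((\<lambda>h. h * norm x) \<longlongrightarrow> 0) (at_right 0)" by (intro tendsto_mult_left_zero tendsto_ident_at)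
      qed
    qed
    moreover have "\<forall>\<^sub>F h in at_right 0. Q h w = (1 / h) *\<^sub>R (Phi (rheat h) (R w) - R w) - (R w - w)"
      using pos
    proof eventually_elim
      case (elim h)
      have ch: "continuous_on {0..1} (rheat h)" using elim by (intro continuous_rheat) auto
      have "Phi (\<lambda>r. (1 / h) * ((rheat h r - 1) * r) - (r - 1)) w =
          (1 / h) *\<^sub>R (Phi (rheat h) (R w) - R w) - (R w - w)"
        using ch by (simp only: Phi_diff Phi_scale Phi_mult Phi_1 Phi_ident continuous_on_mult continuous_on_diff
            continuous_on_const continuous_on_id)
      then show ?case unfolding Q_def using elim by simp
    qed
    ultimately show ?thesis by (rule Lim_transform_eventually)
  qed
  show ?thesis
  proof (intro equalityI subsetI)
    fix z assume "z \<in> graph"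
    then obtain w where w: "w \<in> W" and z: "z = (U (R w), U (R w - w))" unfolding graph_def by auto
    have "((\<lambda>h. N ((1 / h) *\<^sub>R (T h (U (R w)) - U (R w)) - U (R w - w))) \<longlongrightarrow> 0) (at_right 0)"
    proof (rule Lim_transform_eventually[OF tendsto_norm_zero[OF quot[OF w]]])
      show "\<forall>\<^sub>F h in at_right 0. norm ((1 / h) *\<^sub>R (Phi (rheat h) (R w) - R w) - (R w - w)) =
          N ((1 / h) *\<^sub>R (T h (U (R w)) - U (R w)) - U (R w - w))"
        using eventually_at_right_less
      proof eventually_elim
        case (elim h)
        have "(1 / h) *\<^sub>R (Phi (rheat h) (R w) - R w) - (R w - w) \<in> W"
          using elim w by (intro W_intros Phi_W continuous_rheat R_W) auto
        from U_norm[OF this] show ?case using w by (simp add: T_def R_W)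
      qed
    qed
    then show "z \<in> generator S N T"
      unfolding generator_def z using w by (auto intro!: U_in R_W W_intros simp del: U_simps)
  next
    fix z assume "z \<in> generator S N T"
    then obtain y y' where z: "z = (y, y')" and y: "y \<in> S" "y' \<in> S"
      and lim: "((\<lambda>h. N ((1 / h) *\<^sub>R (T h y - y) - y')) \<longlongrightarrow> 0) (at_right 0)"
      unfolding generator_def by auto
    define x x' where "x = V y" and "x' = V y'"
    have x: "x \<in> W" "x' \<in> W" unfolding x_def x'_def using y by (auto intro: V_in)
    have "((\<lambda>h. norm ((1 / h) *\<^sub>R (Phi (rheat h) x - x) - x')) \<longlongrightarrow> 0) (at_right 0)"
    proof (rule Lim_transform_eventually[OF lim])
      show "\<forall>\<^sub>F h in at_right 0. N ((1 / h) *\<^sub>R (T h y - y) - y') = norm ((1 / h) *\<^sub>R (Phi (rheat h) x - x) - x')"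
        using eventually_at_right_less
      proof eventually_elim
        case (elim h)
        have "(1 / h) *\<^sub>R (Phi (rheat h) x - x) - x' \<in> W"
          using elim x by (intro W_intros Phi_W continuous_rheat R_W) auto
        from U_norm[OF this] show ?case using y by (simp add: T_def x_def x'_def U_V)
      qed
    qed
    then have "((\<lambda>h. R ((1 / h) *\<^sub>R (Phi (rheat h) x - x) - x')) \<longlongrightarrow> 0) (at_right 0)"
      using Lim_null_comparison[of "\<lambda>h. R ((1 / h) *\<^sub>R (Phi (rheat h) x - x) - x')"] norm_R_le
      by (metis (no_types, lifting) always_eventually)
    moreover have "\<forall>\<^sub>F h in at_right 0. R ((1 / h) *\<^sub>R (Phi (rheat h) x - x) - x')
        = ((1 / h) *\<^sub>R (Phi (rheat h) (R x) - R x) - (R x - x)) + (R x - x - R x')"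
      using eventually_at_right_less
    proof eventually_elim
      case (elim h)
      have "R (Phi (rheat h) x) = Phi (rheat h) (R x)"
        using Phi_mult[of "\<lambda>t. t" "rheat h" x] Phi_mult[of "rheat h" "\<lambda>t. t" x] elim continuous_rheat[of h]
        by (simp add: Phi_ident mult.commute)
      then show ?case by (simp add: algebra_simps)
    qed
    ultimately have "((\<lambda>h. ((1 / h) *\<^sub>R (Phi (rheat h) (R x) - R x) - (R x - x)) + (R x - x - R x')) \<longlongrightarrow> 0) (at_right 0)"
      by (rule Lim_transform_eventually)
    moreover have "((\<lambda>h. ((1 / h) *\<^sub>R (Phi (rheat h) (R x) - R x) - (R x - x)) + (R x - x - R x'))
        \<longlongrightarrow> 0 + (R x - x - R x')) (at_right 0)"
      by (intro tendsto_add quot x tendsto_const)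
    ultimately have "0 = 0 + (R x - x - R x')" by (intro tendsto_unique[OF trivial_limit_at_right_real])
    then have "R (x - x') = x" by (simp add: algebra_simps)
    then have "y = U (R (x - x'))" "y' = U (R (x - x') - (x - x'))"
      using y by (simp_all add: x_def x'_def U_V)
    then show "z \<in> graph" unfolding graph_def z using W_intros(2)[OF x] by blast
  qed
qed

theorem generates: "generates_analytic_contraction_semigroup S N graph"
  unfolding generates_analytic_contraction_semigroup_def contraction_semigroup_def
  using C0 analytic generator_eq T_contraction by (intro exI[of _ T]) blast

end

section \<open>Solutions: regularity, uniqueness and long-time limit\<close>

definition rheat' :: "real \<Rightarrow> real \<Rightarrow> real" where
  "rheat' t r = (if r = 0 then 0 else (1 / r - 1) * exp (- t * (1 / r - 1)))"

lemma heat'_of_real: "heat' (of_real t) r = of_real (rheat' t r)"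
  by (simp add: heat'_def rheat'_def exp_of_real[symmetric])

lemma continuous_rheat':
  assumes "0 < t"
  shows "continuous_on {0..1} (rheat' t)"
proof -
  have "continuous_on {0..1} (\<lambda>r. Re (heat' (of_real t) r))"
    using assms by (intro continuous_on_Re continuous_heat') auto
  then show ?thesis by (simp add: heat'_of_real)
qed

lemma rheat_has_derivative:
  assumes t: "0 < t" and e: "0 < e"
  obtains d where "d > 0" "d \<le> t / 2"
    "\<And>h r. h \<noteq> 0 \<Longrightarrow> \<bar>h\<bar> < d \<Longrightarrow> r \<in> {0..1} \<Longrightarrow> \<bar>(rheat (t + h) r - rheat t r) / h + rheat' t r\<bar> \<le> e"
proof -
  obtain d where d: "d > 0" "d \<le> Re (of_real t) / 2"
    and le: "\<And>(h::complex) r. h \<noteq> 0 \<Longrightarrow> norm h < d \<Longrightarrow> r \<in> {0..1} \<Longrightarrow>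
      norm ((heat (of_real t + h) r - heat (of_real t) r) / h + heat' (of_real t) r) \<le> e"
    using heat_has_derivative[of "of_real t" e] t e by auto
  show ?thesis
  proof (rule that)
    fix h r :: real assume h: "h \<noteq> 0" "\<bar>h\<bar> < d" and r: "r \<in> {0..1}"
    have "norm (complex_of_real ((rheat (t + h) r - rheat t r) / h + rheat' t r)) \<le> e"
      using le[of "of_real h" r] h r
      unfolding of_real_add[symmetric] heat_of_real heat'_of_real by simp
    then show "\<bar>(rheat (t + h) r - rheat t r) / h + rheat' t r\<bar> \<le> e" by (simp only: norm_of_real)
  qed (use d in auto)
qed

lemma has_vector_derivative_quotient:
  fixes f :: "real \<Rightarrow> 'b::real_normed_vector"
  assumes "((\<lambda>h. (1 / h) *\<^sub>R (f (s + h) - f s) - y) \<longlongrightarrow> 0) (at 0)"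
  shows "(f has_vector_derivative y) (at s)"
  unfolding has_vector_derivative_def has_derivative_at
proof
  show "((\<lambda>h. norm (f (s + h) - f s - h *\<^sub>R y) / norm h) \<longlongrightarrow> 0) (at 0)"
  proof (rule Lim_transform_eventually[OF tendsto_norm_zero[OF assms]])
    have "norm ((1 / h) *\<^sub>R (f (s + h) - f s) - y) = norm (f (s + h) - f s - h *\<^sub>R y) / norm h"
      if "h \<noteq> 0" for h
    proof -
      have "(1 / h) *\<^sub>R (f (s + h) - f s) - y = (1 / h) *\<^sub>R (f (s + h) - f s - h *\<^sub>R y)"
        using that by (simp add: scaleR_diff_right)
      then show ?thesis by simp
    qed
    then show "\<forall>\<^sub>F h in at 0. norm ((1 / h) *\<^sub>R (f (s + h) - f s) - y) = norm (f (s + h) - f s - h *\<^sub>R y) / norm h"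
      by (auto simp: eventually_at_filter)
  qed
qed (rule bounded_linear_scaleR_left)

context evolution
begin

text \<open>With s = 1 / r - 1 the symbol is exp (- t s) (1 + s) = exp (- t s) / r, so this is (1 +
  A) e^(-tA) x, the preimage of the orbit under R. Its norm continuity encodes continuity of the
  orbit in the domain of the operator.\<close>

definition rep :: "'k \<Rightarrow> real \<Rightarrow> 'k" where
  "rep x t = Phi (\<lambda>r. rheat t r + rheat' t r) x"

lemma rep_W: "0 < t \<Longrightarrow> x \<in> W \<Longrightarrow> rep x t \<in> W"
  unfolding rep_def by (intro Phi_W continuous_intros continuous_rheat continuous_rheat') auto

lemma R_rep:
  assumes t: "0 < t"
  shows "R (rep x t) = Phi (rheat t) x"
proof -
  have "R (rep x t) = Phi (\<lambda>r. r * (rheat t r + rheat' t r)) x"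
    unfolding rep_def using t
    by (subst Phi_mult) (auto simp: Phi_ident intro!: continuous_intros continuous_rheat continuous_rheat')
  also have "\<dots> = Phi (rheat t) x"
    using t by (intro Phi_cong) (auto simp: rheat_def rheat'_def field_simps)
  finally show ?thesis .
qed

lemma rep_diff:
  assumes t: "0 < t"
  shows "R (rep x t) - rep x t = - Phi (rheat' t) x"
  unfolding R_rep[OF t] unfolding rep_def using t
  by (simp add: Phi_add continuous_rheat continuous_rheat')

lemma rep_shift:
  assumes "0 \<le> s" "0 < t"
  shows "rep x (s + t) = Phi (rheat s) (rep x t)"
  unfolding rep_def using assms
proof (subst Phi_mult[symmetric])
  show "Phi (\<lambda>r. rheat (s + t) r + rheat' (s + t) r) x = Phi (\<lambda>r. rheat s r * (rheat t r + rheat' t r)) x"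
    using assms by (intro Phi_cong) (auto simp: rheat_def rheat'_def exp_add[symmetric] algebra_simps)
qed (auto intro!: continuous_intros continuous_rheat continuous_rheat')

text \<open>Smoothing is done once, up to time t / 2; beyond that time \<open>rep x\<close> is an
  ordinary orbit with initial value \<open>rep x (t / 2)\<close>.\<close>

lemma continuous_rep:
  assumes x: "x \<in> W"
  shows "continuous_on {0<..} (rep x)"
  unfolding continuous_on_eq_continuous_at[OF open_greaterThan]
proof
  fix t :: real assume t: "t \<in> {0<..}"
  then have t2: "0 < t / 2" by simp
  have "continuous_on {t / 2<..} (\<lambda>s. Phi (rheat (s - t / 2)) (rep x (t / 2)))"
    by (rule continuous_on_compose2[OF orbit_continuous[OF rep_W[OF t2 x]]]) (auto intro!: continuous_intros)
  then have "continuous_on {t / 2<..} (rep x)"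
  proof (rule continuous_on_eq)
    fix s assume "s \<in> {t / 2<..}"
    then show "Phi (rheat (s - t / 2)) (rep x (t / 2)) = rep x s"
      using rep_shift[of "s - t / 2" "t / 2" x] t2 by simp
  qed
  then show "isCont (rep x) t"
    using t2 by (simp add: continuous_on_eq_continuous_at)
qed

lemma orbit_derivative:
  assumes t: "0 < t"
  shows "((\<lambda>h. (1 / h) *\<^sub>R (Phi (rheat (t + h)) x - Phi (rheat t) x) - (R (rep x t) - rep x t)) \<longlongrightarrow> 0) (at 0)"
proof (rule tendstoI)
  fix e :: real assume e: "0 < e"
  \<comment> \<open>The summand 1 avoids division by 0 at x = 0.\<close>
  define e' where "e' = e / (2 * (norm x + 1))"
  have e': "0 < e'" unfolding e'_def using e by (auto intro!: divide_pos_pos add_nonneg_pos)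
  have e'x: "e' * norm x < e"
  proof -
    have "e' * norm x \<le> e' * (norm x + 1)" using e' by (intro mult_left_mono) auto
    also have "\<dots> = e / 2" unfolding e'_def by (simp add: field_simps add_nonneg_eq_0_iff)
    finally show ?thesis using e by simp
  qed
  obtain d where d: "d > 0" "d \<le> t / 2" and le: "\<And>h r. h \<noteq> 0 \<Longrightarrow> \<bar>h\<bar> < d \<Longrightarrow> r \<in> {0..1} \<Longrightarrow>
      \<bar>(rheat (t + h) r - rheat t r) / h + rheat' t r\<bar> \<le> e'"
    using rheat_has_derivative[OF t e'] by blast
  have "norm ((1 / h) *\<^sub>R (Phi (rheat (t + h)) x - Phi (rheat t) x) - (R (rep x t) - rep x t)) < e"
    if h: "h \<noteq> 0" "\<bar>h\<bar> < d" for h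
  proof -
    have c: "continuous_on {0..1} (rheat (t + h))" "continuous_on {0..1} (rheat t)" "continuous_on {0..1} (rheat' t)"
      using t h d by (auto intro: continuous_rheat continuous_rheat')
    have "(1 / h) *\<^sub>R (Phi (rheat (t + h)) x - Phi (rheat t) x) - (R (rep x t) - rep x t) =
      Phi (\<lambda>r. (1 / h) * (rheat (t + h) r - rheat t r) + rheat' t r) x"
      unfolding rep_diff[OF t] diff_minus_eq_add
      by (simp only: Phi_add Phi_diff Phi_scale c continuous_on_diff continuous_on_mult continuous_on_const)
    also have "norm \<dots> \<le> e' * norm x"
      using le[OF h] by (intro Phi_norm_le continuous_intros c) simp
    also have "\<dots> < e" by (rule e'x)
    finally show ?thesis .
  qed
  then show "\<forall>\<^sub>F h in at 0. dist ((1 / h) *\<^sub>R (Phi (rheat (t + h)) x - Phi (rheat t) x) - (R (rep x t) - rep x t)) 0 < e"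
    unfolding eventually_at using d(1) by (auto simp: dist_norm)
qed

lemma derivative_transfer:
  assumes t: "0 < t" and u: "\<And>s. 0 \<le> s \<Longrightarrow> u s \<in> S" and y: "y \<in> S"
  shows "has_derivative_in N u y t \<longleftrightarrow>
    ((\<lambda>h. (1 / h) *\<^sub>R (V (u (t + h)) - V (u t)) - V y) \<longlongrightarrow> 0) (at 0)"
proof -
  have "\<forall>\<^sub>F h in at 0. N ((1 / h) *\<^sub>R (u (t + h) - u t) - y) =
      norm ((1 / h) *\<^sub>R (V (u (t + h)) - V (u t)) - V y)"
    unfolding eventually_at
  proof (intro exI[of _ t] conjI ballI impI t)
    \<comment> \<open>Since |h| < t, the time t + h is positive and u is known to lie in S
      there.\<close>
    fix h :: real assume "h \<noteq> 0 \<and> dist h 0 < t"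
    then have "u (t + h) \<in> S" "u t \<in> S" using t u by auto
    then show "N ((1 / h) *\<^sub>R (u (t + h) - u t) - y) = norm ((1 / h) *\<^sub>R (V (u (t + h)) - V (u t)) - V y)"
      using y by (simp add: norm_V[symmetric] V_simps S_intros)
  qed
  then show ?thesis
    unfolding has_derivative_in_def using tendsto_cong tendsto_norm_zero_iff by fastforce
qed

lemma solution_T:
  assumes u0: "u0 \<in> S"
  shows "acp_solution S N graph u0 (\<lambda>t. T t u0)" "C1_in S N (\<lambda>t. T t u0)"
proof -
  let ?v = "rep (V u0)"
  have v: "?v t \<in> W" if "0 < t" for t using that by (intro rep_W V_in u0)
  have Tv: "T t u0 = U (R (?v t))" if "0 < t" for t using that by (simp add: R_rep T_def)
  have deriv: "has_derivative_in N (\<lambda>t. T t u0) (U (R (?v t) - ?v t)) t" if t: "0 < t" for t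
  proof (subst derivative_transfer[OF t])
    show "U (R (?v t) - ?v t) \<in> S" using t by (intro U_in W_intros R_W v)
    have "\<forall>\<^sub>F h in at 0. (1 / h) *\<^sub>R (Phi (rheat (t + h)) (V u0) - Phi (rheat t) (V u0)) - (R (?v t) - ?v t) =
       (1 / h) *\<^sub>R (V (T (t + h) u0) - V (T t u0)) - V (U (R (?v t) - ?v t))"
      unfolding eventually_at
      by (intro exI[of _ t]) (use t u0 in \<open>auto simp: T_def Phi_W continuous_rheat V_in v R_W W_intros simp del: U_simps\<close>)
    from Lim_transform_eventually[OF orbit_derivative[OF t] this]
    show "((\<lambda>h. (1 / h) *\<^sub>R (V (T (t + h) u0) - V (T t u0)) - V (U (R (?v t) - ?v t))) \<longlongrightarrow> 0) (at 0)" .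
  qed (use T_in u0 in auto)
  show "acp_solution S N graph u0 (\<lambda>t. T t u0)"
    unfolding acp_solution_def
  proof (intro conjI allI impI)
    fix t :: real assume t: "0 < t"
    show "\<exists>y. (T t u0, y) \<in> graph \<and> has_derivative_in N (\<lambda>t. T t u0) y t"
      unfolding graph_def using deriv[OF t] Tv[OF t] v[OF t] by blast
  qed (use T_in u0 T_0 T_continuous_in in auto)
  show "C1_in S N (\<lambda>t. T t u0)"
    unfolding C1_in_def
  proof (intro exI[of _ "\<lambda>t. U (R (?v t) - ?v t)"] conjI allI impI)
    fix t :: real assume t: "0 < t"
    show "T t u0 \<in> S" using t u0 by (intro T_in) auto
    show "U (R (?v t) - ?v t) \<in> S" using t by (intro U_in W_intros R_W v)
    show "has_derivative_in N (\<lambda>t. T t u0) (U (R (?v t) - ?v t)) t" by (rule deriv[OF t])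
  next
    show "continuous_in N {0<..} (\<lambda>t. U (R (?v t) - ?v t))"
      unfolding continuous_in_def
    proof
      fix t :: real assume t: "t \<in> {0<..}"
      have bl: "bounded_linear R"
        by (rule bounded_linear_intro[of _ 1]) (use norm_R_le in auto)
      have "continuous_on {0<..} (\<lambda>t. R (?v t) - ?v t)"
        by (intro continuous_intros bounded_linear.continuous_on[OF bl] continuous_rep V_in u0)
      then have "((\<lambda>s. R (?v s) - ?v s) \<longlongrightarrow> R (?v t) - ?v t) (at t within {0<..})"
        using t unfolding continuous_on_def by auto
      then have "((\<lambda>s. norm ((R (?v s) - ?v s) - (R (?v t) - ?v t))) \<longlongrightarrow> 0) (at t within {0<..})"
        by (intro tendsto_norm_zero LIM_zero)
      moreover have "\<forall>\<^sub>F s in at t within {0<..}. norm ((R (?v s) - ?v s) - (R (?v t) - ?v t))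
          = N (U (R (?v s) - ?v s) - U (R (?v t) - ?v t))"
        unfolding eventually_at_filter
      proof (intro always_eventually allI impI)
        fix s :: real assume "s \<in> {0<..}"
        then have "(R (?v s) - ?v s) - (R (?v t) - ?v t) \<in> W" using t by (intro W_intros R_W v) auto
        from U_norm[OF this] show "norm ((R (?v s) - ?v s) - (R (?v t) - ?v t))
          = N (U (R (?v s) - ?v s) - U (R (?v t) - ?v t))" by simp
      qed
      ultimately show "((\<lambda>s. N (U (R (?v s) - ?v s) - U (R (?v t) - ?v t))) \<longlongrightarrow> 0) (at t within {0<..})"
        by (rule Lim_transform_eventually)
    qed
  qed
qed

text \<open>The difference of two solutions has nonincreasing norm.\<close>

lemma solution_unique:
  assumes u: "acp_solution S N graph u0 u" and w: "acp_solution S N graph u0 w" and t: "0 \<le> t"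
  shows "w t = u t"
proof -
  have uS: "\<And>s. 0 \<le> s \<Longrightarrow> u s \<in> S" and wS: "\<And>s. 0 \<le> s \<Longrightarrow> w s \<in> S" and eq0: "u 0 = w 0"
    using u w unfolding acp_solution_def by auto
  define D where "D s = V (u s) - V (w s)" for s
  have cont: "continuous_on {0..} (\<lambda>s. V (z s))" if z: "acp_solution S N graph u0 z" for z
    unfolding continuous_on_def
  proof
    fix s :: real assume s: "s \<in> {0..}"
    have zS: "\<And>s. 0 \<le> s \<Longrightarrow> z s \<in> S" using z unfolding acp_solution_def by auto
    have "((\<lambda>r. N (z r - z s)) \<longlongrightarrow> 0) (at s within {0..})"
      using z s unfolding acp_solution_def continuous_in_def by auto
    moreover have "\<forall>\<^sub>F r in at s within {0..}. N (z r - z s) = norm (V (z r) - V (z s))"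
      unfolding eventually_at_filter using zS s
      by (intro always_eventually) (auto simp: norm_V[symmetric] V_simps S_intros)
    ultimately have "((\<lambda>r. norm (V (z r) - V (z s))) \<longlongrightarrow> 0) (at s within {0..})"
      by (rule Lim_transform_eventually)
    then show "((\<lambda>r. V (z r)) \<longlongrightarrow> V (z s)) (at s within {0..})"
      by (rule LIM_zero_cancel[OF tendsto_norm_zero_cancel])
  qed
  have deriv: "\<exists>x. x \<in> W \<and> V (z s) = R x \<and> ((\<lambda>s. V (z s)) has_vector_derivative (R x - x)) (at s)"
    if z: "acp_solution S N graph u0 z" and s: "0 < s" for z s
  proof -
    have zS: "\<And>s. 0 \<le> s \<Longrightarrow> z s \<in> S" using z unfolding acp_solution_def by auto
    obtain y where y: "(z s, y) \<in> graph" "has_derivative_in N z y s"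
      using z s unfolding acp_solution_def by blast
    obtain x where x: "x \<in> W" "z s = U (R x)" "y = U (R x - x)" using y(1) unfolding graph_def by auto
    have y_in: "y \<in> S" unfolding x(3) by (intro U_in W_intros R_W x)
    have "V y = R x - x" unfolding x(3) using x(1) by (simp add: W_intros R_W del: U_simps)
    then have "((\<lambda>h. (1 / h) *\<^sub>R (V (z (s + h)) - V (z s)) - (R x - x)) \<longlongrightarrow> 0) (at 0)"
      using derivative_transfer[OF s zS y_in] y(2) by auto
    then have "((\<lambda>s. V (z s)) has_vector_derivative (R x - x)) (at s)"
      by (rule has_vector_derivative_quotient)
    then show ?thesis using x by (auto simp: R_W)
  qed
  have "D t \<bullet> D t \<le> D 0 \<bullet> D 0"
    using t
  proof (rule DERIV_nonpos_imp_decreasing_open[where f = "\<lambda>s. D s \<bullet> D s"])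
      fix s :: real assume "0 < s"
      obtain x where x: "x \<in> W" "V (u s) = R x" "((\<lambda>s. V (u s)) has_vector_derivative (R x - x)) (at s)"
        using deriv[OF u \<open>0 < s\<close>] by blast
      obtain y where y: "y \<in> W" "V (w s) = R y" "((\<lambda>s. V (w s)) has_vector_derivative (R y - y)) (at s)"
        using deriv[OF w \<open>0 < s\<close>] by blast
      define q where "q = x - y"
      have Dq: "D s = R q" unfolding D_def q_def using x y by simp
      have D': "(D has_vector_derivative (R q - q)) (at s)"
      proof -
        have "D = (\<lambda>s. V (u s) - V (w s))" "R q - q = (R x - x) - (R y - y)"
          by (simp_all add: D_def q_def fun_eq_iff)
        then show ?thesis by (simp only: has_vector_derivative_diff[OF x(3) y(3)])
      qed
      have "((\<lambda>s. D s \<bullet> D s) has_vector_derivative (D s \<bullet> (R q - q) + (R q - q) \<bullet> D s)) (at s)"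
        by (rule bounded_bilinear.has_vector_derivative[OF bounded_bilinear_inner D' D'])
      then have "DERIV (\<lambda>s. D s \<bullet> D s) s :> D s \<bullet> (R q - q) + (R q - q) \<bullet> D s"
        by (simp add: has_real_derivative_iff_has_vector_derivative)
      \<comment> \<open>Dissipativity: D s = R q, and R^2 \<le> R makes the product of R q with R q
        - q nonpositive.\<close>
      moreover have "D s \<bullet> (R q - q) + (R q - q) \<bullet> D s \<le> 0"
      proof -
        have "0 \<le> (R q - R (R q)) \<bullet> q" by (rule quadratic_nonneg)
        then have "R q \<bullet> R q \<le> R q \<bullet> q" by (simp add: inner_diff sym)
        then show ?thesis unfolding Dq by (simp add: inner_diff inner_commute)
      qed
      ultimately show "\<exists>y. DERIV (\<lambda>s. D s \<bullet> D s) s :> y \<and> y \<le> 0" by blast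
    next
      show "continuous_on {0..t} (\<lambda>s. D s \<bullet> D s)"
        unfolding D_def by (intro continuous_intros continuous_on_subset[OF cont[OF u]] continuous_on_subset[OF cont[OF w]]) auto
  qed
  also have "D 0 \<bullet> D 0 = 0" unfolding D_def eq0 by simp
  finally have "D t = 0" using inner_ge_zero[of "D t"] by (metis inner_eq_zero_iff order_antisym)
  then show ?thesis unfolding D_def using U_V uS[OF t] wS[OF t] by (metis eq_iff_diff_eq_0)
qed

text \<open>A mean ergodic argument: after the component along e is subtracted, the initial vector
  lies in the closure of the range of 1 - R, and on the range itself \<open>rheat_decay\<close>
  gives decay of order 1 / t.\<close>

lemma T_limit:
  assumes e: "e \<in> W" "R e = e" "e \<noteq> 0" and ker: "\<And>x. x \<in> W \<Longrightarrow> R x = x \<Longrightarrow> \<exists>c. x = c *\<^sub>R e"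
    and u0: "u0 \<in> S"
  shows "((\<lambda>t. N (T t u0 - U ((V u0 \<bullet> e / (e \<bullet> e)) *\<^sub>R e))) \<longlongrightarrow> 0) at_top"
proof -
  define x where "x = V u0 - (V u0 \<bullet> e / (e \<bullet> e)) *\<^sub>R e"
  have x: "x \<in> W" unfolding x_def by (intro W_intros V_in u0 e)
  have xe: "x \<bullet> e = 0" unfolding x_def using e(3) by (simp add: inner_diff_left)
  define M where "M = (\<lambda>w. w - R w) ` W"
  have linM: "linear (\<lambda>w. w - R w)" using linear by (intro linear_compose_sub linear_ident)
  have M: "subspace M" unfolding M_def by (rule linear_subspace_image[OF linM W(1)])
  obtain p where p: "p \<in> closure M" "\<And>m. m \<in> M \<Longrightarrow> p \<bullet> m = x \<bullet> m" using inner_witness[OF M] by blast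
  have "p \<in> W" using p(1) W(2) closure_minimal[of M W] unfolding M_def by (auto intro: W_intros R_W)
  then have q: "x - p \<in> W" using x by (intro W_intros)
  \<comment> \<open>The part x - p orthogonal to M is fixed by R: for z = (1 - R)(x - p), symmetry
    gives \<open>z \<bullet> z = (x - p) \<bullet> (z - R z)\<close>, which is 0. Being a multiple
    of e and orthogonal to e, it vanishes.\<close>
  define z where "z = (x - p) - R (x - p)"
  have "z \<in> W" unfolding z_def by (intro W_intros(2)[OF q R_W[OF q]])
  then have "z - R z \<in> M" unfolding M_def by (rule imageI)
  then have "(x - p) \<bullet> (z - R z) = 0" using p(2) by (simp add: inner_diff_left)
  then have "z \<bullet> z = 0" unfolding z_def by (simp add: inner_diff sym)
  then have "R (x - p) = x - p" by (metis inner_eq_zero_iff right_minus_eq z_def)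
  then obtain c where c: "x - p = c *\<^sub>R e" using ker q by blast
  have "p \<bullet> e = 0"
  proof -
    have "M \<subseteq> {y. e \<bullet> y = 0}" unfolding M_def using e(2) by (auto simp: inner_diff sym[symmetric])
    then have "closure M \<subseteq> {y. e \<bullet> y = 0}" by (intro closure_minimal closed_hyperplane)
    then show ?thesis using p(1) by (auto simp: inner_commute)
  qed
  then have "(x - p) \<bullet> e = 0" using xe by (simp add: inner_diff_left)
  then have "x = p" using c e(3) by simp
  then have xM: "x \<in> closure M" using p by simp
  define Q where "Q t y = (if 0 < t then Phi (rheat t) y else 0)" for t y
  have "((\<lambda>t. Q t x) \<longlongrightarrow> 0) at_top"
  proof (rule tendsto_zero_on_closure[where C = 1, OF _ _ _ xM])
    show "Q t (y - z) = Q t y - Q t z" for t y z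
      using linear_diff[OF Phi_linear[OF continuous_rheat]] unfolding Q_def by auto
    show "\<forall>\<^sub>F t in at_top. \<forall>y. norm (Q t y) \<le> 1 * norm y"
      unfolding Q_def using Phi_rheat_le by (intro always_eventually) auto
    fix m assume "m \<in> M"
    then obtain w where m: "m = w - R w" unfolding M_def by auto
    show "((\<lambda>t. Q t m) \<longlongrightarrow> 0) at_top"
    proof (rule Lim_null_comparison)
      show "\<forall>\<^sub>F t in at_top. norm (Q t m) \<le> 1 / t * norm w"
        using eventually_gt_at_top[of 0]
      proof eventually_elim
        case (elim t)
        have c: "continuous_on {0..1} (rheat t)" using elim by (intro continuous_rheat) auto
        have "Q t m = Phi (\<lambda>r. rheat t r * (1 - r)) w"
          unfolding Q_def m using elim
          by (simp add: Phi_mult Phi_diff Phi_1 Phi_ident c continuous_on_diff)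
        also have "norm \<dots> \<le> 1 / t * norm w"
          by (intro Phi_norm_le rheat_decay elim continuous_intros c)
        finally show ?case .
      qed
      show "((\<lambda>t. 1 / t * norm w) \<longlongrightarrow> 0) at_top"
        by (intro tendsto_mult_left_zero tendsto_divide_0[OF tendsto_const] filterlim_at_top_imp_at_infinity filterlim_ident)
    qed
  qed
  then have "((\<lambda>t. norm (Q t x)) \<longlongrightarrow> 0) at_top" by (rule tendsto_norm_zero)
  moreover have "\<forall>\<^sub>F t in at_top. norm (Q t x) = N (T t u0 - U ((V u0 \<bullet> e / (e \<bullet> e)) *\<^sub>R e))"
    using eventually_gt_at_top[of 0]
  proof eventually_elim
    case (elim t)
    have c: "continuous_on {0..1} (rheat t)" using elim by (intro continuous_rheat) auto
    have "Q t x = Phi (rheat t) (V u0) - (V u0 \<bullet> e / (e \<bullet> e)) *\<^sub>R e"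
      unfolding Q_def x_def using elim linear_diff[OF Phi_linear[OF c]] linear_scale[OF Phi_linear[OF c]]
        Phi_fixed_vector[OF c e(2)] by (simp add: rheat_def)
    moreover have "norm (Phi (rheat t) (V u0) - (V u0 \<bullet> e / (e \<bullet> e)) *\<^sub>R e) =
        N (U (Phi (rheat t) (V u0) - (V u0 \<bullet> e / (e \<bullet> e)) *\<^sub>R e))"
      by (intro U_norm[symmetric] W_intros Phi_W c V_in u0 e)
    ultimately show ?case by (simp add: T_def)
  qed
  ultimately show ?thesis by (rule Lim_transform_eventually)
qed

text \<open>The preimages v of the values of u under R are exposed because their continuity in the
  Hilbert norm becomes continuity in the domain norm in both concrete problems.\<close>

theorem cauchy_problem:
  assumes e: "e \<in> W" "R e = e" "e \<noteq> 0" and ker: "\<forall>x\<in>W. R x = x \<longrightarrow> (\<exists>c. x = c *\<^sub>R e)"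
    and u0: "u0 \<in> S"
  shows "\<exists>u v. acp_solution S N graph u0 u \<and> C1_in S N u \<and>
    (\<forall>t>0. v t \<in> W \<and> u t = U (R (v t))) \<and> continuous_on {0<..} v \<and>
    (\<forall>w. acp_solution S N graph u0 w \<longrightarrow> (\<forall>t\<ge>0. w t = u t)) \<and>
    ((\<lambda>t. N (u t - U ((V u0 \<bullet> e / (e \<bullet> e)) *\<^sub>R e))) \<longlongrightarrow> 0) at_top"
proof (intro exI conjI)
  show "acp_solution S N graph u0 (\<lambda>t. T t u0)" "C1_in S N (\<lambda>t. T t u0)" by (rule solution_T[OF u0])+
  show "\<forall>t>0. rep (V u0) t \<in> W \<and> T t u0 = U (R (rep (V u0) t))"
    using rep_W[OF _ V_in[OF u0]] R_rep by (simp add: T_def)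
  show "continuous_on {0<..} (rep (V u0))" by (rule continuous_rep[OF V_in[OF u0]])
  show "\<forall>w. acp_solution S N graph u0 w \<longrightarrow> (\<forall>t\<ge>0. w t = T t u0)"
    using solution_unique[OF solution_T(1)[OF u0]] by auto
  show "((\<lambda>t. N (T t u0 - U ((V u0 \<bullet> e / (e \<bullet> e)) *\<^sub>R e))) \<longlongrightarrow> 0) at_top"
    using ker by (intro T_limit e u0) auto
qed

end

subsection \<open>Completeness of the space of square integrable functions\<close>

lemma l2_rel_refl [simp]: "l2_rel f f \<longleftrightarrow> sq_integrable f"
  by (simp add: l2_rel_def)

lemma sq_integrable_rep [simp]: "sq_integrable (rep_l2 u)"
  using Quotient_rep_reflp[OF Quotient_l2, of u] by simp

lemma abs_rep_l2 [simp]: "abs_l2 (rep_l2 u) = u"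
  by (rule Quotient_abs_rep[OF Quotient_l2])

lemma rep_abs_l2:
  assumes "sq_integrable f"
  shows "AE x in boxm. rep_l2 (abs_l2 f) x = f x"
  using Quotient_rep_abs[OF Quotient_l2, of f] assms by (simp add: l2_rel_def)

lemma abs_l2_eq_iff: "sq_integrable f \<Longrightarrow> sq_integrable g \<Longrightarrow> abs_l2 f = abs_l2 g \<longleftrightarrow> (AE x in boxm. f x = g x)"
  using Quotient_rel[OF Quotient_l2, of f g] by (auto simp: l2_rel_def)

lemma inner_abs_l2: "sq_integrable f \<Longrightarrow> sq_integrable g \<Longrightarrow> abs_l2 f \<bullet> abs_l2 g = (LINT x|boxm. f x * g x)"
  by (intro inner_l2.abs_eq) simp_all

lemma inner_l2_abs: "sq_integrable g \<Longrightarrow> u \<bullet> abs_l2 g = (LINT x|boxm. rep_l2 u x * g x)"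
  using inner_abs_l2[of "rep_l2 u" g] by simp

lemma add_abs_l2: "sq_integrable f \<Longrightarrow> sq_integrable g \<Longrightarrow> abs_l2 f + abs_l2 g = abs_l2 (\<lambda>x. f x + g x)"
  by (intro plus_l2.abs_eq) simp_all

lemma scaleR_abs_l2: "sq_integrable f \<Longrightarrow> c *\<^sub>R abs_l2 f = abs_l2 (\<lambda>x. c * f x)"
  by (intro scaleR_l2.abs_eq) simp_all

lemma sq_integrable_diff: "sq_integrable f \<Longrightarrow> sq_integrable g \<Longrightarrow> sq_integrable (\<lambda>x. f x - g x)"
  using sq_integrable_add[of f "\<lambda>x. -1 * g x"] sq_integrable_scale[of g "-1"] by simp

lemma diff_abs_l2:
  assumes "sq_integrable f" "sq_integrable g"
  shows "abs_l2 f - abs_l2 g = abs_l2 (\<lambda>x. f x - g x)"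
proof -
  have "abs_l2 f - abs_l2 g = abs_l2 f + (- 1) *\<^sub>R abs_l2 g" by simp
  also have "\<dots> = abs_l2 f + abs_l2 (\<lambda>x. - 1 * g x)" by (simp only: scaleR_abs_l2[OF assms(2)])
  also have "\<dots> = abs_l2 (\<lambda>x. f x - g x)" using add_abs_l2[OF assms(1) sq_integrable_scale[OF assms(2)], of "- 1"] by simp
  finally show ?thesis .
qed

lemma l2_const_abs: "l2_const c = abs_l2 (\<lambda>x. c)"
  by (rule l2_const.abs_eq)

lemma norm_abs_l2: "sq_integrable f \<Longrightarrow> (norm (abs_l2 f))\<^sup>2 = (LINT x|boxm. (f x)\<^sup>2)"
  unfolding power2_norm_eq_inner by (simp add: inner_abs_l2 power2_eq_square)

lemma rep_l2_measurable [measurable]: "rep_l2 u \<in> borel_measurable boxm"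
  using sq_integrable_rep[of u] by (simp add: sq_integrable_def)

lemma L1_le_L2:
  fixes f :: "real ^ 'n::finite \<Rightarrow> real"
  assumes f: "sq_integrable f"
  shows "integrable boxm (\<lambda>x. \<bar>f x\<bar>)" "(LINT x|boxm. \<bar>f x\<bar>) \<le> norm (abs_l2 f) * norm (l2_const 1 :: 'n l2)"
proof -
  have af: "sq_integrable (\<lambda>x. \<bar>f x\<bar>)" using f by (auto simp: sq_integrable_def)
  show "integrable boxm (\<lambda>x. \<bar>f x\<bar>)" using sq_integrable_mult[OF af sq_integrable_const[of 1]] by simp
  have "(LINT x|boxm. \<bar>f x\<bar>) = abs_l2 (\<lambda>x. \<bar>f x\<bar>) \<bullet> l2_const 1"
    by (simp add: l2_const_abs inner_abs_l2 af sq_integrable_const)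
  also have "\<dots> \<le> norm (abs_l2 (\<lambda>x. \<bar>f x\<bar>)) * norm (l2_const 1 :: 'n l2)" by (rule norm_cauchy_schwarz)
  also have "norm (abs_l2 (\<lambda>x. \<bar>f x\<bar>)) = norm (abs_l2 f)"
    by (rule power2_eq_imp_eq) (simp_all add: norm_abs_l2[OF af] norm_abs_l2[OF f])
  finally show "(LINT x|boxm. \<bar>f x\<bar>) \<le> norm (abs_l2 f) * norm (l2_const 1 :: 'n l2)" .
qed

text \<open>The extended integral allows Fatou to be applied before square integrability of a limit
  is known.\<close>

lemma norm_diff_l2: "ennreal ((norm (u - v))\<^sup>2) = (\<integral>\<^sup>+x. ennreal ((rep_l2 u x - rep_l2 v x)\<^sup>2) \<partial>boxm)"
proof -
  have sq: "sq_integrable (\<lambda>x. rep_l2 u x - rep_l2 v x)" by (intro sq_integrable_diff) simp_all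
  have "(norm (u - v))\<^sup>2 = (LINT x|boxm. (rep_l2 u x - rep_l2 v x)\<^sup>2)"
    using diff_abs_l2[of "rep_l2 u" "rep_l2 v"] norm_abs_l2[OF sq] by simp
  then show ?thesis using sq by (simp add: nn_integral_eq_integral sq_integrable_def)
qed

text \<open>The box has finite measure, so the L1 norms of the differences are summable as well, and
  the telescoping series converges absolutely almost everywhere.\<close>

lemma AE_summable_differences:
  fixes Y :: "nat \<Rightarrow> 'n::finite l2"
  assumes Y: "\<And>n. norm (Y (Suc n) - Y n) \<le> (1/2) ^ n"
  shows "AE x in boxm. convergent (\<lambda>n. rep_l2 (Y n) x)"
proof -
  define d where "d n x = rep_l2 (Y (Suc n)) x - rep_l2 (Y n) x" for n x
  have sq: "sq_integrable (d n)" for n unfolding d_def by (intro sq_integrable_diff) simp_all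
  have meas [measurable]: "d n \<in> borel_measurable boxm" for n using sq by (simp add: sq_integrable_def)
  let ?C = "norm (l2_const 1 :: 'n l2)"
  have le: "(LINT x|boxm. \<bar>d n x\<bar>) \<le> (1/2) ^ n * ?C" for n
  proof -
    have "abs_l2 (d n) = Y (Suc n) - Y n"
      unfolding d_def using diff_abs_l2[of "rep_l2 (Y (Suc n))" "rep_l2 (Y n)"] by simp
    then show ?thesis using L1_le_L2(2)[OF sq, of n] Y[of n] mult_right_mono[OF Y[of n], of ?C] by simp
  qed
  have "(\<integral>\<^sup>+x. (\<Sum>n. ennreal \<bar>d n x\<bar>) \<partial>boxm) = (\<Sum>n. \<integral>\<^sup>+x. ennreal \<bar>d n x\<bar> \<partial>boxm)"
    by (intro nn_integral_suminf) measurable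
  also have "\<dots> = (\<Sum>n. ennreal (LINT x|boxm. \<bar>d n x\<bar>))"
    using L1_le_L2(1)[OF sq] by (simp add: nn_integral_eq_integral)
  also have "\<dots> \<le> (\<Sum>n. ennreal ((1/2) ^ n * ?C))" using le by (intro suminf_le ennreal_leI) auto
  also have "\<dots> = ennreal (\<Sum>n. (1/2) ^ n * ?C)"
    by (intro suminf_ennreal2 summable_mult2 summable_geometric) auto
  also have "\<dots> < \<infinity>" by simp
  finally have "AE x in boxm. (\<Sum>n. ennreal \<bar>d n x\<bar>) \<noteq> \<infinity>"
    by (intro nn_integral_PInf_AE) auto
  then show ?thesis
  proof eventually_elim
    case (elim x)
    then have "summable (\<lambda>n. \<bar>d n x\<bar>)" by (intro summable_suminf_not_top) auto
    then have "summable (\<lambda>n. d n x)" by (rule summable_rabs_cancel)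
    then have "convergent (\<lambda>n. (\<Sum>i<n. d i x) + rep_l2 (Y 0) x)"
      unfolding summable_iff_convergent by (intro convergent_add convergent_const)
    moreover have "(\<Sum>i<n. d i x) + rep_l2 (Y 0) x = rep_l2 (Y n) x" for n
      unfolding d_def by (subst sum_lessThan_telescope) simp
    ultimately show ?case by simp
  qed
qed

instance l2 :: (finite) complete_space
proof
  fix X :: "nat \<Rightarrow> 'a l2"
  assume X: "Cauchy X"
  have "\<forall>k. \<exists>M. \<forall>m\<ge>M. \<forall>n\<ge>M. norm (X m - X n) < (1/2) ^ k"
    using X unfolding Cauchy_def dist_norm by simp
  then obtain M where M: "\<And>k m n. m \<ge> M k \<Longrightarrow> n \<ge> M k \<Longrightarrow> norm (X m - X n) < (1/2) ^ k" by metis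
  \<comment> \<open>The index r n dominates n and every M k with k \<le> n, so consecutive terms of
    the subsequence differ by at most (1/2)^n.\<close>
  define r where "r n = n + (\<Sum>k\<le>n. M k)" for n
  have r: "M n \<le> r n" "M n \<le> r (Suc n)" "n \<le> r n" for n
    unfolding r_def using member_le_sum[of n "{..n}" M] by auto
  define F where "F n = rep_l2 (X (r n))" for n
  define g where "g x = lim (\<lambda>n. F n x)" for x
  have [measurable]: "F n \<in> borel_measurable boxm" for n unfolding F_def by measurable
  have [measurable]: "g \<in> borel_measurable boxm" unfolding g_def[abs_def] by measurable
  have "AE x in boxm. convergent (\<lambda>n. F n x)"
    unfolding F_def by (intro AE_summable_differences less_imp_le M r)
  then have lim: "AE x in boxm. (\<lambda>n. F n x) \<longlonglongrightarrow> g x"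
    by eventually_elim (simp add: g_def convergent_LIMSEQ_iff)
  \<comment> \<open>Fatou along the subsequence, applied to every member m of the tail.\<close>
  have bound: "(\<integral>\<^sup>+x. ennreal ((rep_l2 (X m) x - g x)\<^sup>2) \<partial>boxm) \<le> ennreal (((1/2) ^ k)\<^sup>2)" if m: "m \<ge> M k" for m k
  proof -
    have "(\<integral>\<^sup>+x. ennreal ((rep_l2 (X m) x - g x)\<^sup>2) \<partial>boxm)
        = (\<integral>\<^sup>+x. liminf (\<lambda>n. ennreal ((rep_l2 (X m) x - F n x)\<^sup>2)) \<partial>boxm)"
    proof (rule nn_integral_cong_AE)
      show "AE x in boxm. ennreal ((rep_l2 (X m) x - g x)\<^sup>2) = liminf (\<lambda>n. ennreal ((rep_l2 (X m) x - F n x)\<^sup>2))"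
        using lim
      proof eventually_elim
        case (elim x)
        then have "(\<lambda>n. ennreal ((rep_l2 (X m) x - F n x)\<^sup>2)) \<longlonglongrightarrow> ennreal ((rep_l2 (X m) x - g x)\<^sup>2)"
          by (intro tendsto_intros)
        then show ?case using lim_imp_Liminf[OF sequentially_bot] by metis
      qed
    qed
    also have "\<dots> \<le> liminf (\<lambda>n. \<integral>\<^sup>+x. ennreal ((rep_l2 (X m) x - F n x)\<^sup>2) \<partial>boxm)"
      by (intro nn_integral_liminf) measurable
    also have "\<dots> = liminf (\<lambda>n. ennreal ((norm (X m - X (r n)))\<^sup>2))" by (simp add: norm_diff_l2 F_def)
    also have "\<dots> \<le> limsup (\<lambda>n. ennreal ((norm (X m - X (r n)))\<^sup>2))" by (rule Liminf_le_Limsup) simp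
    also have "\<dots> \<le> ennreal (((1/2) ^ k)\<^sup>2)"
    proof (rule Limsup_bounded)
      show "\<forall>\<^sub>F n in sequentially. ennreal ((norm (X m - X (r n)))\<^sup>2) \<le> ennreal (((1/2) ^ k)\<^sup>2)"
        using eventually_ge_at_top[of "M k"]
      proof eventually_elim
        case (elim n)
        then have "norm (X m - X (r n)) < (1/2) ^ k" using m r(3)[of n] by (intro M) auto
        then show ?case by (intro ennreal_leI power_mono) auto
      qed
    qed
    finally show ?thesis .
  qed
  have sq: "sq_integrable (\<lambda>x. rep_l2 (X m) x - g x)" if "m \<ge> M k" for m k
    unfolding sq_integrable_def using bound[OF that]
    by (auto intro!: integrableI_nonneg simp: le_less_trans[OF _ ennreal_less_top])
  have g: "sq_integrable g"
    using sq_integrable_diff[OF sq_integrable_rep[of "X (M 0)"] sq[of 0 "M 0"]] by simp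
  have le: "norm (X m - abs_l2 g) \<le> (1/2) ^ k" if "m \<ge> M k" for m k
  proof -
    have "ennreal ((norm (X m - abs_l2 g))\<^sup>2) = (\<integral>\<^sup>+x. ennreal ((rep_l2 (X m) x - rep_l2 (abs_l2 g) x)\<^sup>2) \<partial>boxm)"
      by (rule norm_diff_l2)
    also have "\<dots> = (\<integral>\<^sup>+x. ennreal ((rep_l2 (X m) x - g x)\<^sup>2) \<partial>boxm)"
      by (intro nn_integral_cong_AE) (use rep_abs_l2[OF g] in \<open>eventually_elim, simp\<close>)
    also have "\<dots> \<le> ennreal (((1/2) ^ k)\<^sup>2)" by (rule bound[OF that])
    finally have "(norm (X m - abs_l2 g))\<^sup>2 \<le> ((1/2) ^ k)\<^sup>2" by (simp add: ennreal_le_iff)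
    then show ?thesis by (rule power2_le_imp_le) simp
  qed
  have "X \<longlonglongrightarrow> abs_l2 g"
  proof (rule LIMSEQ_I)
    fix e :: real assume "e > 0"
    then obtain k where "(1/2) ^ k < e" using real_arch_pow_inv[of e "1/2"] by auto
    then show "\<exists>no. \<forall>n\<ge>no. norm (X n - abs_l2 g) < e" using le by (meson le_less_trans)
  qed
  then show "convergent X" unfolding convergent_def by blast
qed

section \<open>The periodicity box as a measure space\<close>

lemma sets_borel_pbox [measurable]: "(pbox :: (real ^ 'n::finite) set) \<in> sets borel"
proof -
  have "(pbox :: (real ^ 'n) set) = (\<Inter>i. {x. -1 \<le> x $ i} \<inter> {x. x $ i < 1})"
    by (auto simp: pbox_def)
  also have "\<dots> \<in> sets borel" by measurable
  finally show ?thesis .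
qed

lemma space_boxm [simp]: "space boxm = pbox"
  by (simp add: space_restrict_space)

lemma borel_measurable_boxm: "f \<in> borel_measurable borel \<Longrightarrow> f \<in> borel_measurable boxm"
  by (intro measurable_restrict_space1 measurable_completion) simp

lemma integral_boxm:
  fixes f :: "real ^ 'n::finite \<Rightarrow> real"
  assumes "f \<in> borel_measurable borel"
  shows "(LINT x|boxm. f x) = (LINT x|lborel. indicator pbox x * f x)"
proof -
  have "(LINT x|boxm. f x) = (LINT x|lebesgue. indicator pbox x *\<^sub>R f x)"
    using sets_pbox by (intro integral_restrict_space) simp
  also have "\<dots> = (LINT x|lborel. indicator pbox x *\<^sub>R f x)"
    using assms by (intro integral_completion) measurable
  finally show ?thesis by simp
qed

lemma integrable_boxm_bounded:
  fixes f :: "real ^ 'n::finite \<Rightarrow> 'b::{banach,second_countable_topology}"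
  assumes "f \<in> borel_measurable boxm" "\<And>x. x \<in> pbox \<Longrightarrow> norm (f x) \<le> C"
  shows "integrable boxm f"
  by (rule finite_measure.integrable_const_bound[OF finite_measure_boxm, of _ C]) (use assms in auto)

lemma pbox_subset_cbox: "(pbox :: (real ^ 'n::finite) set) \<subseteq> cbox (- 1) 1"
  by (auto simp: pbox_def mem_box_cart less_imp_le)

lemma pbox_shift_cbox:
  fixes x :: "real ^ 'n::finite"
  assumes "x \<in> pbox" "\<bar>t\<bar> \<le> 2"
  shows "x + t *\<^sub>R axis i 1 \<in> cbox (- 3) 3"
  unfolding mem_box_cart
proof (intro allI)
  fix j
  have "-1 \<le> x $ j" "x $ j < 1" using assms(1) by (auto simp: pbox_def)
  then show "(- 3) $ j \<le> (x + t *\<^sub>R axis i 1) $ j \<and> (x + t *\<^sub>R axis i 1) $ j \<le> 3 $ j"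
    using assms(2) by (auto simp: axis_def)
qed

lemma pbox_split:
  "y \<in> pbox \<longleftrightarrow> -1 \<le> y $ i \<and> y $ i < 1 \<and> (\<forall>j. j \<noteq> i \<longrightarrow> -1 \<le> y $ j \<and> y $ j < 1)"
  unfolding pbox_def by auto

subsection \<open>Integration by parts on the torus\<close>

lemma integral_lborel_shift:
  fixes f :: "'a::euclidean_space \<Rightarrow> real"
  assumes [measurable]: "f \<in> borel_measurable borel"
  shows "(LINT x|lborel. f (a + x)) = (LINT x|lborel. f x)"
proof -
  have "(LINT x|lborel. f x) = (LINT x|distr lborel borel ((+) a). f x)" by (simp add: lborel_distr_plus)
  also have "\<dots> = (LINT x|lborel. f (a + x))" by (intro integral_distr) measurable
  finally show ?thesis by simp
qed

text \<open>The shifted box consists of a part A of the original box and an overhang B beyond the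
  face at 1; translating B back by the period 2 fills the box minus A.\<close>

lemma integral_pbox_shift:
  fixes F :: "real ^ 'n::finite \<Rightarrow> real"
  assumes F: "continuous_on UNIV F" and per: "box_periodic F" and h: "0 < h" "h < 2"
  shows "(LINT x|boxm. F (x + h *\<^sub>R axis i 1)) = (LINT x|boxm. F x)"
proof -
  let ?e = "axis i 1 :: real ^ 'n"
  have F_meas [measurable]: "F \<in> borel_measurable borel" by (rule borel_measurable_continuous_onI[OF F])
  have nth: "(axis i 1 :: real ^ 'n) $ j = (if j = i then 1 else 0)" for j by (simp add: axis_def)
  define A where "A = {y \<in> pbox. h - 1 \<le> y $ i}"
  define others where "others y \<longleftrightarrow> (\<forall>j. j \<noteq> i \<longrightarrow> -1 \<le> y $ j \<and> y $ j < 1)" for y :: "real ^ 'n"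
  have in_pbox: "y \<in> pbox \<longleftrightarrow> -1 \<le> y $ i \<and> y $ i < 1 \<and> others y" for y
    unfolding others_def by (rule pbox_split)
  have others_shift: "others (t *\<^sub>R ?e + y) \<longleftrightarrow> others y" for t y unfolding others_def by (auto simp: nth)
  define B where "B = {y. 1 \<le> y $ i \<and> y $ i < 1 + h \<and> others y}"
  have B_sub: "y \<in> cbox (- 3) 3" if "y \<in> B" for y
  proof -
    have "y + (- 2) *\<^sub>R ?e \<in> pbox"
      using that h others_shift[of "- 2" y] unfolding B_def in_pbox by (simp add: nth add.commute)
    from pbox_shift_cbox[OF this, of 2 i] show ?thesis by simp
  qed
  have pbox_sub: "y \<in> cbox (- 3) 3" if "y \<in> pbox" for y :: "real ^ 'n"
    using pbox_shift_cbox[OF that, of 0] by simp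
  have A_meas [measurable]: "A \<in> sets borel" unfolding A_def by measurable
  have B_meas [measurable]: "B \<in> sets borel" unfolding B_def others_def by measurable
  have int: "integrable lborel (\<lambda>y. indicator C y * F y)" if "C \<in> sets borel" "C \<subseteq> cbox (- 3) (3 :: real ^ 'n)" for C
  proof -
    have "set_integrable lborel (cbox (- 3) (3 :: real ^ 'n)) F"
      unfolding set_integrable_def by (intro borel_integrable_compact compact_cbox continuous_on_subset[OF F]) auto
    from set_integrable_subset[OF this] that show ?thesis by (simp add: set_integrable_def)
  qed
  have "(LINT x|boxm. F (x + h *\<^sub>R ?e)) = (LINT x|lborel. indicator pbox x * F (x + h *\<^sub>R ?e))"
    by (intro integral_boxm) measurable
  also have "\<dots> = (LINT x|lborel. indicator pbox (- (h *\<^sub>R ?e) + x) * F x)"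
    by (subst integral_lborel_shift[of _ "- (h *\<^sub>R ?e)", symmetric]) (auto simp: algebra_simps)
  also have "\<dots> = (LINT x|lborel. indicator A x * F x + indicator B x * F x)"
  proof (intro Bochner_Integration.integral_cong refl)
    fix y :: "real ^ 'n"
    have "- (h *\<^sub>R ?e) + y \<in> pbox \<longleftrightarrow> y \<in> A \<union> B"
      using h others_shift[of "- h" y] unfolding A_def B_def by (auto simp: in_pbox nth)
    moreover have "A \<inter> B = {}" unfolding A_def B_def by (auto simp: in_pbox)
    ultimately show "indicator pbox (- (h *\<^sub>R ?e) + y) * F y = indicator A y * F y + indicator B y * F y"
      by (auto simp: indicator_def split: if_splits)
  qed
  also have "\<dots> = (LINT x|lborel. indicator A x * F x) + (LINT x|lborel. indicator B x * F x)"
  proof (rule Bochner_Integration.integral_add)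
    have "A \<subseteq> cbox (- 3) 3" "B \<subseteq> cbox (- 3) 3"
      using B_sub pbox_sub unfolding A_def by blast+
    then show "integrable lborel (\<lambda>y. indicator A y * F y)" "integrable lborel (\<lambda>y. indicator B y * F y)"
      by (auto intro!: int)
  qed
  also have "(LINT x|lborel. indicator B x * F x) = (LINT x|lborel. indicator B (2 *\<^sub>R ?e + x) * F (2 *\<^sub>R ?e + x))"
    by (intro integral_lborel_shift[symmetric]) measurable
  also have "\<dots> = (LINT x|lborel. indicator (pbox - A) x * F x)"
  proof (intro Bochner_Integration.integral_cong refl)
    fix y :: "real ^ 'n"
    have "2 *\<^sub>R ?e + y \<in> B \<longleftrightarrow> y \<in> pbox - A"
      using h others_shift[of 2 y] unfolding A_def B_def by (auto simp: in_pbox nth)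
    moreover have "F (2 *\<^sub>R ?e + y) = F y" using per unfolding box_periodic_def by (metis add.commute)
    ultimately show "indicator B (2 *\<^sub>R ?e + y) * F (2 *\<^sub>R ?e + y) = indicator (pbox - A) y * F y"
      by (simp add: indicator_def)
  qed
  also have "(LINT x|lborel. indicator A x * F x) + \<dots> = (LINT x|lborel. indicator A x * F x + indicator (pbox - A) x * F x)"
  proof (rule Bochner_Integration.integral_add[symmetric])
    have "A \<subseteq> cbox (- 3) 3" "pbox - A \<subseteq> cbox (- 3) (3 :: real ^ 'n)"
      using pbox_sub unfolding A_def by blast+
    then show "integrable lborel (\<lambda>y. indicator A y * F y)" "integrable lborel (\<lambda>y. indicator (pbox - A) y * F y)"
      by (auto intro!: int)
  qed
  also have "\<dots> = (LINT x|lborel. indicator pbox x * F x)"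
    by (intro Bochner_Integration.integral_cong refl) (auto simp: indicator_def A_def)
  also have "\<dots> = (LINT x|boxm. F x)" by (intro integral_boxm[symmetric]) measurable
  finally show ?thesis .
qed

text \<open>The difference quotients have integral 0 by translation invariance. The mean value
  theorem bounds them by a bound for the derivative on a larger compact box, and dominated
  convergence passes to the derivative.\<close>

lemma integral_partial_derivative:
  fixes F :: "real ^ 'n::finite \<Rightarrow> real"
  assumes diff: "\<And>x. (F has_derivative F' x) (at x)" and per: "box_periodic F"
    and cont: "continuous_on UNIV (\<lambda>x. F' x (axis i 1))"
  shows "(LINT x|boxm. F' x (axis i 1)) = 0"
proof -
  let ?e = "axis i 1 :: real ^ 'n"
  define G where "G x = F' x ?e" for x
  have F: "continuous_on UNIV F" using diff by (meson continuous_at_imp_continuous_on has_derivative_continuous)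
  have F_meas [measurable]: "F \<in> borel_measurable borel" by (rule borel_measurable_continuous_onI[OF F])
  have line: "((\<lambda>s. F (x + s *\<^sub>R ?e)) has_real_derivative G (x + s *\<^sub>R ?e)) (at s)" for x s
  proof -
    have "((\<lambda>s. x + s *\<^sub>R ?e) has_derivative (\<lambda>s. s *\<^sub>R ?e)) (at s)" by (auto intro!: derivative_eq_intros)
    from has_derivative_compose[OF this diff]
    have "((\<lambda>s. F (x + s *\<^sub>R ?e)) has_derivative (\<lambda>t. F' (x + s *\<^sub>R ?e) (t *\<^sub>R ?e))) (at s)" .
    moreover have "F' y (t *\<^sub>R ?e) = G y * t" for y t
      using linear_scale[OF has_derivative_linear[OF diff[of y]], of t ?e] by (simp add: G_def)
    ultimately show ?thesis by (simp add: has_field_derivative_def)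
  qed
  have "bounded (G ` cbox (- 3) 3)" unfolding G_def
    by (intro compact_imp_bounded compact_continuous_image compact_cbox continuous_on_subset[OF cont]) auto
  then obtain C where C: "\<And>x. x \<in> cbox (- 3) 3 \<Longrightarrow> \<bar>G x\<bar> \<le> C" unfolding bounded_iff by auto
  define h where "h n = 1 / (real n + 1)" for n
  have h: "0 < h n" "h n \<le> 1" for n unfolding h_def by auto
  have h0: "h \<longlonglongrightarrow> 0" using LIMSEQ_Suc[OF lim_1_over_n] unfolding h_def by (simp add: add.commute)
  define Q where "Q n x = (F (x + h n *\<^sub>R ?e) - F x) / h n" for n x
  have Q_le: "norm (Q n x) \<le> C" if x: "x \<in> pbox" for n x
  proof -
    obtain s where s: "0 < s" "s < h n" "F (x + h n *\<^sub>R ?e) - F (x + 0 *\<^sub>R ?e) = (h n - 0) * G (x + s *\<^sub>R ?e)"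
      using MVT2[of 0 "h n" "\<lambda>s. F (x + s *\<^sub>R ?e)" "\<lambda>s. G (x + s *\<^sub>R ?e)"] line h(1) by blast
    have "x + s *\<^sub>R ?e \<in> cbox (- 3) 3"
      using s(1,2) h(2)[of n] by (intro pbox_shift_cbox x) auto
    then show ?thesis unfolding Q_def using C s(3) h(1)[of n] by simp
  qed
  have Q_meas [measurable]: "Q n \<in> borel_measurable boxm" for n
    unfolding Q_def[abs_def] by (rule borel_measurable_boxm) measurable
  have F_int: "integrable boxm F" "integrable boxm (\<lambda>x. F (x + h n *\<^sub>R ?e))" for n
  proof -
    have "bounded (F ` cbox (- 3) 3)"
      by (intro compact_imp_bounded compact_continuous_image compact_cbox continuous_on_subset[OF F]) auto
    then obtain K where K: "\<And>x. x \<in> cbox (- 3) 3 \<Longrightarrow> \<bar>F x\<bar> \<le> K" unfolding bounded_iff by auto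
    have "norm (F x) \<le> K" if "x \<in> pbox" for x
      using K[of x] pbox_shift_cbox[OF that, of 0] by simp
    then show "integrable boxm F"
      by (intro integrable_boxm_bounded[of _ K] borel_measurable_boxm F_meas)
    have "x + h n *\<^sub>R ?e \<in> cbox (- 3) 3" if "x \<in> pbox" for x :: "real ^ 'n"
      using h[of n] by (intro pbox_shift_cbox that) auto
    then show "integrable boxm (\<lambda>x. F (x + h n *\<^sub>R ?e))"
      by (intro integrable_boxm_bounded[of _ K] borel_measurable_boxm) (auto intro: K)
  qed
  have "(LINT x|boxm. Q n x) = 0" for n
    using integral_pbox_shift[OF F per h(1)[of n], of i] h(2)[of n] F_int(1) F_int(2)[of n]
    by (simp add: Q_def)
  moreover have "(\<lambda>n. LINT x|boxm. Q n x) \<longlonglongrightarrow> (LINT x|boxm. G x)"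
  proof (rule integral_dominated_convergence[where w = "\<lambda>_. C"])
    show "G \<in> borel_measurable boxm"
      unfolding G_def[abs_def] by (intro borel_measurable_boxm borel_measurable_continuous_onI cont)
    show "integrable boxm (\<lambda>_. C)" by (rule finite_measure.integrable_const[OF finite_measure_boxm])
    show "AE x in boxm. norm (Q n x) \<le> C" for n using Q_le by (intro AE_I2) simp
    show "AE x in boxm. (\<lambda>n. Q n x) \<longlonglongrightarrow> G x"
    proof (intro AE_I2)
      fix x :: "real ^ 'n"
      have "((\<lambda>t. (F (x + t *\<^sub>R ?e) - F x) / t) \<longlongrightarrow> G x) (at 0)"
        using line[of x 0] unfolding has_field_derivative_iff by simp
      moreover have "filterlim h (at 0) sequentially"
        using h0 h(1) by (intro filterlim_atI) (auto intro!: always_eventually simp: less_imp_neq[symmetric])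
      ultimately show "(\<lambda>n. Q n x) \<longlonglongrightarrow> G x" unfolding Q_def by (rule filterlim_compose)
    qed
  qed measurable
  ultimately show ?thesis unfolding G_def by (simp add: LIMSEQ_const_iff)
qed

subsection \<open>Trigonometric polynomials\<close>

text \<open>The phase c puts cosines and sines in one family; differentiation multiplies by a
  constant and shifts c by pi / 2.\<close>

definition wave :: "real ^ 'n::finite \<Rightarrow> real \<Rightarrow> real ^ 'n \<Rightarrow> real" where
  "wave k c x = cos (pi * (k \<bullet> x) + c)"

definition frequencies :: "(real ^ 'n) set" where
  "frequencies = {k. \<forall>i. k $ i \<in> \<int>}"

lemma wave_has_derivative:
  "((\<lambda>x. a * wave k c x) has_derivative (\<lambda>h. a * pi * (k \<bullet> h) * wave k (c + pi / 2) x)) (at x)"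
proof -
  have "((\<lambda>x. a * cos (pi * (k \<bullet> x) + c)) has_derivative (\<lambda>h. a * (- sin (pi * (k \<bullet> x) + c) * (pi * (k \<bullet> h))))) (at x)"
    by (auto intro!: derivative_eq_intros simp: fun_eq_iff algebra_simps)
  moreover have "- sin (pi * (k \<bullet> x) + c) = cos (pi * (k \<bullet> x) + (c + pi / 2))"
    by (simp add: cos_add add.assoc[symmetric])
  ultimately show ?thesis by (simp add: wave_def mult_ac)
qed

lemma wave_frechet: "frechet_derivative (\<lambda>x. a * wave k c x) (at x) = (\<lambda>h. a * pi * (k \<bullet> h) * wave k (c + pi / 2) x)"
  using frechet_derivative_at[OF wave_has_derivative] by metis

lemma continuous_wave: "continuous_on S (wave k c)"
  unfolding wave_def[abs_def] by (intro continuous_intros)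

lemma smooth_wave: "smooth (\<lambda>x. a * wave k c x)"
proof -
  have "Ck m (\<lambda>x. a * wave k c x)" for m
  proof (induction m arbitrary: a c)
    case 0
    show ?case unfolding Ck.simps by (intro continuous_intros continuous_wave)
  next
    case (Suc m)
    have "(\<lambda>x. a * wave k c x) differentiable (at x)" for x
      using wave_has_derivative unfolding differentiable_def by blast
    then show ?case using Suc by (simp add: wave_frechet)
  qed
  then show ?thesis by (simp add: smooth_def)
qed

lemma periodic_wave:
  fixes k :: "real ^ 'n::finite"
  assumes "k \<in> frequencies"
  shows "box_periodic (\<lambda>x. a * wave k c x)"
  unfolding box_periodic_def
proof (intro allI)
  fix x :: "real ^ 'n" and i
  obtain n where n: "k $ i = of_int n" using assms unfolding frequencies_def by (auto elim: Ints_cases)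
  have "pi * (k \<bullet> (x + 2 *\<^sub>R axis i 1)) + c = (pi * (k \<bullet> x) + c) + 2 * pi * of_int n"
    by (simp add: inner_add_right inner_axis n algebra_simps)
  moreover have "cos (y + 2 * pi * of_int n) = cos y" for y by (simp add: cos_add)
  ultimately show "a * wave k c (x + 2 *\<^sub>R axis i 1) = a * wave k c x" by (simp only: wave_def)
qed

inductive_set trig :: "(real ^ 'n::finite \<Rightarrow> real) set" where
  wave: "k \<in> frequencies \<Longrightarrow> (\<lambda>x. a * wave k c x) \<in> trig"
| add: "f \<in> trig \<Longrightarrow> g \<in> trig \<Longrightarrow> (\<lambda>x. f x + g x) \<in> trig"

lemma frequencies_intros: "0 \<in> frequencies" "k \<in> frequencies \<Longrightarrow> l \<in> frequencies \<Longrightarrow> k + l \<in> frequencies"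
  "k \<in> frequencies \<Longrightarrow> l \<in> frequencies \<Longrightarrow> k - l \<in> frequencies" "axis i 1 \<in> frequencies"
  by (auto simp: frequencies_def axis_def)

lemma trig_const: "(\<lambda>x. a) \<in> trig"
  using trig.wave[OF frequencies_intros(1), of a 0] by (simp add: wave_def)

lemma trig_wave_mult:
  assumes "k \<in> frequencies" "g \<in> trig"
  shows "(\<lambda>x. a * wave k c x * g x) \<in> trig"
  using assms(2)
proof (induction rule: trig.induct)
  case (wave l b d)
  have "a * wave k c x * (b * wave l d x) =
      (a * b / 2) * wave (k - l) (c - d) x + (a * b / 2) * wave (k + l) (c + d) x" for x
    by (simp add: wave_def cos_times_cos inner_diff_left inner_add_left algebra_simps)
  then show ?case
    using trig.add[OF trig.wave trig.wave, of "k - l" "k + l" "a * b / 2" "c - d" "a * b / 2" "c + d"]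
      frequencies_intros(2,3)[OF assms(1) wave] by simp
next
  case (add f g)
  then show ?case using trig.add[OF add.IH] by (simp add: distrib_left)
qed

lemma trig_mult:
  assumes "f \<in> trig" "g \<in> trig"
  shows "(\<lambda>x. f x * g x) \<in> trig"
  using assms(1)
proof (induction rule: trig.induct)
  case (wave k a c)
  then show ?case using trig_wave_mult assms(2) by blast
next
  case (add f h)
  then show ?case using trig.add[OF add.IH] by (simp add: distrib_right)
qed

lemma trig_sum: "finite I \<Longrightarrow> (\<And>i. i \<in> I \<Longrightarrow> f i \<in> trig) \<Longrightarrow> (\<lambda>x. \<Sum>i\<in>I. f i x) \<in> trig"
  by (induction rule: finite_induct) (auto intro: trig_const trig.add)

lemma trig_continuous: "f \<in> trig \<Longrightarrow> continuous_on UNIV f"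
  by (induction rule: trig.induct) (auto intro!: continuous_intros continuous_wave)

lemma trig_bounded: "f \<in> trig \<Longrightarrow> \<exists>C. \<forall>x. \<bar>f x\<bar> \<le> C"
proof (induction rule: trig.induct)
  case (wave k a c)
  have "\<bar>a * wave k c x\<bar> \<le> \<bar>a\<bar>" for x unfolding abs_mult wave_def by (simp add: mult_left_le)
  then show ?case by blast
next
  case (add f g)
  then show ?case by (metis abs_triangle_ineq add_mono order_trans)
qed

text \<open>An embedding of the torus into Euclidean space: polynomials in the image coordinates are
  trigonometric polynomials, which makes Stone-Weierstrass available.\<close>

definition torus_map :: "real ^ 'n::finite \<Rightarrow> (real ^ 'n) \<times> (real ^ 'n)" where
  "torus_map x = ((\<chi> i. cos (pi * x $ i)), (\<chi> i. sin (pi * x $ i)))"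

lemma trig_polynomial_torus_map:
  fixes p :: "(real ^ 'n::finite) \<times> (real ^ 'n) \<Rightarrow> real"
  assumes "real_polynomial_function p"
  shows "(\<lambda>x. p (torus_map x)) \<in> trig"
  using assms
proof (induction rule: real_polynomial_function.induct)
  case (linear p)
  then have lin: "linear p" by (rule bounded_linear.linear)
  have cs: "(\<lambda>x. a * cos (pi * x $ i)) \<in> trig" "(\<lambda>x. a * sin (pi * x $ i)) \<in> trig" for a and i :: 'n
  proof -
    have "wave (axis i 1) 0 x = cos (pi * x $ i)" "wave (axis i 1) (- (pi / 2)) x = sin (pi * x $ i)" for x
      by (simp_all add: wave_def inner_axis' cos_diff)
    then show "(\<lambda>x. a * cos (pi * x $ i)) \<in> trig" "(\<lambda>x. a * sin (pi * x $ i)) \<in> trig"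
      using trig.wave[OF frequencies_intros(4)[of i], of a 0] trig.wave[OF frequencies_intros(4)[of i], of a "- (pi / 2)"]
      by simp_all
  qed
  have "p (torus_map x) = (\<Sum>i\<in>UNIV. p (axis i 1, 0) * cos (pi * x $ i)) + (\<Sum>i\<in>UNIV. p (0, axis i 1) * sin (pi * x $ i))"
    for x
  proof -
    have e: "(\<Sum>i\<in>UNIV. v $ i *\<^sub>R axis i 1) = v" for v :: "real ^ 'n"
      using basis_expansion[of v] by (simp add: scalar_mult_eq_scaleR)
    have "p (r *\<^sub>R b, 0) = r * p (b, 0)" "p (0, r *\<^sub>R b) = r * p (0, b)" for r b
      using linear_scale[OF lin, of r "(b, 0)"] linear_scale[OF lin, of r "(0, b)"] by simp_all
    then have l: "linear (\<lambda>u. p (u, 0))" "linear (\<lambda>v. p (0, v))"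
      by (auto intro!: linearI simp: linear_add[OF lin, symmetric])
    have "p (u, 0) = (\<Sum>i\<in>UNIV. p (axis i 1, 0) * u $ i)" for u
      using linear_sum[OF l(1), of "\<lambda>i. u $ i *\<^sub>R axis i 1" UNIV]
      unfolding e by (simp add: linear_scale[OF l(1)] mult.commute)
    moreover have "p (0, v) = (\<Sum>i\<in>UNIV. p (0, axis i 1) * v $ i)" for v
      using linear_sum[OF l(2), of "\<lambda>i. v $ i *\<^sub>R axis i 1" UNIV]
      unfolding e by (simp add: linear_scale[OF l(2)] mult.commute)
    moreover have "p (u, v) = p (u, 0) + p (0, v)" for u v
      by (simp add: linear_add[OF lin, symmetric])
    ultimately show ?thesis unfolding torus_map_def by (metis (no_types, lifting) sum.cong vec_lambda_beta)
  qed
  then show ?case by (auto intro!: trig.add trig_sum cs)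
qed (auto intro: trig_const trig.add trig_mult)

text \<open>Equal images force coordinates to differ by even integers, and the half-open box leaves
  only the difference 0.\<close>

lemma inj_on_torus_map: "inj_on torus_map pbox"
proof
  fix x y :: "real ^ 'n" assume x: "x \<in> pbox" and y: "y \<in> pbox" and eq: "torus_map x = torus_map y"
  have "x $ i = y $ i" for i
  proof -
    have "cos (pi * x $ i) = cos (pi * y $ i)" "sin (pi * x $ i) = sin (pi * y $ i)"
      using eq unfolding torus_map_def by (auto simp: vec_eq_iff)
    then obtain n :: int where n: "pi * x $ i = pi * y $ i + 2 * pi * n" by (meson sin_cos_eq_iff)
    then have "x $ i - y $ i = 2 * n"
    proof -
      have "pi * (x $ i - y $ i - 2 * n) = 0" using n by (simp add: algebra_simps)
      then show ?thesis by simp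
    qed
    moreover have "\<bar>x $ i - y $ i\<bar> < 2" using x y unfolding pbox_def by (smt (verit) mem_Collect_eq)
    ultimately have "n = 0" by linarith
    with \<open>x $ i - y $ i = 2 * n\<close> show ?thesis by simp
  qed
  then show "x = y" by (simp add: vec_eq_iff)
qed

lemma continuous_torus_map: "continuous_on S torus_map"
  unfolding torus_map_def[abs_def] by (intro continuous_intros)

text \<open>A closed \<open>T\<close> inside the box is recovered as the preimage of the compact set
  \<open>torus_map ` T\<close>, so its indicator is a bounded limit of continuous functions of \<open>torus_map\<close>.\<close>

lemma trig_total_compact:
  fixes g :: "real ^ 'n::finite \<Rightarrow> real"
  assumes g: "integrable boxm g"
    and orth: "\<And>k c. k \<in> frequencies \<Longrightarrow> (LINT x|boxm. g x * wave k c x) = 0"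
    and T: "compact T" "T \<subseteq> pbox"
  shows "(LINT x|boxm. indicator T x * g x) = 0"
proof (cases "T = {}")
  \<comment> \<open>The empty set is split off because \<open>infdist\<close> to it is 0 by
    convention, and the cut-offs F below would be constantly 1.\<close>
  case False
  have [measurable]: "g \<in> borel_measurable boxm" using g by (rule borel_measurable_integrable)
  have tm: "f \<in> borel_measurable boxm" if "continuous_on UNIV f" for f :: "real ^ 'n \<Rightarrow> real"
    by (intro borel_measurable_boxm borel_measurable_continuous_onI that)
  have prod_int: "integrable boxm (\<lambda>x. g x * f x)" if f: "continuous_on UNIV f" "\<And>x. \<bar>f x\<bar> \<le> C" for f C
  proof (rule Bochner_Integration.integrable_bound[OF integrable_mult_right[OF g, of C]])
    show "(\<lambda>x. g x * f x) \<in> borel_measurable boxm" using tm[OF f(1)] by measurable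
    show "AE x in boxm. norm (g x * f x) \<le> norm (C * g x)"
    proof (intro AE_I2)
      fix x
      have "0 \<le> C" using f(2)[of x] by linarith
      then show "norm (g x * f x) \<le> norm (C * g x)"
        using f(2)[of x] by (simp add: abs_mult mult.commute[of "\<bar>g x\<bar>"] mult_right_mono)
    qed
  qed
  have trig0: "integrable boxm (\<lambda>x. g x * f x) \<and> (LINT x|boxm. g x * f x) = 0" if "f \<in> trig" for f
    using that
  proof (induction rule: trig.induct)
    case (wave k a c)
    have "integrable boxm (\<lambda>x. g x * (a * wave k c x))"
      using trig_bounded[OF trig.wave[OF wave, of a c]] trig_continuous[OF trig.wave[OF wave, of a c]] prod_int by metis
    moreover have "(LINT x|boxm. g x * (a * wave k c x)) = a * (LINT x|boxm. g x * wave k c x)"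
      by (subst integral_mult_right_zero[symmetric]) (simp add: mult_ac)
    ultimately show ?case using orth[OF wave] by simp
  next
    case (add f h)
    then show ?case by (simp add: distrib_left)
  qed
  have tm_bounded: "torus_map x \<in> cbox (- 1, - 1) (1, 1)" for x :: "real ^ 'n"
    unfolding torus_map_def cbox_Pair_eq by (auto simp: mem_box_cart)
  have cont0: "(LINT x|boxm. g x * F (torus_map x)) = 0" if F: "continuous_on UNIV F" and F_le: "\<And>y. \<bar>F y\<bar> \<le> 1" for F
  proof (rule ccontr)
    assume ne: "(LINT x|boxm. g x * F (torus_map x)) \<noteq> 0" (is "?I \<noteq> 0")
    \<comment> \<open>A uniform error e changes the integral by at most e times the L1 norm of g,
      here at most half of it; the + 1 keeps the denominator positive.\<close>
    define e where "e = \<bar>?I\<bar> / (2 * ((LINT x|boxm. \<bar>g x\<bar>) + 1))"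
    have G0: "0 \<le> (LINT x|boxm. \<bar>g x\<bar>)" by simp
    then have e: "0 < e" unfolding e_def using ne by (intro divide_pos_pos mult_pos_pos add_nonneg_pos) auto
    obtain p where p: "real_polynomial_function p" "\<And>y. y \<in> cbox (- 1, - 1) (1, 1) \<Longrightarrow> \<bar>F y - p y\<bar> < e"
      using Stone_Weierstrass_real_polynomial_function[OF compact_cbox continuous_on_subset[OF F] e] by blast
    note pt = trig0[OF trig_polynomial_torus_map[OF p(1)]]
    have FE: "continuous_on UNIV (\<lambda>x. F (torus_map x))"
      by (rule continuous_on_compose2[OF F continuous_torus_map]) auto
    have FI: "integrable boxm (\<lambda>x. g x * F (torus_map x))" by (rule prod_int[OF FE F_le])
    have "?I = (LINT x|boxm. g x * F (torus_map x) - g x * p (torus_map x))"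
      using pt FI by simp
    also have "\<bar>\<dots>\<bar> \<le> (LINT x|boxm. \<bar>g x * F (torus_map x) - g x * p (torus_map x)\<bar>)" by (rule integral_abs_bound)
    also have "\<dots> \<le> (LINT x|boxm. e * \<bar>g x\<bar>)"
    proof (rule integral_mono)
      show "integrable boxm (\<lambda>x. \<bar>g x * F (torus_map x) - g x * p (torus_map x)\<bar>)" using FI pt by auto
      show "integrable boxm (\<lambda>x. e * \<bar>g x\<bar>)" using g by auto
      fix x
      have "\<bar>g x * F (torus_map x) - g x * p (torus_map x)\<bar> = \<bar>g x\<bar> * \<bar>F (torus_map x) - p (torus_map x)\<bar>"
        by (simp add: abs_mult[symmetric] right_diff_distrib)
      also have "\<dots> \<le> \<bar>g x\<bar> * e" using p(2)[OF tm_bounded, of x] by (intro mult_left_mono) auto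
      finally show "\<bar>g x * F (torus_map x) - g x * p (torus_map x)\<bar> \<le> e * \<bar>g x\<bar>" by (simp add: mult.commute)
    qed
    also have "\<dots> = e * (LINT x|boxm. \<bar>g x\<bar>)" by simp
    also have "\<dots> \<le> e * ((LINT x|boxm. \<bar>g x\<bar>) + 1)" using e by simp
    also have "\<dots> = \<bar>?I\<bar> / 2" unfolding e_def using G0 by (simp add: field_simps add_nonneg_eq_0_iff)
    finally show False using ne by simp
  qed
  \<comment> \<open>Equal to 1 on the image of T and, for m > 0, equal to 0 at distance 1 / m or
    more from it.\<close>
  define F where "F m y = max 0 (1 - real m * infdist y (torus_map ` T))" for m y
  have closedT: "closed (torus_map ` T)"
    by (intro compact_imp_closed compact_continuous_image continuous_torus_map T)
  have F_le: "\<bar>F m y\<bar> \<le> 1" for m y unfolding F_def using infdist_nonneg[of y "torus_map ` T"] by (auto simp: max_def)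
  have F_cont: "continuous_on UNIV (F m)" for m
    unfolding F_def[abs_def] by (intro continuous_intros)
  have FT_cont: "continuous_on UNIV (\<lambda>x. F m (torus_map x))" for m
    by (rule continuous_on_compose2[OF F_cont continuous_torus_map]) auto
  have "(\<lambda>m. LINT x|boxm. g x * F m (torus_map x)) \<longlonglongrightarrow> (LINT x|boxm. indicator T x * g x)"
  proof (rule integral_dominated_convergence[where w = "\<lambda>x. \<bar>g x\<bar>"])
    have "T \<in> sets borel" using T(1) by (intro borel_closed compact_imp_closed)
    then have "indicator T \<in> borel_measurable (boxm :: (real ^ 'n) measure)"
      by (intro borel_measurable_boxm) simp
    then show "(\<lambda>x. indicator T x * g x) \<in> borel_measurable boxm" by measurable
    show "(\<lambda>x. g x * F m (torus_map x)) \<in> borel_measurable boxm" for m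
      using tm[OF FT_cont] by measurable
    show "integrable boxm (\<lambda>x. \<bar>g x\<bar>)" using g by auto
    show "AE x in boxm. norm (g x * F m (torus_map x)) \<le> \<bar>g x\<bar>" for m
      using F_le by (intro AE_I2) (simp add: abs_mult mult_left_le)
    show "AE x in boxm. (\<lambda>m. g x * F m (torus_map x)) \<longlonglongrightarrow> indicator T x * g x"
    proof (intro AE_I2)
      fix x :: "real ^ 'n" assume "x \<in> space boxm"
      then have x: "x \<in> pbox" by simp
      have "(\<lambda>m. F m (torus_map x)) \<longlonglongrightarrow> indicator T x"
      proof (cases "x \<in> T")
        case True
        then have "F m (torus_map x) = 1" for m unfolding F_def by simp
        then show ?thesis using True by simp
      next
        case False
        then have "torus_map x \<notin> torus_map ` T"
          using inj_on_torus_map x T(2) by (auto simp: inj_on_def)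
        then have pos: "0 < infdist (torus_map x) (torus_map ` T)"
          using closedT \<open>T \<noteq> {}\<close> by (metis image_is_empty in_closed_iff_infdist_zero infdist_nonneg order_le_less)
        obtain M :: nat where M: "1 / infdist (torus_map x) (torus_map ` T) < M" using reals_Archimedean2 by blast
        have "F m (torus_map x) = 0" if "m \<ge> M" for m
        proof -
          have "1 < M * infdist (torus_map x) (torus_map ` T)" using M pos by (simp add: field_simps)
          also have "\<dots> \<le> m * infdist (torus_map x) (torus_map ` T)" using that pos by (intro mult_right_mono) auto
          finally show ?thesis unfolding F_def by simp
        qed
        then have "\<forall>\<^sub>F m in sequentially. F m (torus_map x) = 0" unfolding eventually_sequentially by blast
        then show ?thesis using False by (simp add: tendsto_eventually)
      qed
      from tendsto_mult_left[OF this, of "g x"]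
      show "(\<lambda>m. g x * F m (torus_map x)) \<longlonglongrightarrow> indicator T x * g x" by (simp add: mult.commute)
    qed
  qed
  then show ?thesis using cont0[OF F_cont F_le] by (simp add: LIMSEQ_const_iff)
qed simp

text \<open>Exhaust the set where g > 0 by compact sets T from inside: the integral of g over T is 0
  although g > 0 on T, so T is null.\<close>

lemma trig_total_nonpos:
  fixes g :: "real ^ 'n::finite \<Rightarrow> real"
  assumes g: "integrable boxm g"
    and orth: "\<And>k c. k \<in> frequencies \<Longrightarrow> (LINT x|boxm. g x * wave k c x) = 0"
  shows "AE x in boxm. g x \<le> 0"
proof -
  have [measurable]: "g \<in> borel_measurable boxm" using g by (rule borel_measurable_integrable)
  define A where "A = {x \<in> pbox. 0 < g x}"
  have "{x \<in> space boxm. 0 < g x} \<in> sets boxm" by measurable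
  then have A: "A \<in> sets lebesgue" "A \<in> sets boxm"
    unfolding A_def using sets_pbox by (auto simp: sets_restrict_space_iff)
  have "emeasure lebesgue A \<le> ennreal e" if "e > 0" for e
  proof -
    obtain T where T: "closed T" "T \<subseteq> A" "A - T \<in> lmeasurable" "emeasure lebesgue (A - T) < ennreal e"
      using sets_lebesgue_inner_closed[OF A(1) \<open>e > 0\<close>] by blast
    have Tp: "T \<subseteq> pbox" using T(2) unfolding A_def by auto
    have "compact T"
      using T(1) bounded_subset[OF bounded_cbox subset_trans[OF Tp pbox_subset_cbox]]
      by (simp add: compact_eq_bounded_closed)
    then have I: "(LINT x|boxm. indicator T x * g x) = 0" by (intro trig_total_compact g orth Tp)
    have Tm: "T \<in> sets borel" using T(1) by simp
    then have indT: "indicator T \<in> borel_measurable (boxm :: (real ^ 'n) measure)"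
      by (intro borel_measurable_boxm) simp
    have int: "integrable boxm (\<lambda>x. indicator T x * g x)"
      by (intro Bochner_Integration.integrable_bound[OF g] borel_measurable_times indT
          borel_measurable_integrable[OF g]) (auto simp: indicator_def)
    have "AE x in boxm. 0 \<le> indicator T x * g x"
      using T(2) by (intro AE_I2) (auto simp: indicator_def A_def less_imp_le)
    then have "AE x in boxm. indicator T x * g x = 0"
      using integral_nonneg_eq_0_iff_AE[OF int] I by blast
    then have "AE x in boxm. x \<notin> T"
      by eventually_elim (use T(2) in \<open>auto simp: indicator_def A_def split: if_splits\<close>)
    then have "AE x in lebesgue. x \<in> pbox \<longrightarrow> x \<notin> T" using sets_pbox by (subst (asm) AE_restrict_space_iff) auto
    then have "AE x in lebesgue. x \<notin> T" by eventually_elim (use Tp in auto)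
    then have T0: "emeasure lebesgue T = 0" using Tm by (subst (asm) AE_iff_null_sets[symmetric]) auto
    have "T \<union> (A - T) = A" using T(2) by auto
    moreover have "emeasure lebesgue (T \<union> (A - T)) \<le> emeasure lebesgue T + emeasure lebesgue (A - T)"
      by (intro emeasure_subadditive fmeasurableD[OF T(3)]) (use Tm in auto)
    ultimately have "emeasure lebesgue A \<le> emeasure lebesgue T + emeasure lebesgue (A - T)" by (simp only:)
    also have "\<dots> = emeasure lebesgue (A - T)" by (simp only: T0 add_0)
    finally show ?thesis using T(4) by (meson less_imp_le order_trans)
  qed
  then have "emeasure lebesgue A \<le> 0 + ennreal e" if "e > 0" for e using that by simp
  from ennreal_le_epsilon[OF this] have "emeasure lebesgue A \<le> 0" by simp
  then have "emeasure lebesgue A = 0" by simp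
  then have "AE x in lebesgue. x \<notin> A" using A by (intro AE_not_in) (auto simp: null_sets_def)
  then have "AE x in lebesgue. x \<in> pbox \<longrightarrow> g x \<le> 0" by eventually_elim (auto simp: A_def)
  then show ?thesis using sets_pbox by (subst AE_restrict_space_iff) auto
qed

lemma trig_total:
  fixes g :: "real ^ 'n::finite \<Rightarrow> real"
  assumes g: "integrable boxm g"
    and orth: "\<And>k c. k \<in> frequencies \<Longrightarrow> (LINT x|boxm. g x * wave k c x) = 0"
  shows "AE x in boxm. g x = 0"
proof -
  have "AE x in boxm. g x \<le> 0" by (rule trig_total_nonpos[OF assms])
  moreover have "AE x in boxm. - g x \<le> 0" using assms by (intro trig_total_nonpos) auto
  ultimately show ?thesis by eventually_elim auto
qed

subsection \<open>Integrability of the reciprocal weight\<close>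

text \<open>By the triangle inequality, cubes of half-side t + r around the centres contain the
  neighbourhood.\<close>

lemma emeasure_neighbourhood_le:
  fixes \<Gamma> :: "(real ^ 'n::finite) set"
  assumes J: "finite J" and cover: "\<Gamma> \<subseteq> (\<Union>j\<in>J. cball (p j) t)" and ne: "\<Gamma> \<noteq> {}" and t: "0 \<le> t" and r: "0 < r"
  shows "emeasure lebesgue {x \<in> pbox. infdist x \<Gamma> < r} \<le> ennreal (real (card J) * (2 * (t + r)) ^ CARD('n))"
proof -
  let ?C = "\<lambda>j. cbox (p j - (t + r) *\<^sub>R 1) (p j + (t + r) *\<^sub>R 1)"
  have em: "emeasure lebesgue (?C j) = ennreal ((2 * (t + r)) ^ CARD('n))" for j
  proof -
    have b1: "(1 :: real ^ 'n) \<bullet> b = 1" if "b \<in> Basis" for b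
      using that by (auto simp: Basis_vec_def inner_axis)
    have e: "p j + (t + r) *\<^sub>R 1 - (p j - (t + r) *\<^sub>R 1) = (2 * (t + r)) *\<^sub>R (1 :: real ^ 'n)"
      by (simp add: vec_eq_iff)
    have "emeasure lborel (?C j) = (\<Prod>b\<in>Basis. (p j + (t + r) *\<^sub>R 1 - (p j - (t + r) *\<^sub>R 1)) \<bullet> b)"
      using t r by (intro emeasure_lborel_cbox) (simp add: inner_diff_left inner_add_left b1)
    also have "\<dots> = (\<Prod>b\<in>(Basis :: (real ^ 'n) set). 2 * (t + r))"
      unfolding e by (simp add: b1)
    finally show ?thesis by simp
  qed
  have "{x \<in> pbox. infdist x \<Gamma> < r} \<subseteq> (\<Union>j\<in>J. ?C j)"
  proof
    fix x assume "x \<in> {x \<in> pbox. infdist x \<Gamma> < r}"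
    then have "(INF a\<in>\<Gamma>. dist x a) < r" using ne by (simp add: infdist_notempty)
    then obtain y where y: "y \<in> \<Gamma>" "dist x y < r" using cINF_less_iff[of \<Gamma> "dist x" r] ne by (auto intro: bdd_belowI2[of _ 0])
    then obtain j where j: "j \<in> J" "dist (p j) y \<le> t" using cover by auto
    have "norm (x - p j) \<le> t + r"
      using dist_triangle[of x "p j" y] y(2) j(2) by (simp add: dist_norm[symmetric] dist_commute)
    then have "\<bar>x $ i - p j $ i\<bar> \<le> t + r" for i
      using component_le_norm_cart[of "x - p j" i] by simp
    then have "x \<in> ?C j" unfolding mem_box_cart by (auto simp: abs_le_iff algebra_simps)
    then show "x \<in> (\<Union>j\<in>J. ?C j)" using j(1) by blast
  qed
  then have "emeasure lebesgue {x \<in> pbox. infdist x \<Gamma> < r} \<le> emeasure lebesgue (\<Union>j\<in>J. ?C j)"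
    using J by (intro emeasure_mono sets.finite_UN) auto
  also have "\<dots> \<le> (\<Sum>j\<in>J. emeasure lebesgue (?C j))"
    using J by (intro emeasure_subadditive_finite) auto
  also have "\<dots> = ennreal (real (card J) * (2 * (t + r)) ^ CARD('n))"
    using t r by (simp add: em ennreal_mult ennreal_of_nat_eq_real_of_nat)
  finally show ?thesis .
qed

lemma periodic_of_int:
  fixes \<gamma> :: "real \<Rightarrow> 'b"
  assumes "\<And>t. \<gamma> (t + 1) = \<gamma> t"
  shows "\<gamma> (t + of_int k) = \<gamma> t"
proof -
  have nat: "\<gamma> (t + of_nat n) = \<gamma> t" for t and n :: nat
  proof (induction n)
    case (Suc n)
    have "\<gamma> (t + of_nat (Suc n)) = \<gamma> ((t + of_nat n) + 1)" by (simp add: ac_simps)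
    then show ?case using assms Suc by simp
  qed simp
  show ?thesis
  proof (cases k rule: int_cases2)
    case (nonneg n)
    then show ?thesis using nat[of t n] by simp
  next
    case (nonpos n)
    then show ?thesis using nat[of "t - of_nat n" n] by simp
  qed
qed

text \<open>The parametrisation is Lipschitz on one period, so m equally spaced parameters suffice
  with balls of radius L / m. This count expresses that the curve is one-dimensional.\<close>

lemma smooth_closed_curve_cover:
  fixes \<Gamma> :: "(real ^ 'n::finite) set"
  assumes "smooth_closed_curve \<Gamma>"
  shows "\<exists>(L :: real) (p :: nat \<Rightarrow> nat \<Rightarrow> real ^ 'n). 0 \<le> L \<and>
    (\<forall>m>0. \<Gamma> \<subseteq> (\<Union>j\<in>{..<m}. cball (p m j) (L / real m)))"
proof -
  obtain \<gamma> :: "real \<Rightarrow> real ^ 'n" where \<gamma>: "smooth \<gamma>" "\<And>t. \<gamma> (t + 1) = \<gamma> t" "range \<gamma> = \<Gamma>"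
    using assms unfolding smooth_closed_curve_def by auto
  have "Ck (Suc 0) \<gamma>" using \<gamma>(1) unfolding smooth_def by blast
  then have diff: "\<And>x. \<gamma> differentiable (at x)" and cont: "continuous_on UNIV (\<lambda>x. frechet_derivative \<gamma> (at x) 1)"
    by auto
  have "bounded ((\<lambda>x. frechet_derivative \<gamma> (at x) 1) ` {0..1})"
    by (intro compact_imp_bounded compact_continuous_image continuous_on_subset[OF cont]) auto
  then obtain L where L: "\<And>x. x \<in> {0..1} \<Longrightarrow> norm (frechet_derivative \<gamma> (at x) 1) \<le> L"
    unfolding bounded_iff by fast
  have L0: "0 \<le> L" using order_trans[OF norm_ge_zero L[of 0]] by simp
  have lip: "norm (\<gamma> x - \<gamma> y) \<le> L * norm (x - y)" if "x \<in> {0..1}" "y \<in> {0..1}" for x y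
  proof (rule differentiable_bound[of "{0..1}" \<gamma> "\<lambda>x. frechet_derivative \<gamma> (at x)"])
    fix x :: real assume x: "x \<in> {0..1}"
    have d: "(\<gamma> has_derivative frechet_derivative \<gamma> (at x)) (at x)"
      using diff frechet_derivative_works by blast
    then show "(\<gamma> has_derivative frechet_derivative \<gamma> (at x)) (at x within {0..1})"
      by (rule has_derivative_at_withinI)
    show "onorm (frechet_derivative \<gamma> (at x)) \<le> L"
    proof (rule onorm_le)
      fix h :: real
      have "frechet_derivative \<gamma> (at x) h = h *\<^sub>R frechet_derivative \<gamma> (at x) 1"
        using linear_scale[OF has_derivative_linear[OF d], of h 1] by simp
      then show "norm (frechet_derivative \<gamma> (at x) h) \<le> L * norm h"
        using mult_left_mono[OF L[OF x], of "\<bar>h\<bar>"] by (simp add: mult.commute)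
    qed
  qed (use that in auto)
  show ?thesis
  proof (intro exI[of _ L] exI[of _ "\<lambda>m j. \<gamma> (real j / real m)"] conjI allI impI L0)
    fix m :: nat assume m: "0 < m"
    show "\<Gamma> \<subseteq> (\<Union>j\<in>{..<m}. cball (\<gamma> (real j / real m)) (L / m))"
    proof
      fix y assume "y \<in> \<Gamma>"
      then obtain t where t: "y = \<gamma> t" using \<gamma>(3) by auto
      \<comment> \<open>Periodicity moves the parameter into [0, 1), where the derivative bound is
        available.\<close>
      define s where "s = frac t"
      have s: "0 \<le> s" "s < 1" unfolding s_def by (auto simp: frac_lt_1)
      have ys: "y = \<gamma> s" using periodic_of_int[of \<gamma> "s" "\<lfloor>t\<rfloor>", OF \<gamma>(2)] unfolding t s_def frac_def by simp
      define j where "j = nat \<lfloor>s * m\<rfloor>"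
      have j: "real j \<le> s * m" "s * m < real j + 1" unfolding j_def using s by auto
      have "real j < m" using j(1) s m mult_strict_right_mono[of s 1 "real m"] by linarith
      then have jm: "j < m" by simp
      have "\<bar>real j / m - s\<bar> \<le> 1 / m"
      proof -
        have "s - real j / m = (s * m - real j) / m" using m by (simp add: diff_divide_distrib)
        moreover have "0 \<le> (s * m - real j) / m" "(s * m - real j) / m \<le> 1 / m"
          using j by (auto intro!: divide_nonneg_nonneg divide_right_mono)
        ultimately show ?thesis by linarith
      qed
      moreover have "real j / m \<in> {0..1}" using jm m by (simp add: divide_le_eq)
      ultimately have "norm (\<gamma> (real j / m) - \<gamma> s) \<le> L * (1 / m)"
        using lip[of "real j / m" s] s mult_left_mono[OF _ L0, of "norm (real j / m - s)" "1 / m"] by fastforce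
      then show "y \<in> (\<Union>j\<in>{..<m}. cball (\<gamma> (real j / real m)) (L / m))"
        using jm ys by (auto simp: dist_norm)
    qed
  qed
qed

lemma admissible_interface_basic:
  fixes \<Gamma> :: "(real ^ 'n::finite) set"
  assumes "admissible_interface \<Gamma>"
  shows "\<Gamma> \<subseteq> pbox" "\<Gamma> \<noteq> {}"
  using assms unfolding admissible_interface_def smooth_closed_curve_def by (auto simp: pbox_def)

lemma admissible_interface_neighbourhood:
  fixes \<Gamma> :: "(real ^ 'n::finite) set"
  assumes \<Gamma>: "admissible_interface \<Gamma>"
  obtains C where "0 \<le> C" "\<And>r. 0 < r \<Longrightarrow> r \<le> 1 \<Longrightarrow> emeasure lebesgue {x \<in> pbox. infdist x \<Gamma> < r} \<le> ennreal (C * r)"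
proof -
  note ne = admissible_interface_basic(2)[OF \<Gamma>]
  consider "CARD('n) = 1" "\<Gamma> = {\<chi> i. - 1/2, \<chi> i. 1/2}" | "CARD('n) = 2" "smooth_closed_curve \<Gamma>"
    using \<Gamma> unfolding admissible_interface_def by auto
  then show ?thesis
  proof cases
    case 1
    \<comment> \<open>Two points, each with an interval of length 2 r.\<close>
    show ?thesis
    proof (rule that[of 4])
      fix r :: real assume r: "0 < r"
      have "\<Gamma> \<subseteq> (\<Union>j\<in>{False, True}. cball (if j then \<chi> i. 1/2 else \<chi> i. - 1/2) 0)" unfolding 1(2) by auto
      from emeasure_neighbourhood_le[OF _ this ne _ r]
      show "emeasure lebesgue {x \<in> pbox. infdist x \<Gamma> < r} \<le> ennreal (4 * r)" by (simp add: 1(1))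
    qed simp
  next
    case 2
    obtain L :: real and p :: "nat \<Rightarrow> nat \<Rightarrow> real ^ 'n" where L: "0 \<le> L" and p: "\<And>m::nat. 0 < m \<Longrightarrow> \<Gamma> \<subseteq> (\<Union>j\<in>{..<m}. cball (p m j) (L / m))"
      using smooth_closed_curve_cover[OF 2(2)] by auto
    \<comment> \<open>At most 2 / r squares of side at most 2 (L + 1) r have total area at most 8 (L
      + 1)^2 r.\<close>
    show ?thesis
    proof (rule that[of "8 * (L + 1)\<^sup>2"])
      fix r :: real assume r: "0 < r" "r \<le> 1"
      define m where "m = nat \<lceil>1 / r\<rceil>"
      have m: "1 / r \<le> real m" "real m \<le> 1 / r + 1" unfolding m_def using r by (auto simp: ceiling_correct)
      then have m0: "0 < m" using r by (smt (verit) divide_pos_pos of_nat_0_less_iff)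
      have "1 / m \<le> r" using m(1) r m0 by (simp add: field_simps)
      then have Lm: "L / m \<le> L * r" using mult_left_mono[OF _ L] by fastforce
      have "emeasure lebesgue {x \<in> pbox. infdist x \<Gamma> < r} \<le> ennreal (real m * (2 * (L / m + r)) ^ 2)"
        using emeasure_neighbourhood_le[OF _ p[OF m0] ne _ r(1)] L by (simp add: 2(1))
      also have "\<dots> \<le> ennreal ((2 / r) * (2 * (L * r + r)) ^ 2)"
      proof (intro ennreal_leI mult_mono power_mono)
        have "1 \<le> 1 / r" using r by simp
        then show "real m \<le> 2 / r" using m(2) by simp
      qed (use Lm L r in auto)
      also have "(2 / r) * (2 * (L * r + r)) ^ 2 = 8 * (L + 1)\<^sup>2 * r"
        using r(1) by (simp add: power2_eq_square field_simps)
      finally show "emeasure lebesgue {x \<in> pbox. infdist x \<Gamma> < r} \<le> ennreal (8 * (L + 1)\<^sup>2 * r)" .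
    qed simp
  qed
qed

lemma emeasure_boxm: "A \<subseteq> pbox \<Longrightarrow> emeasure boxm A = emeasure lebesgue A"
  using sets_pbox by (intro emeasure_restrict_space) auto

lemma infdist_measurable [measurable]: "(\<lambda>x. infdist x \<Gamma>) \<in> borel_measurable (boxm :: (real ^ 'n::finite) measure)"
  by (intro borel_measurable_boxm borel_measurable_continuous_onI continuous_intros)

text \<open>Dyadic shells: where the distance lies in [2^-(k+1), 2^-k) the integrand is at most
  q^(k+1) with q = 2 powr \<sigma>, on a set of measure O(2^-k). The sum is geometric with ratio q /
  2, and it converges because \<sigma> < 1.\<close>

lemma infdist_powr_integrable:
  fixes \<Gamma> :: "(real ^ 'n::finite) set"
  assumes \<Gamma>: "admissible_interface \<Gamma>" and \<sigma>: "0 < \<sigma>" "\<sigma> < 1"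
  shows "integrable boxm (\<lambda>x. infdist x \<Gamma> powr - \<sigma>)"
proof (rule integrableI_nonneg)
  show "(\<lambda>x. infdist x \<Gamma> powr - \<sigma>) \<in> borel_measurable boxm" by measurable
  obtain C where C: "0 \<le> C" "\<And>r. 0 < r \<Longrightarrow> r \<le> 1 \<Longrightarrow> emeasure lebesgue {x \<in> pbox. infdist x \<Gamma> < r} \<le> ennreal (C * r)"
    using admissible_interface_neighbourhood[OF \<Gamma>] by blast
  define q where "q = 2 powr \<sigma>"
  have q: "0 < q" "q < 2" using \<sigma> powr_less_mono[of \<sigma> 1 "2::real"] unfolding q_def by auto
  define A where "A k = {x \<in> pbox. infdist x \<Gamma> < (1/2) ^ k}" for k :: nat
  have A_meas [measurable]: "A k \<in> sets boxm" for k
  proof -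
    have "{x \<in> space boxm. infdist x \<Gamma> < (1/2) ^ k} \<in> sets boxm" by measurable
    then show ?thesis unfolding A_def by simp
  qed
  \<comment> \<open>At distance 0 the left side is 0, because \<open>0 powr a = 0\<close>; the
    summand 1 covers distances of at least 1.\<close>
  have ptw: "ennreal (infdist x \<Gamma> powr - \<sigma>) \<le> 1 + (\<Sum>k. ennreal (q ^ Suc k) * indicator (A k) x)" if x: "x \<in> pbox" for x
  proof -
    let ?D = "infdist x \<Gamma>"
    consider "?D = 0" | "1 \<le> ?D" | "0 < ?D" "?D < 1" using infdist_nonneg[of x \<Gamma>] by linarith
    then show ?thesis
    proof cases
      case 2
      then have "?D powr - \<sigma> \<le> 1" using powr_mono[of "- \<sigma>" 0 ?D] \<sigma> by simp
      then have "ennreal (?D powr - \<sigma>) \<le> 1" by simp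
      then show ?thesis by (meson le_iff_add order_trans)
    next
      case 3
      obtain n where n: "(1/2) ^ n < ?D" using real_arch_pow_inv[of ?D "1/2"] 3 by auto
      \<comment> \<open>By minimality of k the distance is still below 2^-(k-1), which places x in A
        (k - 1).\<close>
      define k where "k = (LEAST n. (1/2) ^ n \<le> ?D)"
      have k1: "(1/2) ^ k \<le> ?D" unfolding k_def by (rule LeastI[of _ n]) (use n in simp)
      have "k \<noteq> 0" using k1 3 by (intro notI) simp
      then obtain l where l: "k = Suc l" by (cases k) auto
      have "\<not> (1/2) ^ l \<le> ?D" using not_less_Least[of l "\<lambda>n. (1/2) ^ n \<le> ?D"] l unfolding k_def by simp
      then have "x \<in> A l" unfolding A_def using x by simp
      have "?D powr - \<sigma> \<le> ((1/2) ^ k) powr - \<sigma>"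
        using k1 \<sigma> by (intro powr_mono2') auto
      also have "((1/2) ^ k) powr - \<sigma> = q ^ k"
      proof -
        have "(1/2 :: real) ^ k = 2 powr (- real k)"
          by (simp add: powr_minus powr_realpow power_one_over inverse_eq_divide)
        moreover have "q ^ k = 2 powr (\<sigma> * real k)"
          using powr_realpow[of "2 powr \<sigma>" k] unfolding q_def by (simp add: powr_powr)
        ultimately show ?thesis by (simp add: powr_powr mult.commute)
      qed
      also have "q ^ k = q ^ Suc l" unfolding l ..
      finally have "ennreal (?D powr - \<sigma>) \<le> ennreal (q ^ Suc l) * indicator (A l) x"
        using \<open>x \<in> A l\<close> by (simp add: ennreal_leI)
      also have "\<dots> \<le> (\<Sum>k. ennreal (q ^ Suc k) * indicator (A k) x)"
      proof -
        define f where "f k = ennreal (q ^ Suc k) * indicator (A k) x" for k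
        have "f l \<le> suminf f" using sum_le_suminf[of f "{l}"] by simp
        then show ?thesis unfolding f_def .
      qed
      finally show ?thesis by (meson add_increasing zero_le)
    qed simp
  qed
  have "(\<integral>\<^sup>+x. ennreal (infdist x \<Gamma> powr - \<sigma>) \<partial>boxm) \<le> (\<integral>\<^sup>+x. 1 + (\<Sum>k. ennreal (q ^ Suc k) * indicator (A k) x) \<partial>boxm)"
    using ptw by (intro nn_integral_mono) simp
  also have "\<dots> = emeasure boxm (pbox :: (real ^ 'n) set) + (\<Sum>k. ennreal (q ^ Suc k) * emeasure boxm (A k))"
  proof (subst nn_integral_add)
    show "(\<integral>\<^sup>+(x :: real ^ 'n). 1 \<partial>boxm) + (\<integral>\<^sup>+x. (\<Sum>k. ennreal (q ^ Suc k) * indicator (A k) x) \<partial>boxm) =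
        emeasure boxm (pbox :: (real ^ 'n) set) + (\<Sum>k. ennreal (q ^ Suc k) * emeasure boxm (A k))"
      by (subst nn_integral_suminf) (simp_all add: nn_integral_cmult_indicator)
  qed measurable
  also have "\<dots> \<le> emeasure boxm (pbox :: (real ^ 'n) set) + (\<Sum>k. ennreal (q ^ Suc k) * ennreal (C * (1/2) ^ k))"
  proof (intro add_left_mono suminf_le mult_left_mono)
    show "emeasure boxm (A k) \<le> ennreal (C * (1/2) ^ k)" for k
      unfolding A_def by (subst emeasure_boxm) (auto intro!: C(2) power_le_one)
  qed auto
  also have "(\<Sum>k. ennreal (q ^ Suc k) * ennreal (C * (1/2) ^ k)) = (\<Sum>k. ennreal (C * q * (q / 2) ^ k))"
  proof -
    have "ennreal (q ^ Suc k) * ennreal (C * (1/2) ^ k) = ennreal (C * q * (q / 2) ^ k)" for k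
      using q C(1) by (subst ennreal_mult[symmetric]) (auto simp: power_divide field_simps)
    then show ?thesis by simp
  qed
  also have "\<dots> = ennreal (\<Sum>k. C * q * (q / 2) ^ k)"
    using q C(1) by (intro suminf_ennreal2 summable_mult summable_geometric) auto
  also have "emeasure boxm (pbox :: (real ^ 'n) set) + ennreal (\<Sum>k. C * q * (q / 2) ^ k) < \<infinity>"
    using emeasure_pbox_finite by (simp add: emeasure_boxm ennreal_add_less_top)
  finally show "(\<integral>\<^sup>+x. ennreal (infdist x \<Gamma> powr - \<sigma>) \<partial>boxm) < \<infinity>" .
qed simp

text \<open>The zero set of the distance lies in every r-neighbourhood, whose measure is
  O(r).\<close>

lemma AE_infdist_pos:
  fixes \<Gamma> :: "(real ^ 'n::finite) set"
  assumes \<Gamma>: "admissible_interface \<Gamma>"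
  shows "AE x in boxm. 0 < infdist x \<Gamma>"
proof -
  obtain C where C: "0 \<le> C" "\<And>r. 0 < r \<Longrightarrow> r \<le> 1 \<Longrightarrow> emeasure lebesgue {x \<in> pbox. infdist x \<Gamma> < r} \<le> ennreal (C * r)"
    using admissible_interface_neighbourhood[OF \<Gamma>] by blast
  let ?Z = "{x \<in> pbox. infdist x \<Gamma> \<le> 0}"
  have "emeasure lebesgue ?Z \<le> 0 + ennreal e" if "0 < e" for e
  proof -
    define r where "r = min 1 (e / (C + 1))"
    have r: "0 < r" "r \<le> 1" unfolding r_def using that C(1) by auto
    have "{x \<in> space boxm. infdist x \<Gamma> < r} \<in> sets boxm" by measurable
    then have "{x \<in> pbox. infdist x \<Gamma> < r} \<in> sets lebesgue" using sets_pbox by (simp add: sets_restrict_space_iff)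
    then have "emeasure lebesgue ?Z \<le> emeasure lebesgue {x \<in> pbox. infdist x \<Gamma> < r}"
      using r by (intro emeasure_mono) auto
    also have "\<dots> \<le> ennreal (C * r)" by (rule C(2)[OF r])
    also have "C * r \<le> (C + 1) * (e / (C + 1))" using C(1) r unfolding r_def by (intro mult_mono) auto
    finally show ?thesis using C(1) by (simp add: ennreal_leI)
  qed
  from ennreal_le_epsilon[OF this] have "emeasure boxm ?Z = 0" by (subst emeasure_boxm) auto
  moreover have "{x \<in> space boxm. infdist x \<Gamma> \<le> 0} \<in> sets boxm" by measurable
  ultimately show ?thesis by (subst AE_iff_measurable[of ?Z]) (auto simp: not_less)
qed

subsection \<open>The weighted Sobolev space as a closed subspace\<close>

text \<open>What the interface contributes to the analysis is condensed here into positivity almost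
  everywhere and integrability of 1 / \<alpha>.\<close>

locale weight =
  fixes \<alpha> :: "real ^ 'n::finite \<Rightarrow> real"
  assumes meas [measurable]: "\<alpha> \<in> borel_measurable boxm"
    and nonneg: "0 \<le> \<alpha> x"
    and bounded: "\<exists>K. \<forall>x. \<alpha> x \<le> K"
    and pos: "AE x in boxm. 0 < \<alpha> x"
    and inverse_integrable: "integrable boxm (\<lambda>x. 1 / \<alpha> x)"

text \<open>Completeness of Lebesgue measure: values on a null set are arbitrary. The weight is
  known to be continuous off the interface, which is such a set.\<close>

lemma borel_measurable_lebesgue_spike:
  fixes f g :: "'a::euclidean_space \<Rightarrow> real"
  assumes f: "f \<in> borel_measurable lebesgue" and N: "N \<in> null_sets lebesgue" and eq: "\<And>x. x \<notin> N \<Longrightarrow> g x = f x"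
  shows "g \<in> borel_measurable lebesgue"
proof (rule measurableI)
  fix B :: "real set" assume B: "B \<in> sets borel"
  have "g -` B \<inter> space lebesgue = (f -` B \<inter> space lebesgue - N) \<union> (g -` B \<inter> N)" using eq by auto
  moreover have "f -` B \<inter> space lebesgue - N \<in> sets lebesgue"
    using measurable_sets[OF f B] N by (intro sets.Diff) auto
  moreover have "g -` B \<inter> N \<in> sets lebesgue"
    using null_sets_completion_subset[OF _ N, of "g -` B \<inter> N"] by auto
  ultimately show "g -` B \<inter> space lebesgue \<in> sets lebesgue" by (simp only: sets.Un)
qed simp

lemma weights_weight:
  fixes \<Gamma> :: "(real ^ 'n::finite) set"
  assumes \<Gamma>: "admissible_interface \<Gamma>" and \<sigma>: "0 \<le> \<sigma>" "\<sigma> < 1" and \<alpha>: "\<alpha> \<in> weights \<sigma> \<Gamma>"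
  shows "weight \<alpha>"
proof -
  note \<Gamma>_box = admissible_interface_basic[OF \<Gamma>]
  have "\<exists>c\<ge>1. \<forall>x\<in>pbox. (1 / c) * dist_power \<sigma> \<Gamma> x \<le> \<alpha> x \<and> \<alpha> x \<le> c * dist_power \<sigma> \<Gamma> x"
    using \<alpha> unfolding weights_def by blast
  then obtain c where c: "1 \<le> c" "\<And>x. x \<in> pbox \<Longrightarrow> (1 / c) * dist_power \<sigma> \<Gamma> x \<le> \<alpha> x" by blast
  have nn: "0 \<le> \<alpha> x" for x using \<alpha> unfolding weights_def by auto
  have cont: "continuous_on (- periodic_translates \<Gamma>) \<alpha>" using \<alpha> unfolding weights_def by auto
  \<comment> \<open>Two distinct points of the half-open box never differ by a period, so the
    translates add nothing to \<Gamma> there.\<close>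
  have "x \<in> \<Gamma>" if x: "x \<in> pbox" and y: "y \<in> \<Gamma>" "\<forall>i. (x $ i - y $ i) / 2 \<in> \<int>" for x y
  proof -
    have "x $ i = y $ i" for i
    proof -
      have "\<bar>x $ i - y $ i\<bar> < 2"
        using x subsetD[OF \<Gamma>_box(1) y(1)] unfolding pbox_def by (auto simp: abs_less_iff) (smt (verit))+
      moreover obtain m where "(x $ i - y $ i) / 2 = of_int m" by (meson Ints_cases y(2))
      then have m: "x $ i - y $ i = 2 * of_int m" by simp
      ultimately have "- 1 < real_of_int m" "real_of_int m < 1" by (simp_all add: abs_less_iff)
      then have "m = 0" by linarith
      then show ?thesis using m by simp
    qed
    then have "x = y" by (simp add: vec_eq_iff)
    then show ?thesis using y(1) by simp
  qed
  then have sub: "pbox - \<Gamma> \<subseteq> - periodic_translates \<Gamma>" unfolding periodic_translates_def by blast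
  have AE_pos: "AE x in boxm. 0 < infdist x \<Gamma>" by (rule AE_infdist_pos[OF \<Gamma>])
  have "AE x in lebesgue. x \<in> pbox \<longrightarrow> 0 < infdist x \<Gamma>"
    using AE_pos sets_pbox by (subst (asm) AE_restrict_space_iff) auto
  then have "AE x in lebesgue. x \<notin> \<Gamma>" by eventually_elim (use \<Gamma>_box(1) in auto)
  then have null: "\<Gamma> \<in> null_sets lebesgue" by (subst completion.null_sets_iff_AE) simp
  have meas: "\<alpha> \<in> borel_measurable boxm"
  proof -
    have S: "pbox - \<Gamma> \<in> sets lebesgue" using null sets_pbox by auto
    have "\<alpha> \<in> borel_measurable (lebesgue_on (pbox - \<Gamma>))"
      by (intro continuous_imp_measurable_on_sets_lebesgue continuous_on_subset[OF cont sub] S)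
    then have 1: "(\<lambda>x. if x \<in> pbox - \<Gamma> then \<alpha> x else 0) \<in> borel_measurable lebesgue"
      using borel_measurable_if[OF S] by blast
    have "(\<lambda>x. if x \<in> pbox then \<alpha> x else 0) \<in> borel_measurable lebesgue"
      by (rule borel_measurable_lebesgue_spike[OF 1 null]) auto
    then show ?thesis using borel_measurable_if[OF sets_pbox] by blast
  qed
  have lower: "AE x in boxm. 0 < \<alpha> x \<and> 1 / \<alpha> x \<le> c * (if \<sigma> = 0 then 1 else infdist x \<Gamma> powr - \<sigma>)"
    using AE_pos AE_space
  proof eventually_elim
    case (elim x)
    then have x: "x \<in> pbox" by simp
    have d: "0 < dist_power \<sigma> \<Gamma> x" using elim unfolding dist_power_def by simp
    then have a: "0 < (1 / c) * dist_power \<sigma> \<Gamma> x" using c(1) by simp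
    have le: "(1 / c) * dist_power \<sigma> \<Gamma> x \<le> \<alpha> x" by (rule c(2)[OF x])
    have "1 / \<alpha> x \<le> 1 / ((1 / c) * dist_power \<sigma> \<Gamma> x)" by (intro frac_le a le) simp_all
    also have "\<dots> = c * (if \<sigma> = 0 then 1 else infdist x \<Gamma> powr - \<sigma>)"
      unfolding dist_power_def by (simp add: powr_minus_divide)
    finally show ?case using a le by simp
  qed
  show ?thesis
  proof
    show "\<alpha> \<in> borel_measurable boxm" by (rule meas)
    show "0 \<le> \<alpha> x" for x by (rule nn)
    show "\<exists>K. \<forall>x. \<alpha> x \<le> K"
    proof -
      have "bounded (range \<alpha>)" using \<alpha> unfolding weights_def by blast
      then obtain K where "\<forall>x. \<bar>\<alpha> x\<bar> \<le> K" unfolding bounded_iff by auto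
      then show ?thesis by (meson abs_le_D1)
    qed
    show "AE x in boxm. 0 < \<alpha> x" using lower by eventually_elim simp
    show "integrable boxm (\<lambda>x. 1 / \<alpha> x)"
    proof (rule Bochner_Integration.integrable_bound)
      show "integrable boxm (\<lambda>x. c * (if \<sigma> = 0 then 1 else infdist x \<Gamma> powr - \<sigma>))"
        using finite_measure.integrable_const[OF finite_measure_boxm] infdist_powr_integrable[OF \<Gamma>] \<sigma>
        by (cases "\<sigma> = 0") auto
      show "(\<lambda>x. 1 / \<alpha> x) \<in> borel_measurable boxm" using meas by measurable
      show "AE x in boxm. norm (1 / \<alpha> x) \<le> norm (c * (if \<sigma> = 0 then 1 else infdist x \<Gamma> powr - \<sigma>))"
        using lower by eventually_elim (use nn c(1) in \<open>auto simp: abs_mult\<close>)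
    qed
  qed
qed

section \<open>Test functions and weak gradients\<close>

abbreviation partial :: "(real ^ 'n::finite \<Rightarrow> real) \<Rightarrow> 'n \<Rightarrow> real ^ 'n \<Rightarrow> real" where
  "partial \<phi> i x \<equiv> frechet_derivative \<phi> (at x) (axis i 1)"

definition test_functions :: "(real ^ 'n::finite \<Rightarrow> real) set" where
  "test_functions = {\<phi>. smooth \<phi> \<and> box_periodic \<phi>}"

lemma wave_test: "k \<in> frequencies \<Longrightarrow> (\<lambda>x. a * wave k c x) \<in> test_functions"
  by (simp add: test_functions_def smooth_wave periodic_wave)

lemma test_has_derivative:
  assumes "\<phi> \<in> test_functions"
  shows "(\<phi> has_derivative frechet_derivative \<phi> (at x)) (at x)"
proof -
  have "Ck (Suc 0) \<phi>" using assms unfolding test_functions_def smooth_def by blast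
  then show ?thesis using frechet_derivative_works by auto
qed

lemma test_continuous: "\<phi> \<in> test_functions \<Longrightarrow> continuous_on UNIV \<phi>"
  unfolding test_functions_def smooth_def by (metis (mono_tags) Ck.simps(1) mem_Collect_eq)

lemma test_partial_continuous:
  assumes "\<phi> \<in> test_functions"
  shows "continuous_on UNIV (partial \<phi> i)"
proof -
  have "Ck (Suc 0) \<phi>" using assms unfolding test_functions_def smooth_def by blast
  then show ?thesis by (auto simp: axis_in_Basis_iff)
qed

lemma continuous_box_bounded:
  fixes f :: "real ^ 'n::finite \<Rightarrow> real"
  assumes "continuous_on UNIV f"
  obtains K where "0 \<le> K" "\<And>x. x \<in> pbox \<Longrightarrow> \<bar>f x\<bar> \<le> K"
proof -
  have "bounded (f ` cbox (- 1) 1)"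
    by (intro compact_imp_bounded compact_continuous_image compact_cbox continuous_on_subset[OF assms]) auto
  then obtain K where K: "\<forall>y \<in> f ` cbox (- 1) 1. norm y \<le> K" unfolding bounded_iff by blast
  show ?thesis
  proof (rule that[of "\<bar>K\<bar>"])
    fix x :: "real ^ 'n" assume "x \<in> pbox"
    then have "x \<in> cbox (- 1) 1" using pbox_subset_cbox by auto
    then show "\<bar>f x\<bar> \<le> \<bar>K\<bar>" using K by force
  qed simp
qed

lemma sq_integrable_continuous:
  fixes f :: "real ^ 'n::finite \<Rightarrow> real"
  assumes "continuous_on UNIV f"
  shows "sq_integrable f"
proof -
  obtain K where K: "0 \<le> K" "\<And>x. x \<in> pbox \<Longrightarrow> \<bar>f x\<bar> \<le> K" using continuous_box_bounded[OF assms] by blast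
  have m [measurable]: "f \<in> borel_measurable boxm"
    by (intro borel_measurable_boxm borel_measurable_continuous_onI assms)
  have "integrable boxm (\<lambda>x. (f x)\<^sup>2)"
  proof (rule integrable_boxm_bounded[of _ "K\<^sup>2"])
    fix x :: "real ^ 'n" assume "x \<in> pbox"
    from power_mono[OF K(2)[OF this], of 2] show "norm ((f x)\<^sup>2) \<le> K\<^sup>2" by simp
  qed measurable
  then show ?thesis by (simp add: sq_integrable_def)
qed

lemmas sq_integrable_test = sq_integrable_continuous[OF test_continuous]
lemmas sq_integrable_test_partial = sq_integrable_continuous[OF test_partial_continuous]

lemma integration_by_parts:
  assumes \<phi>: "\<phi> \<in> test_functions" and \<psi>: "\<psi> \<in> test_functions"
  shows "(LINT x|boxm. \<psi> x * partial \<phi> i x) = - (LINT x|boxm. partial \<psi> i x * \<phi> x)"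
proof -
  let ?F' = "\<lambda>x h. \<psi> x * frechet_derivative \<phi> (at x) h + frechet_derivative \<psi> (at x) h * \<phi> x"
  have "(LINT x|boxm. ?F' x (axis i 1)) = 0"
  proof (rule integral_partial_derivative)
    show "((\<lambda>x. \<psi> x * \<phi> x) has_derivative ?F' x) (at x)" for x
      by (intro has_derivative_mult test_has_derivative \<phi> \<psi>)
    show "box_periodic (\<lambda>x. \<psi> x * \<phi> x)" using \<phi> \<psi> unfolding test_functions_def box_periodic_def by simp
    show "continuous_on UNIV (\<lambda>x. ?F' x (axis i 1))"
      by (intro continuous_intros test_continuous test_partial_continuous \<phi> \<psi>)
  qed
  moreover have "integrable boxm (\<lambda>x. \<psi> x * partial \<phi> i x)" "integrable boxm (\<lambda>x. partial \<psi> i x * \<phi> x)"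
    by (intro sq_integrable_mult sq_integrable_test sq_integrable_test_partial \<phi> \<psi>)+
  ultimately show ?thesis by simp
qed

lemma has_weak_gradient_iff:
  "has_weak_gradient u g \<longleftrightarrow> integrable boxm g \<and>
    (\<forall>\<phi>\<in>test_functions. \<forall>i. u \<bullet> abs_l2 (partial \<phi> i) = - (LINT x|boxm. g x $ i * \<phi> x))"
  by (auto simp: has_weak_gradient.rep_eq test_functions_def[symmetric] inner_l2_abs sq_integrable_test_partial
      simp flip: test_functions_def) (auto simp: test_functions_def inner_l2_abs sq_integrable_test_partial)

lemma integrable_component_cart:
  "integrable M f \<Longrightarrow> integrable M (\<lambda>x. (f x :: real ^ 'n::finite) $ i)"
  by (rule integrable_bounded_linear[OF bounded_linear_vec_nth])

text \<open>Waves are test functions, and each component of the difference is orthogonal to all of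
  them. Hence the arbitrary choice in \<open>grad\<close> is determined almost everywhere.\<close>

lemma has_weak_gradient_unique:
  fixes u :: "'n::finite l2"
  assumes g: "has_weak_gradient u g" and h: "has_weak_gradient u h"
  shows "AE x in boxm. g x = h x"
proof -
  have int: "integrable boxm (\<lambda>x. g x $ i)" "integrable boxm (\<lambda>x. h x $ i)" for i
    using g h unfolding has_weak_gradient_iff by (auto intro: integrable_component_cart)
  have "AE x in boxm. g x $ i - h x $ i = 0" for i
  proof (rule trig_total)
    show "integrable boxm (\<lambda>x. g x $ i - h x $ i)" using int by auto
    fix k :: "real ^ 'n" and c assume k: "k \<in> frequencies"
    have t: "wave k c \<in> test_functions" using wave_test[OF k, of 1 c] by simp
    have "integrable boxm (\<lambda>x. f x $ i * wave k c x)" if "integrable boxm (\<lambda>x. f x $ i)" for f :: "real ^ 'n \<Rightarrow> real ^ 'n"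
    proof (rule Bochner_Integration.integrable_bound[OF that])
      show "(\<lambda>x. f x $ i * wave k c x) \<in> borel_measurable boxm"
        using borel_measurable_integrable[OF that] sq_integrable_test[OF t]
        by (intro borel_measurable_times) (auto simp: sq_integrable_def)
      show "AE x in boxm. norm (f x $ i * wave k c x) \<le> norm (f x $ i)"
        by (intro AE_I2) (simp add: abs_mult wave_def mult_left_le)
    qed
    note this[OF int(1)[of i]] this[OF int(2)[of i]]
    moreover have "(LINT x|boxm. g x $ i * wave k c x) = (LINT x|boxm. h x $ i * wave k c x)"
    proof -
      have "u \<bullet> abs_l2 (partial (wave k c) i) = - (LINT x|boxm. g x $ i * wave k c x)"
        using g t unfolding has_weak_gradient_iff by blast
      moreover have "u \<bullet> abs_l2 (partial (wave k c) i) = - (LINT x|boxm. h x $ i * wave k c x)"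
        using h t unfolding has_weak_gradient_iff by blast
      ultimately show ?thesis by linarith
    qed
    ultimately show "(LINT x|boxm. (g x $ i - h x $ i) * wave k c x) = 0" by (simp add: left_diff_distrib)
  qed
  then have "AE x in boxm. \<forall>i. g x $ i - h x $ i = 0" by (subst AE_all_countable) simp
  then show ?thesis by eventually_elim (simp add: vec_eq_iff)
qed

lemma integrable_vec_lambda:
  assumes "\<And>i. integrable M (f i)"
  shows "integrable M (\<lambda>x. (\<chi> i. f i x) :: real ^ 'n::finite)"
proof -
  have "(\<chi> i. f i x) = (\<Sum>i\<in>UNIV. f i x *\<^sub>R (axis i 1 :: real ^ 'n))" for x
    using basis_expansion[of "\<chi> i. f i x"] by (simp add: scalar_mult_eq_scaleR)
  then show ?thesis using assms by auto
qed

section \<open>The Hilbert space model of the weighted Sobolev space\<close>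

context weight
begin

definition s :: "real ^ 'n \<Rightarrow> real" where "s x = sqrt (\<alpha> x)"

lemma s_meas [measurable]: "s \<in> borel_measurable boxm"
  unfolding s_def[abs_def] by measurable

lemma s_sq: "s x * s x = \<alpha> x" using nonneg[of x] by (simp add: s_def)

lemma s_pos: "AE x in boxm. 0 < s x"
  using pos by eventually_elim (simp add: s_def)

text \<open>A test function is bounded on the box, so the square is dominated by a multiple of 1 /
  \<alpha>. These quotients are the vectors against which \<open>W\<close> tests.\<close>

lemma sq_integrable_div_s:
  assumes "\<phi> \<in> test_functions"
  shows "sq_integrable (\<lambda>x. \<phi> x / s x)"
  unfolding sq_integrable_def
proof
  have [measurable]: "\<phi> \<in> borel_measurable boxm" using sq_integrable_test[OF assms] by (simp add: sq_integrable_def)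
  show "(\<lambda>x. \<phi> x / s x) \<in> borel_measurable boxm" by measurable
  obtain K where K: "0 \<le> K" "\<And>x. x \<in> pbox \<Longrightarrow> \<bar>\<phi> x\<bar> \<le> K"
    using continuous_box_bounded[OF test_continuous[OF assms]] by blast
  show "integrable boxm (\<lambda>x. (\<phi> x / s x)\<^sup>2)"
  proof (rule Bochner_Integration.integrable_bound)
    show "integrable boxm (\<lambda>x. K\<^sup>2 * (1 / \<alpha> x))" using inverse_integrable by (rule integrable_mult_right)
    show "(\<lambda>x. (\<phi> x / s x)\<^sup>2) \<in> borel_measurable boxm" by measurable
    show "AE x in boxm. norm ((\<phi> x / s x)\<^sup>2) \<le> norm (K\<^sup>2 * (1 / \<alpha> x))"
    proof (intro AE_I2)
      fix x :: "real ^ 'n" assume "x \<in> space boxm"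
      then have "(\<phi> x)\<^sup>2 \<le> K\<^sup>2" using power_mono[OF K(2), of x 2] by simp
      then show "norm ((\<phi> x / s x)\<^sup>2) \<le> norm (K\<^sup>2 * (1 / \<alpha> x))"
        using s_sq[of x] nonneg[of x] by (simp add: power_divide power2_eq_square[of "s x"] divide_right_mono)
    qed
  qed
qed

lemma sq_integrable_inverse_s: "sq_integrable (\<lambda>x. 1 / s x)"
  using sq_integrable_div_s[of "\<lambda>x. 1"] wave_test[OF frequencies_intros(1), of 1 0] by (simp add: wave_def)

lemma sq_integrable_s_mult:
  assumes "continuous_on UNIV f"
  shows "sq_integrable (\<lambda>x. s x * f x)"
  unfolding sq_integrable_def
proof
  have [measurable]: "f \<in> borel_measurable boxm"
    by (intro borel_measurable_boxm borel_measurable_continuous_onI assms)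
  show "(\<lambda>x. s x * f x) \<in> borel_measurable boxm" by measurable
  obtain K where K: "\<And>x. \<alpha> x \<le> K" using bounded by auto
  obtain L where L: "0 \<le> L" "\<And>x. x \<in> pbox \<Longrightarrow> \<bar>f x\<bar> \<le> L" using continuous_box_bounded[OF assms] by blast
  show "integrable boxm (\<lambda>x. (s x * f x)\<^sup>2)"
  proof (rule integrable_boxm_bounded[of _ "K * L\<^sup>2"])
    fix x :: "real ^ 'n" assume x: "x \<in> pbox"
    have "(s x * f x)\<^sup>2 = \<alpha> x * (f x)\<^sup>2" by (simp add: power_mult_distrib power2_eq_square[of "s x"] s_sq)
    also have "\<dots> \<le> K * L\<^sup>2"
      using power_mono[OF L(2)[OF x], of 2] K[of x] nonneg[of x] by (intro mult_mono) auto
    finally show "norm ((s x * f x)\<^sup>2) \<le> K * L\<^sup>2" by simp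
  qed measurable
qed

text \<open>The weak form of w = sqrt \<alpha> grad u, with the weight moved onto the test function.
  Each condition equates two bounded functionals, so closedness is immediate.\<close>

definition W :: "('n l2 \<times> ('n l2 ^ 'n)) set" where
  "W = {(u, w). \<forall>\<phi>\<in>test_functions. \<forall>i. u \<bullet> abs_l2 (partial \<phi> i) = - (w $ i \<bullet> abs_l2 (\<lambda>x. \<phi> x / s x))}"

lemma subspace_W: "subspace W"
  unfolding W_def by (auto intro!: subspaceI simp: inner_add_left zero_prod_def)

lemma closed_W: "closed W"
proof -
  have "W = (\<Inter>\<phi>\<in>test_functions. \<Inter>i. {p. fst p \<bullet> abs_l2 (partial \<phi> i) = - (snd p $ i \<bullet> abs_l2 (\<lambda>x. \<phi> x / s x))})"
    unfolding W_def by auto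
  moreover have "closed {p :: 'n l2 \<times> ('n l2 ^ 'n). fst p \<bullet> a = - (snd p $ i \<bullet> b)}" for a b i
    by (intro closed_Collect_eq continuous_intros)
  then have "closed (\<Inter>\<phi>\<in>test_functions. \<Inter>i. {p :: 'n l2 \<times> ('n l2 ^ 'n). fst p \<bullet> abs_l2 (partial \<phi> i) = - (snd p $ i \<bullet> abs_l2 (\<lambda>x. \<phi> x / s x))})"
    by (intro closed_INT ballI)
  ultimately show ?thesis by simp
qed

definition hat :: "'n l2 \<Rightarrow> 'n l2 \<times> ('n l2 ^ 'n)" where
  "hat u = (u, \<chi> i. abs_l2 (\<lambda>x. s x * grad u x $ i))"

lemma fst_hat [simp]: "fst (hat u) = u"
  by (simp add: hat_def)

lemma grad_works: "u \<in> H1 \<alpha> \<Longrightarrow> has_weak_gradient u (grad u)"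
  unfolding H1_def grad_def using someI_ex[of "has_weak_gradient u"] by simp

lemma sq_integrable_s_grad:
  assumes u: "u \<in> H1 \<alpha>"
  shows "sq_integrable (\<lambda>x. s x * grad u x $ i)"
  unfolding sq_integrable_def
proof
  have g: "integrable boxm (grad u)" using grad_works[OF u] by (simp add: has_weak_gradient_iff)
  then have [measurable]: "(\<lambda>x. grad u x $ i) \<in> borel_measurable boxm"
    using borel_measurable_integrable integrable_component_cart by blast
  show "(\<lambda>x. s x * grad u x $ i) \<in> borel_measurable boxm" by measurable
  show "integrable boxm (\<lambda>x. (s x * grad u x $ i)\<^sup>2)"
  proof (rule Bochner_Integration.integrable_bound)
    show "integrable boxm (\<lambda>x. \<alpha> x * (norm (grad u x))\<^sup>2)" using u by (simp add: H1_def)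
    show "(\<lambda>x. (s x * grad u x $ i)\<^sup>2) \<in> borel_measurable boxm" by measurable
    have "(grad u x $ i)\<^sup>2 \<le> (norm (grad u x))\<^sup>2" for x
      using power_mono[OF component_le_norm_cart[of "grad u x" i], of 2] by simp
    then show "AE x in boxm. norm ((s x * grad u x $ i)\<^sup>2) \<le> norm (\<alpha> x * (norm (grad u x))\<^sup>2)"
      using nonneg by (intro AE_I2) (simp add: power_mult_distrib power2_eq_square[of "s _"] s_sq abs_mult mult_left_mono)
  qed
qed

lemma hat_in_W:
  assumes u: "u \<in> H1 \<alpha>"
  shows "hat u \<in> W"
  unfolding W_def hat_def
proof (clarsimp)
  fix \<phi> :: "real ^ 'n \<Rightarrow> real" and i assume \<phi>: "\<phi> \<in> test_functions"
  have "abs_l2 (\<lambda>x. s x * grad u x $ i) \<bullet> abs_l2 (\<lambda>x. \<phi> x / s x) = (LINT x|boxm. (s x * grad u x $ i) * (\<phi> x / s x))"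
    by (intro inner_abs_l2 sq_integrable_s_grad u sq_integrable_div_s \<phi>)
  also have "\<dots> = (LINT x|boxm. grad u x $ i * \<phi> x)"
  proof (rule integral_cong_AE)
    have g: "integrable boxm (\<lambda>x. grad u x $ i)"
      using grad_works[OF u] by (auto simp: has_weak_gradient_iff intro: integrable_component_cart)
    note [measurable] = borel_measurable_integrable[OF g]
    have [measurable]: "\<phi> \<in> borel_measurable boxm" using sq_integrable_test[OF \<phi>] by (simp add: sq_integrable_def)
    show "(\<lambda>x. (s x * grad u x $ i) * (\<phi> x / s x)) \<in> borel_measurable boxm" by measurable
    show "(\<lambda>x. grad u x $ i * \<phi> x) \<in> borel_measurable boxm" by measurable
    show "AE x in boxm. (s x * grad u x $ i) * (\<phi> x / s x) = grad u x $ i * \<phi> x"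
      using s_pos by eventually_elim simp
  qed
  finally show "u \<bullet> abs_l2 (partial \<phi> i) = - (abs_l2 (\<lambda>x. s x * grad u x $ i) \<bullet> abs_l2 (\<lambda>x. \<phi> x / s x))"
    using grad_works[OF u] \<phi> by (simp add: has_weak_gradient_iff)
qed

text \<open>w / sqrt \<alpha> is a product of two square integrable functions, hence integrable, and
  it is a weak gradient of u; uniqueness identifies it with \<open>grad u\<close>. Thus W contains
  nothing but images under \<open>hat\<close>.\<close>

lemma W_cases:
  assumes "(u, w) \<in> W"
  shows "u \<in> H1 \<alpha>" "hat u = (u, w)"
proof -
  define g where "g x = (\<chi> i. rep_l2 (w $ i) x * (1 / s x))" for x
  have "integrable boxm g"
    unfolding g_def[abs_def] by (intro integrable_vec_lambda sq_integrable_mult sq_integrable_inverse_s) simp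
  moreover have "u \<bullet> abs_l2 (partial \<phi> i) = - (LINT x|boxm. g x $ i * \<phi> x)" if \<phi>: "\<phi> \<in> test_functions" for \<phi> i
  proof -
    have "u \<bullet> abs_l2 (partial \<phi> i) = - (w $ i \<bullet> abs_l2 (\<lambda>x. \<phi> x / s x))"
      using assms \<phi> unfolding W_def by blast
    also have "w $ i \<bullet> abs_l2 (\<lambda>x. \<phi> x / s x) = (LINT x|boxm. g x $ i * \<phi> x)"
      by (simp add: inner_l2_abs sq_integrable_div_s \<phi> g_def)
    finally show ?thesis .
  qed
  ultimately have wg: "has_weak_gradient u g" by (simp add: has_weak_gradient_iff)
  then have "has_weak_gradient u (grad u)" unfolding grad_def by (rule someI[of "has_weak_gradient u"])
  then have "AE x in boxm. grad u x = g x" using wg by (rule has_weak_gradient_unique)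
  then have sg: "AE x in boxm. \<forall>i. s x * grad u x $ i = rep_l2 (w $ i) x"
    using s_pos by eventually_elim (simp add: g_def)
  have g_meas: "(\<lambda>x. grad u x $ i) \<in> borel_measurable boxm" for i
    using \<open>has_weak_gradient u (grad u)\<close>
    by (auto simp: has_weak_gradient_iff intro!: borel_measurable_integrable integrable_component_cart)
  have i1: "integrable boxm (\<lambda>x. \<Sum>i\<in>UNIV. (rep_l2 (w $ i) x)\<^sup>2)"
  proof (intro Bochner_Integration.integrable_sum)
    show "integrable boxm (\<lambda>x. (rep_l2 (w $ i) x)\<^sup>2)" for i
      using sq_integrable_rep[of "w $ i"] unfolding sq_integrable_def by blast
  qed
  have i2: "AE x in boxm. (\<Sum>i\<in>UNIV. (rep_l2 (w $ i) x)\<^sup>2) = \<alpha> x * (norm (grad u x))\<^sup>2"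
    using sg
  proof eventually_elim
    case (elim x)
    have "\<alpha> x * (norm (grad u x))\<^sup>2 = (\<Sum>i\<in>UNIV. (s x * grad u x $ i)\<^sup>2)"
      unfolding power2_norm_eq_inner inner_vec_def
      by (simp add: sum_distrib_left power2_eq_square s_sq[symmetric] mult_ac)
    then show ?case using elim by simp
  qed
  have i3: "(\<lambda>x. \<alpha> x * (norm (grad u x))\<^sup>2) \<in> borel_measurable boxm"
  proof -
    have "grad u \<in> borel_measurable boxm"
      using \<open>has_weak_gradient u (grad u)\<close> by (auto simp: has_weak_gradient_iff intro!: borel_measurable_integrable)
    then show ?thesis by measurable
  qed
  from i1 i3 i2 have "integrable boxm (\<lambda>x. \<alpha> x * (norm (grad u x))\<^sup>2)" by (rule integrable_cong_AE_imp)
  then show u: "u \<in> H1 \<alpha>" using wg unfolding H1_def by auto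
  have "abs_l2 (\<lambda>x. s x * grad u x $ i) = abs_l2 (rep_l2 (w $ i))" for i
    using sg by (subst abs_l2_eq_iff) (auto simp: sq_integrable_s_grad[OF u] elim: AE_mp)
  then show "hat u = (u, w)" by (simp add: hat_def vec_eq_iff)
qed

lemma hat_fst: "p \<in> W \<Longrightarrow> hat (fst p) = p" and fst_in_H1: "p \<in> W \<Longrightarrow> fst p \<in> H1 \<alpha>"
  using W_cases[of "fst p" "snd p"] by auto

text \<open>\<open>grad\<close> is a choice and so respects sums only almost everywhere; linearity
  of \<open>hat\<close> is read off from the subspace W, whose elements are determined by their
  first component.\<close>

lemma H1_closed: "u \<in> H1 \<alpha> \<Longrightarrow> v \<in> H1 \<alpha> \<Longrightarrow> u + v \<in> H1 \<alpha>" "u \<in> H1 \<alpha> \<Longrightarrow> v \<in> H1 \<alpha> \<Longrightarrow> u - v \<in> H1 \<alpha>"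
    "u \<in> H1 \<alpha> \<Longrightarrow> c *\<^sub>R u \<in> H1 \<alpha>"
  and hat_simps: "u \<in> H1 \<alpha> \<Longrightarrow> v \<in> H1 \<alpha> \<Longrightarrow> hat (u + v) = hat u + hat v"
    "u \<in> H1 \<alpha> \<Longrightarrow> v \<in> H1 \<alpha> \<Longrightarrow> hat (u - v) = hat u - hat v" "u \<in> H1 \<alpha> \<Longrightarrow> hat (c *\<^sub>R u) = c *\<^sub>R hat u"
proof -
  assume u: "u \<in> H1 \<alpha>"
  have p: "c *\<^sub>R hat u \<in> W" by (intro subspace_scale[OF subspace_W] hat_in_W u)
  from fst_in_H1[OF p] hat_fst[OF p] show "c *\<^sub>R u \<in> H1 \<alpha>" "hat (c *\<^sub>R u) = c *\<^sub>R hat u" by simp_all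
  assume v: "v \<in> H1 \<alpha>"
  have p: "hat u + hat v \<in> W" by (intro subspace_add[OF subspace_W] hat_in_W u v)
  from fst_in_H1[OF p] hat_fst[OF p] show "u + v \<in> H1 \<alpha>" "hat (u + v) = hat u + hat v" by simp_all
  have p: "hat u - hat v \<in> W" by (intro subspace_diff[OF subspace_W] hat_in_W u v)
  from fst_in_H1[OF p] hat_fst[OF p] show "u - v \<in> H1 \<alpha>" "hat (u - v) = hat u - hat v" by simp_all
qed

lemma subspace_H1: "subspace (H1 \<alpha>)"
proof -
  have "0 \<in> H1 \<alpha>" using fst_in_H1[OF subspace_0[OF subspace_W]] by simp
  then show ?thesis by (auto intro: subspaceI H1_closed)
qed

lemma inner_hat:
  assumes u: "u \<in> H1 \<alpha>" and v: "v \<in> H1 \<alpha>"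
  shows "hat u \<bullet> hat v = u \<bullet> v + form \<alpha> u v"
proof -
  have int: "integrable boxm (\<lambda>x. (s x * grad u x $ i) * (s x * grad v x $ i))" for i
    by (intro sq_integrable_mult sq_integrable_s_grad u v)
  have "hat u \<bullet> hat v = u \<bullet> v + (\<Sum>i\<in>UNIV. (LINT x|boxm. (s x * grad u x $ i) * (s x * grad v x $ i)))"
    by (simp add: hat_def inner_vec_def inner_abs_l2 sq_integrable_s_grad u v)
  also have "(\<Sum>i\<in>UNIV. (LINT x|boxm. (s x * grad u x $ i) * (s x * grad v x $ i)))
      = (LINT x|boxm. (\<Sum>i\<in>UNIV. (s x * grad u x $ i) * (s x * grad v x $ i)))"
    using int by (intro Bochner_Integration.integral_sum[symmetric])
  also have "\<dots> = form \<alpha> u v"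
    unfolding form_def by (intro Bochner_Integration.integral_cong refl)
      (simp add: inner_vec_def sum_distrib_left s_sq[symmetric] mult_ac)
  finally show ?thesis .
qed

lemma norm_hat: "u \<in> H1 \<alpha> \<Longrightarrow> norm (hat u) = H1_norm \<alpha> u"
  unfolding norm_eq_sqrt_inner H1_norm_def inner_hat by (simp add: form_def power2_norm_eq_inner)

text \<open>Boundedness of \<alpha> puts the weighted gradient into L2, and integration by parts
  identifies it. These elements make the Sobolev space dense in L2.\<close>

lemma wave_in_H1:
  assumes k: "k \<in> frequencies"
  shows "abs_l2 (wave k c) \<in> H1 \<alpha>"
proof -
  have t: "wave k c \<in> test_functions" using wave_test[OF k, of 1 c] by simp
  have "(abs_l2 (wave k c), \<chi> i. abs_l2 (\<lambda>x. s x * partial (wave k c) i x)) \<in> W"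
    unfolding W_def
  proof (clarsimp)
    fix \<phi> :: "real ^ 'n \<Rightarrow> real" and i assume \<phi>: "\<phi> \<in> test_functions"
    have "abs_l2 (\<lambda>x. s x * partial (wave k c) i x) \<bullet> abs_l2 (\<lambda>x. \<phi> x / s x)
        = (LINT x|boxm. (s x * partial (wave k c) i x) * (\<phi> x / s x))"
      by (intro inner_abs_l2 sq_integrable_s_mult test_partial_continuous t sq_integrable_div_s \<phi>)
    also have "\<dots> = (LINT x|boxm. partial (wave k c) i x * \<phi> x)"
    proof (rule integral_cong_AE)
      have [measurable]: "\<phi> \<in> borel_measurable boxm" "partial (wave k c) i \<in> borel_measurable boxm"
        using sq_integrable_test[OF \<phi>] sq_integrable_test_partial[OF t] by (auto simp: sq_integrable_def)
      show "(\<lambda>x. (s x * partial (wave k c) i x) * (\<phi> x / s x)) \<in> borel_measurable boxm" by measurable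
      show "(\<lambda>x. partial (wave k c) i x * \<phi> x) \<in> borel_measurable boxm" by measurable
      show "AE x in boxm. (s x * partial (wave k c) i x) * (\<phi> x / s x) = partial (wave k c) i x * \<phi> x"
        using s_pos by eventually_elim simp
    qed
    also have "\<dots> = - (LINT x|boxm. wave k c x * partial \<phi> i x)" using integration_by_parts[OF \<phi> t] by simp
    finally show "abs_l2 (wave k c) \<bullet> abs_l2 (partial \<phi> i) =
        - (abs_l2 (\<lambda>x. s x * partial (wave k c) i x) \<bullet> abs_l2 (\<lambda>x. \<phi> x / s x))"
      by (simp add: inner_abs_l2 sq_integrable_test t sq_integrable_test_partial \<phi>)
  qed
  then show ?thesis by (rule W_cases)
qed

lemma l2_trig_total:
  fixes f :: "'n l2"
  assumes "\<And>k c. k \<in> frequencies \<Longrightarrow> f \<bullet> abs_l2 (wave k c) = 0"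
  shows "f = 0"
proof -
  have "AE x in boxm. rep_l2 f x = 0"
  proof (rule trig_total)
    have "integrable boxm (\<lambda>x. \<bar>rep_l2 f x\<bar>)" by (intro L1_le_L2) simp
    then show "integrable boxm (rep_l2 f)" by (subst (asm) integrable_abs_iff) auto
    fix k :: "real ^ 'n" and c assume k: "k \<in> frequencies"
    have "sq_integrable (wave k c)" using sq_integrable_test[OF wave_test[OF k, of 1 c]] by simp
    then show "(LINT x|boxm. rep_l2 f x * wave k c x) = 0"
      using assms[OF k, of c] by (simp add: inner_l2_abs)
  qed
  then have "abs_l2 (rep_l2 f) = abs_l2 (\<lambda>x. 0)" by (subst abs_l2_eq_iff) (auto simp: sq_integrable_const)
  then show ?thesis by (simp add: zero_l2.abs_eq sq_integrable_const zero_l2_def)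
qed

lemma H1_dense:
  assumes "\<And>v. v \<in> H1 \<alpha> \<Longrightarrow> f \<bullet> v = 0"
  shows "f = 0"
  using assms wave_in_H1 by (intro l2_trig_total) auto

lemma const_in_W: "(l2_const 1, 0) \<in> W"
proof -
  have "(LINT x|boxm. partial \<phi> i x) = 0" if \<phi>: "\<phi> \<in> test_functions" for \<phi> :: "real ^ 'n \<Rightarrow> real" and i
    using test_has_derivative[OF \<phi>] test_partial_continuous[OF \<phi>] \<phi>
    by (intro integral_partial_derivative) (auto simp: test_functions_def)
  then show ?thesis
    unfolding W_def by (auto simp: l2_const_abs inner_abs_l2 sq_integrable_const sq_integrable_test_partial)
qed

lemma const_in_H1: "l2_const 1 \<in> H1 \<alpha>" and hat_const: "hat (l2_const 1) = (l2_const 1, 0)"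
  using W_cases[OF const_in_W] by auto

text \<open>The volume of the half-open box, squeezed between those of the open and the closed box;
  it is the origin of the factor 1 / 2^n in the limit.\<close>

lemma norm_const: "(l2_const 1 :: 'n l2) \<bullet> l2_const 1 = 2 ^ CARD('n)"
proof -
  have "emeasure lebesgue (pbox :: (real ^ 'n) set) = ennreal (2 ^ CARD('n))"
  proof (rule antisym)
    have b1: "(1 :: real ^ 'n) \<bullet> b = 1" if "b \<in> Basis" for b
      using that by (auto simp: Basis_vec_def inner_axis)
    have p: "(\<Prod>b\<in>Basis. (1 - - 1 :: real ^ 'n) \<bullet> b) = (\<Prod>b\<in>(Basis :: (real ^ 'n) set). 2)"
    proof (intro prod.cong refl)
      fix b :: "real ^ 'n" assume b: "b \<in> Basis"
      show "(1 - - 1 :: real ^ 'n) \<bullet> b = 2" unfolding inner_diff_left inner_minus_left b1[OF b] by simp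
    qed
    have c: "emeasure lborel (cbox (- 1) (1 :: real ^ 'n)) = ennreal (2 ^ CARD('n))"
    proof -
      have "emeasure lborel (cbox (- 1) (1 :: real ^ 'n)) = ennreal (\<Prod>b\<in>Basis. (1 - - 1 :: real ^ 'n) \<bullet> b)"
        by (rule emeasure_lborel_cbox) (simp add: b1)
      then show ?thesis unfolding p by simp
    qed
    have o: "emeasure lborel (box (- 1) (1 :: real ^ 'n)) = ennreal (2 ^ CARD('n))"
    proof -
      have "emeasure lborel (box (- 1) (1 :: real ^ 'n)) = ennreal (\<Prod>b\<in>Basis. (1 - - 1 :: real ^ 'n) \<bullet> b)"
        by (rule emeasure_lborel_box) (simp add: b1)
      then show ?thesis unfolding p by simp
    qed
    have "box (- 1) 1 \<subseteq> (pbox :: (real ^ 'n) set)" by (auto simp: pbox_def mem_box_cart less_imp_le)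
    then show "ennreal (2 ^ CARD('n)) \<le> emeasure lebesgue (pbox :: (real ^ 'n) set)"
      using emeasure_mono[of "box (- 1) 1" "pbox :: (real ^ 'n) set" lebesgue] sets_pbox o by simp
    show "emeasure lebesgue (pbox :: (real ^ 'n) set) \<le> ennreal (2 ^ CARD('n))"
      using emeasure_mono[OF pbox_subset_cbox[where 'n = 'n], of lebesgue] c by simp
  qed
  then have "measure boxm (pbox :: (real ^ 'n) set) = 2 ^ CARD('n)"
    by (simp add: measure_def emeasure_boxm)
  then show ?thesis by (simp add: l2_const_abs inner_abs_l2 sq_integrable_const)
qed

lemma gradient_zero_const:
  assumes u: "(u, 0) \<in> W"
  shows "\<exists>c. u = c *\<^sub>R l2_const 1"
proof -
  define c where "c = (u \<bullet> l2_const 1) / (l2_const 1 \<bullet> (l2_const 1 :: 'n l2))"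
  \<comment> \<open>Removing the mean gives orthogonality to the waves with k = 0.\<close>
  define f where "f = u - c *\<^sub>R l2_const 1"
  have "(u, 0) - c *\<^sub>R (l2_const 1, 0) \<in> W" by (intro subspace_diff[OF subspace_W] subspace_scale[OF subspace_W] u const_in_W)
  then have fW: "(f, 0) \<in> W" by (simp add: f_def)
  have f1: "f \<bullet> l2_const 1 = 0" unfolding f_def c_def by (simp add: inner_diff_left norm_const)
  have "f = 0"
  proof (rule l2_trig_total)
    fix k :: "real ^ 'n" and d assume k: "k \<in> frequencies"
    show "f \<bullet> abs_l2 (wave k d) = 0"
    proof (cases "k = 0")
      case True
      have "abs_l2 (wave k d) = cos d *\<^sub>R (l2_const 1 :: 'n l2)"
        by (simp add: l2_const_abs scaleR_abs_l2 sq_integrable_const wave_def[abs_def] True)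
      then show ?thesis using f1 by simp
    next
      case False
      then obtain i where i: "k $ i \<noteq> 0" by (auto simp: vec_eq_iff)
      \<comment> \<open>A primitive of the wave in direction i; the phase - pi / 2 undoes the shift
        caused by differentiation.\<close>
      let ?\<phi> = "\<lambda>x. 1 / (pi * k $ i) * wave k (d - pi / 2) x"
      have "partial ?\<phi> i = wave k d"
        unfolding wave_frechet using i by (simp add: inner_axis fun_eq_iff)
      moreover have "f \<bullet> abs_l2 (partial ?\<phi> i) = 0"
        using fW wave_test[OF k, of "1 / (pi * k $ i)" "d - pi / 2"] unfolding W_def by auto
      ultimately show ?thesis by simp
    qed
  qed
  then show ?thesis unfolding f_def by auto
qed

end

subsection \<open>The two evolution problems\<close>

lemma linear_proj:
  fixes W :: "'k::{real_inner,complete_space} set"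
  assumes W: "subspace W" "closed W"
  shows "linear (proj W)"
proof (rule linearI)
  fix x y c
  show "proj W (x + y) = proj W x + proj W y"
    by (rule proj_unique[OF W]) (auto intro: subspace_add W proj_in simp: inner_add_left proj_inner[OF W])
  show "proj W (c *\<^sub>R x) = c *\<^sub>R proj W x"
    by (rule proj_unique[OF W]) (auto intro: subspace_scale W proj_in simp: proj_inner[OF W])
qed

lemma
  fixes W :: "'k::{real_inner,complete_space} set"
  assumes W: "subspace W" "closed W"
  shows proj_sym: "proj W x \<bullet> y = x \<bullet> proj W y"
    and proj_nonneg: "0 \<le> proj W x \<bullet> x"
    and proj_le: "proj W x \<bullet> x \<le> x \<bullet> x"
    and proj_proj: "proj W x \<bullet> proj W x = proj W x \<bullet> x"
    and proj_id: "x \<in> W \<Longrightarrow> proj W x = x"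
proof -
  have 1: "proj W x \<bullet> proj W y = x \<bullet> proj W y" for x y by (rule proj_inner[OF W proj_in[OF W]])
  then show sym: "proj W x \<bullet> y = x \<bullet> proj W y" by (metis inner_commute)
  show 2: "proj W x \<bullet> proj W x = proj W x \<bullet> x" using 1[of x x] by (simp add: inner_commute)
  then show "0 \<le> proj W x \<bullet> x" using inner_ge_zero by metis
  have "0 \<le> (x - proj W x) \<bullet> (x - proj W x)" by simp
  then show "proj W x \<bullet> x \<le> x \<bullet> x" using 2 by (simp add: inner_diff inner_commute)
  show "x \<in> W \<Longrightarrow> proj W x = x" by (rule proj_unique[OF W]) auto
qed

context weight
begin

text \<open>For both spaces the resolvent \<open>(1 + A)\<^sup>-\<^sup>1\<close> comes from the orthogonal projection onto \<open>W\<close>: the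
  projection of \<open>(f, 0)\<close> is \<open>hat u\<close> for the solution \<open>u\<close> of \<open>\<langle>u, v\<rangle> + a(u, v) = \<langle>f, v\<rangle>\<close>.\<close>

definition resolvent_L2 :: "'n l2 \<Rightarrow> 'n l2" where
  "resolvent_L2 f = fst (proj W (f, 0))"

text \<open>On W this sends \<open>hat u\<close> to the projection of (u, 0). The inner projection
  extends it to the whole Hilbert space so that it is symmetric and between 0 and 1 there
  too.\<close>

definition resolvent_W :: "'n l2 \<times> ('n l2 ^ 'n) \<Rightarrow> 'n l2 \<times> ('n l2 ^ 'n)" where
  "resolvent_W k = proj W (fst (proj W k), 0)"

lemmas W_proj = proj_in[OF subspace_W closed_W] and W_proj_inner = proj_inner[OF subspace_W closed_W]
  and W_proj_unique = proj_unique[OF subspace_W closed_W] and W_proj_linear = linear_proj[OF subspace_W closed_W]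
  and W_proj_sym = proj_sym[OF subspace_W closed_W] and W_proj_id = proj_id[OF subspace_W closed_W]

lemma proj_W_pair: "proj W (f, 0) = hat (resolvent_L2 f)"
  unfolding resolvent_L2_def by (simp add: hat_fst W_proj)

lemma resolvent_L2_in_H1: "resolvent_L2 f \<in> H1 \<alpha>"
  unfolding resolvent_L2_def by (intro fst_in_H1 W_proj)

lemma resolvent_L2_works: "v \<in> H1 \<alpha> \<Longrightarrow> resolvent_L2 f \<bullet> v + form \<alpha> (resolvent_L2 f) v = f \<bullet> v"
  using W_proj_inner[OF hat_in_W, of v "(f, 0)"]
  by (simp add: proj_W_pair inner_hat resolvent_L2_in_H1) (simp add: hat_def)

lemma resolvent_L2_unique:
  assumes u: "u \<in> H1 \<alpha>" and eq: "\<And>v. v \<in> H1 \<alpha> \<Longrightarrow> u \<bullet> v + form \<alpha> u v = f \<bullet> v"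
  shows "resolvent_L2 f = u"
proof -
  have "proj W (f, 0) = hat u"
  proof (rule W_proj_unique[OF hat_in_W[OF u]])
    fix p assume p: "p \<in> W"
    have "hat u \<bullet> hat (fst p) = (f, 0) \<bullet> hat (fst p)"
      using eq[OF fst_in_H1[OF p]] by (simp add: inner_hat u fst_in_H1 p) (simp add: hat_def)
    then show "hat u \<bullet> p = (f, 0) \<bullet> p" by (simp add: hat_fst p)
  qed
  then show ?thesis by (simp add: resolvent_L2_def)
qed

lemma resolvent_L2_inj: "resolvent_L2 f = 0 \<Longrightarrow> f = 0"
proof (rule H1_dense)
  fix v assume "resolvent_L2 f = 0" and v: "v \<in> H1 \<alpha>"
  then have "proj W (f, 0) = hat 0" using proj_W_pair[of f] by simp
  also have "\<dots> = 0" using hat_fst[OF subspace_0[OF subspace_W]] by simp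
  finally show "f \<bullet> v = 0" using W_proj_inner[OF hat_in_W[OF v], of "(f, 0)"] by (simp add: hat_def)
qed

lemma unit_operator_L2: "unit_operator resolvent_L2"
proof (rule unit_operator.intro)
  have lin: "linear (\<lambda>f :: 'n l2. (f, 0 :: 'n l2 ^ 'n))" by (auto intro!: linearI)
  show "linear resolvent_L2"
    unfolding resolvent_L2_def[abs_def]
    using linear_compose[OF linear_compose[OF lin W_proj_linear] bounded_linear.linear[OF bounded_linear_fst]]
    by (simp add: o_def)
  fix x y :: "'n l2"
  have pair: "resolvent_L2 x \<bullet> y = proj W (x, 0) \<bullet> (y, 0)" for x y by (simp add: resolvent_L2_def inner_prod_def)
  show "resolvent_L2 x \<bullet> y = x \<bullet> resolvent_L2 y"
    using W_proj_sym[of "(x, 0)" "(y, 0)"] pair[of x y] pair[of y x] by (simp add: inner_commute)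
  show "0 \<le> resolvent_L2 x \<bullet> x" unfolding pair by (rule proj_nonneg[OF subspace_W closed_W])
  show "resolvent_L2 x \<bullet> x \<le> x \<bullet> x"
    using proj_le[OF subspace_W closed_W, of "(x, 0)"] unfolding pair by (simp add: inner_prod_def)
qed

lemma evolution_L2: "evolution resolvent_L2 UNIV id UNIV norm"
  by (intro evolution.intro unit_operator_L2 evolution_axioms.intro)
    (use resolvent_L2_inj in \<open>auto simp: linear_id\<close>)

text \<open>Density of the Sobolev space in L2 makes the representing f unique, which resolves the
  definite description.\<close>

lemma opA_eq:
  assumes u: "u \<in> H1 \<alpha>" and f: "\<And>v. v \<in> H1 \<alpha> \<Longrightarrow> form \<alpha> u v = f \<bullet> v"
  shows "opA \<alpha> u = f"
  unfolding opA_def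
proof (rule the_equality)
  show "embed_l2 \<alpha> f = calA \<alpha> u" using f by (auto simp: embed_l2_def calA_def)
  fix g assume g: "embed_l2 \<alpha> g = calA \<alpha> u"
  have "(g - f) \<bullet> v = 0" if v: "v \<in> H1 \<alpha>" for v
    using fun_cong[OF g, of v] f[OF v] v by (simp add: embed_l2_def calA_def inner_diff_left)
  then have "g - f = 0" by (rule H1_dense)
  then show "g = f" by simp
qed

lemma resolvent_L2_form: "v \<in> H1 \<alpha> \<Longrightarrow> form \<alpha> (resolvent_L2 f) v = (f - resolvent_L2 f) \<bullet> v"
  using resolvent_L2_works[of v f] by (simp add: inner_diff_left)

lemma opA_resolvent: "opA \<alpha> (resolvent_L2 f) = f - resolvent_L2 f"
  by (rule opA_eq[OF resolvent_L2_in_H1 resolvent_L2_form])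

text \<open>For u in the domain, Riesz on the Sobolev space with the L2 norm, where it need not be
  closed, represents the form by some f; then u solves the resolvent equation with right-hand side u
  + f.\<close>

lemma H2_eq: "H2 \<alpha> = range resolvent_L2"
proof (intro equalityI subsetI)
  fix u assume "u \<in> range resolvent_L2"
  then obtain f where u: "u = resolvent_L2 f" by auto
  have "\<bar>form \<alpha> u v\<bar> \<le> norm (f - u) * norm v" if "v \<in> H1 \<alpha>" for v
    unfolding u resolvent_L2_form[OF that] by (rule Cauchy_Schwarz_ineq2)
  then show "u \<in> H2 \<alpha>" unfolding H2_def using resolvent_L2_in_H1 u by auto
next
  fix u assume "u \<in> H2 \<alpha>"
  then obtain C where u: "u \<in> H1 \<alpha>" and C: "\<And>v. v \<in> H1 \<alpha> \<Longrightarrow> \<bar>form \<alpha> u v\<bar> \<le> C * norm v" unfolding H2_def by auto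
  have form: "form \<alpha> u v = hat u \<bullet> hat v - u \<bullet> v" if "v \<in> H1 \<alpha>" for v using inner_hat[OF u that] by simp
  obtain f where f: "\<And>v. v \<in> H1 \<alpha> \<Longrightarrow> form \<alpha> u v = f \<bullet> v"
  proof (rule riesz_on_subspace[OF subspace_H1, of "form \<alpha> u" C])
    show "form \<alpha> u (x + y) = form \<alpha> u x + form \<alpha> u y" if "x \<in> H1 \<alpha>" "y \<in> H1 \<alpha>" for x y
      using that by (simp add: form H1_closed hat_simps inner_add_right)
    show "form \<alpha> u (c *\<^sub>R x) = c * form \<alpha> u x" if "x \<in> H1 \<alpha>" for c x
      using that by (simp add: form H1_closed hat_simps right_diff_distrib)
  qed (use C in blast)+
  have "resolvent_L2 (u + f) = u" by (rule resolvent_L2_unique[OF u]) (simp add: f inner_add_left)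
  then show "u \<in> range resolvent_L2" by (metis rangeI)
qed

lemma graph_L2: "evolution.graph resolvent_L2 UNIV id = minus_A_graph \<alpha>"
  unfolding evolution.graph_def[OF evolution_L2] minus_A_graph_def H2_eq by (auto simp: opA_resolvent)

lemma form_zero_const:
  assumes u: "u \<in> H1 \<alpha>" and "form \<alpha> u u = 0"
  shows "\<exists>c. u = c *\<^sub>R l2_const 1"
proof -
  have "hat u \<bullet> hat u = u \<bullet> u" using inner_hat[OF u u] assms(2) by simp
  then have "snd (hat u) \<bullet> snd (hat u) = 0" by (simp add: inner_prod_def)
  then have "hat u = (u, 0)" by (simp add: prod_eq_iff)
  then show ?thesis using hat_in_W[OF u] gradient_zero_const by simp
qed

lemma resolvent_L2_const: "resolvent_L2 (l2_const 1) = l2_const 1"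
  using W_proj_id[OF const_in_W] by (simp add: resolvent_L2_def)

lemma resolvent_L2_fixed: "resolvent_L2 x = x \<Longrightarrow> \<exists>c. x = c *\<^sub>R l2_const 1"
  using form_zero_const[of x] resolvent_L2_form[of x x] resolvent_L2_in_H1[of x] by simp

text \<open>The Riesz isomorphism from W onto the dual, with the extension by 0 that membership in
  \<open>Hm1\<close> prescribes.\<close>

definition represent :: "'n l2 \<times> ('n l2 ^ 'n) \<Rightarrow> 'n l2 \<Rightarrow> real" where
  "represent k = (\<lambda>v. if v \<in> H1 \<alpha> then k \<bullet> hat v else 0)"

text \<open>\<open>hat u\<close> represents the functional (1 + A) u, since its product with
  \<open>hat v\<close> is \<open>u \<bullet> v + form \<alpha> u v\<close>. The resolvent must
  therefore yield the representative of u itself.\<close>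

lemma represent_resolvent_W:
  assumes u: "u \<in> H1 \<alpha>"
  shows "represent (resolvent_W (hat u)) = embed_l2 \<alpha> u"
    and "represent (resolvent_W (hat u) - hat u) = - calA \<alpha> u"
proof -
  have R: "resolvent_W (hat u) \<bullet> hat v = u \<bullet> v" if v: "v \<in> H1 \<alpha>" for v
    unfolding resolvent_W_def W_proj_id[OF hat_in_W[OF u]] W_proj_inner[OF hat_in_W[OF v]] by (simp add: hat_def)
  then show "represent (resolvent_W (hat u)) = embed_l2 \<alpha> u" by (auto simp: represent_def embed_l2_def)
  show "represent (resolvent_W (hat u) - hat u) = - calA \<alpha> u"
    using R by (auto simp: represent_def calA_def inner_diff_left inner_hat u fun_eq_iff)
qed

lemma unit_operator_W: "unit_operator resolvent_W"
proof (rule unit_operator.intro)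
  have lin: "linear (\<lambda>k :: 'n l2 \<times> ('n l2 ^ 'n). (fst k, 0 :: 'n l2 ^ 'n))" by (auto intro!: linearI)
  show "linear resolvent_W"
    unfolding resolvent_W_def[abs_def]
    using linear_compose[OF linear_compose[OF W_proj_linear lin] W_proj_linear] by (simp add: o_def)
  fix x y :: "'n l2 \<times> ('n l2 ^ 'n)"
  \<comment> \<open>This expression is visibly symmetric and, at y = x, nonnegative and at most the
    squared norm of the projection.\<close>
  have R: "resolvent_W x \<bullet> y = fst (proj W x) \<bullet> fst (proj W y)" for x y
    unfolding resolvent_W_def W_proj_sym by (simp add: inner_prod_def)
  show "resolvent_W x \<bullet> y = x \<bullet> resolvent_W y" using R[of x y] R[of y x] by (simp add: inner_commute)
  show "0 \<le> resolvent_W x \<bullet> x" unfolding R by simp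
  have "fst (proj W x) \<bullet> fst (proj W x) \<le> proj W x \<bullet> proj W x" by (simp add: inner_prod_def)
  also have "\<dots> \<le> x \<bullet> x" using proj_proj[OF subspace_W closed_W] proj_le[OF subspace_W closed_W] by metis
  finally show "resolvent_W x \<bullet> x \<le> x \<bullet> x" unfolding R .
qed

lemma Hm1_norm_represent:
  assumes k: "k \<in> W"
  shows "Hm1_norm \<alpha> (represent k) = norm k"
proof -
  let ?B = "{v \<in> H1 \<alpha>. H1_norm \<alpha> v \<le> 1}"
  have zero: "0 \<in> ?B" using subspace_0[OF subspace_H1] norm_hat[of 0] hat_fst[OF subspace_0[OF subspace_W]] by simp
  have le: "\<bar>represent k v\<bar> \<le> norm k" if "v \<in> ?B" for v
  proof -
    have "\<bar>k \<bullet> hat v\<bar> \<le> norm k * norm (hat v)" by (rule Cauchy_Schwarz_ineq2)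
    also have "\<dots> \<le> norm k * 1" using that by (intro mult_left_mono) (auto simp: norm_hat)
    finally show ?thesis using that by (simp add: represent_def)
  qed
  have "Hm1_norm \<alpha> (represent k) \<le> norm k"
    unfolding Hm1_norm_def by (rule cSUP_least) (use zero le in auto)
  moreover have "norm k \<le> Hm1_norm \<alpha> (represent k)"
  proof (cases "k = 0")
    case True
    then show ?thesis unfolding Hm1_norm_def using zero le
      by (intro cSUP_upper2[of _ _ 0]) (auto intro!: bdd_aboveI2[of _ _ "norm k"])
  next
    case False
    \<comment> \<open>The supremum is attained at the normalised first component of k.\<close>
    define v where "v = (1 / norm k) *\<^sub>R fst k"
    have v: "v \<in> H1 \<alpha>" unfolding v_def by (intro H1_closed fst_in_H1 k)
    have hv: "hat v = (1 / norm k) *\<^sub>R k" unfolding v_def by (simp add: hat_simps fst_in_H1 k hat_fst)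
    have "v \<in> ?B" using v norm_hat[OF v] False by (simp add: hv)
    moreover have "represent k v = norm k"
      using v False by (simp add: represent_def hv power2_norm_eq_inner[symmetric] power2_eq_square)
    ultimately show ?thesis unfolding Hm1_norm_def using le
      by (intro cSUP_upper2[of _ _ v]) (auto intro!: bdd_aboveI2[of _ _ "norm k"])
  qed
  ultimately show ?thesis by simp
qed

lemma represent_image: "represent ` W = Hm1 \<alpha>"
proof (intro equalityI subsetI)
  fix F assume "F \<in> represent ` W"
  then obtain k where k: "k \<in> W" "F = represent k" by auto
  have "\<bar>F v\<bar> \<le> norm k * H1_norm \<alpha> v" if "v \<in> H1 \<alpha>" for v
    using Cauchy_Schwarz_ineq2[of k "hat v"] that by (simp add: k represent_def norm_hat)
  moreover have "linear_map_on (H1 \<alpha>) F"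
    unfolding linear_map_on_def k represent_def by (auto simp: H1_closed hat_simps inner_add_right)
  ultimately show "F \<in> Hm1 \<alpha>" unfolding Hm1_def by (auto simp: k represent_def)
next
  fix F assume "F \<in> Hm1 \<alpha>"
  then obtain C where lin: "linear_map_on (H1 \<alpha>) F" and C: "\<And>v. v \<in> H1 \<alpha> \<Longrightarrow> \<bar>F v\<bar> \<le> C * H1_norm \<alpha> v"
    and out: "\<And>v. v \<notin> H1 \<alpha> \<Longrightarrow> F v = 0" unfolding Hm1_def by auto
  \<comment> \<open>F is bounded by the Sobolev norm of \<open>fst p\<close>, which for p in W is
    the norm of p itself.\<close>
  obtain f where f: "f \<in> closure W" "\<And>p. p \<in> W \<Longrightarrow> F (fst p) = f \<bullet> p"
  proof (rule riesz_on_subspace[OF subspace_W, of "\<lambda>p. F (fst p)" C])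
    show "F (fst (x + y)) = F (fst x) + F (fst y)" if "x \<in> W" "y \<in> W" for x y
      using lin that unfolding linear_map_on_def by (simp add: fst_in_H1)
    show "F (fst (c *\<^sub>R x)) = c * F (fst x)" if "x \<in> W" for c x
      using lin that unfolding linear_map_on_def by (simp add: fst_in_H1)
    show "\<bar>F (fst x)\<bar> \<le> C * norm x" if "x \<in> W" for x
      using C[OF fst_in_H1[OF that]] norm_hat[OF fst_in_H1[OF that]] by (simp add: hat_fst that)
  qed (rule that, assumption, blast)
  have "f \<in> W" using f(1) closed_W by simp
  moreover have "F = represent f"
    using f(2)[OF hat_in_W] out by (auto simp: represent_def fun_eq_iff)
  ultimately show "F \<in> represent ` W" by blast
qed

lemma evolution_W: "evolution resolvent_W W represent (Hm1 \<alpha>) (Hm1_norm \<alpha>)"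
proof (intro evolution.intro unit_operator_W evolution_axioms.intro)
  show "resolvent_W x \<in> W" if "x \<in> W" for x unfolding resolvent_W_def by (rule W_proj)
  fix x assume x: "x \<in> W" and "resolvent_W x = 0"
  then have "resolvent_L2 (fst x) = 0" by (simp add: resolvent_W_def resolvent_L2_def W_proj_id)
  then show "x = 0" using resolvent_L2_inj hat_fst[OF x] hat_fst[OF subspace_0[OF subspace_W]] by (metis fst_zero)
next
  show "linear represent"
    by (rule linearI) (auto simp: represent_def plus_fun_def scaleR_fun_def inner_add_left fun_eq_iff)
qed (use subspace_W closed_W represent_image Hm1_norm_represent in auto)

lemma graph_W: "evolution.graph resolvent_W W represent = minus_calA_graph \<alpha>"
proof -
  have W: "W = hat ` H1 \<alpha>"
  proof (intro equalityI subsetI)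
    fix p assume "p \<in> W"
    then show "p \<in> hat ` H1 \<alpha>" using hat_fst fst_in_H1 by (intro image_eqI[of _ _ "fst p"]) auto
  qed (use hat_in_W in auto)
  have "{(represent (resolvent_W w), represent (resolvent_W w - w)) |w. w \<in> W} =
      (\<lambda>w. (represent (resolvent_W w), represent (resolvent_W w - w))) ` W" by (rule Setcompr_eq_image)
  also have "\<dots> = (\<lambda>u. (represent (resolvent_W (hat u)), represent (resolvent_W (hat u) - hat u))) ` H1 \<alpha>"
    unfolding W image_image ..
  also have "\<dots> = (\<lambda>u. (embed_l2 \<alpha> u, - calA \<alpha> u)) ` H1 \<alpha>"
    by (rule image_cong) (simp_all add: represent_resolvent_W)
  also have "\<dots> = minus_calA_graph \<alpha>" unfolding minus_calA_graph_def by (rule Setcompr_eq_image[symmetric])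
  finally show ?thesis unfolding evolution.graph_def[OF evolution_W] .
qed

lemma const_W:
  shows "resolvent_W (l2_const 1, 0) = (l2_const 1, 0)"
    and "x \<in> W \<Longrightarrow> resolvent_W x = x \<Longrightarrow> \<exists>c. x = c *\<^sub>R (l2_const 1, 0)"
proof -
  show "resolvent_W (l2_const 1, 0) = (l2_const 1, 0)"
    by (simp add: resolvent_W_def W_proj_id const_in_W)
  assume x: "x \<in> W" and "resolvent_W x = x"
  then have "resolvent_L2 (fst x) = fst x" by (simp add: resolvent_W_def resolvent_L2_def W_proj_id)
  then obtain c where "fst x = c *\<^sub>R l2_const 1" using resolvent_L2_fixed by blast
  then have "x = c *\<^sub>R (l2_const 1, 0)" using hat_fst[OF x] const_in_H1 by (simp add: hat_simps hat_const)
  then show "\<exists>c. x = c *\<^sub>R (l2_const 1, 0)" ..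
qed

section \<open>The Cauchy problems in L2 and in the dual\<close>

lemma scale_const: "c *\<^sub>R l2_const 1 = (l2_const c :: 'n l2)"
  by (simp add: l2_const_abs scaleR_abs_l2 sq_integrable_const)

theorem L2_problem:
  "\<exists>u. acp_solution UNIV norm (minus_A_graph \<alpha>) u0 u \<and>
        C1_in UNIV norm u \<and>
        (\<forall>t>0. u t \<in> H2 \<alpha>) \<and> continuous_in (H2_norm \<alpha>) {0<..} u \<and>
        (\<forall>w. acp_solution UNIV norm (minus_A_graph \<alpha>) u0 w \<longrightarrow> (\<forall>t\<ge>0. w t = u t)) \<and>
        ((\<lambda>t. norm (u t - l2_const (1 / 2 ^ CARD('n) * embed_l2 \<alpha> u0 (l2_const 1)))) \<longlongrightarrow> 0) at_top"
proof -
  interpret evolution resolvent_L2 UNIV id UNIV norm by (rule evolution_L2)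
  let ?e = "l2_const 1 :: 'n l2"
  have ne: "?e \<noteq> 0" using norm_const by (metis inner_zero_left power_not_zero zero_neq_numeral)
  have ker: "\<forall>x\<in>UNIV. resolvent_L2 x = x \<longrightarrow> (\<exists>c. x = c *\<^sub>R l2_const 1)" using resolvent_L2_fixed by blast
  from cauchy_problem[OF UNIV_I resolvent_L2_const ne ker UNIV_I, of u0]
  obtain u v where u: "acp_solution UNIV norm graph u0 u" "C1_in UNIV norm u"
    "\<forall>t>0. v t \<in> UNIV \<and> u t = id (resolvent_L2 (v t))" "continuous_on {0<..} v"
    "\<forall>w. acp_solution UNIV norm graph u0 w \<longrightarrow> (\<forall>t\<ge>0. w t = u t)"
    "((\<lambda>t. norm (u t - id ((V u0 \<bullet> ?e / (?e \<bullet> ?e)) *\<^sub>R ?e))) \<longlongrightarrow> 0) at_top"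
    by (elim exE conjE) (rule that)
  have Vu0: "V u0 = u0" using V_U[of u0] by simp
  have lim: "id ((V u0 \<bullet> ?e / (?e \<bullet> ?e)) *\<^sub>R ?e)
      = (l2_const (1 / 2 ^ CARD('n) * embed_l2 \<alpha> u0 (l2_const 1)) :: 'n l2)"
    by (simp add: Vu0 norm_const scale_const embed_l2_def const_in_H1)
  \<comment> \<open>The increment of u is R d with d the increment of v, and the operator maps it to
    d - R d; both parts of the graph norm are controlled by the norm of d.\<close>
  have "continuous_in (H2_norm \<alpha>) {0<..} u"
    unfolding continuous_in_def
  proof
    fix t :: real assume t: "t \<in> {0<..}"
    let ?d = "\<lambda>s. v s - v t"
    have d: "(?d \<longlongrightarrow> 0) (at t within {0<..})" using u(4) t unfolding continuous_on_def by (auto intro: LIM_zero)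
    have bl: "bounded_linear resolvent_L2"
      by (rule bounded_linear_intro[of _ 1]) (use norm_R_le in auto)
    have "((\<lambda>s. norm (resolvent_L2 (?d s)) + norm (?d s - resolvent_L2 (?d s))) \<longlongrightarrow> norm (0 :: 'n l2) + norm (0 - 0 :: 'n l2))
        (at t within {0<..})"
      by (intro tendsto_add tendsto_norm tendsto_diff d bounded_linear.tendsto_zero[OF bl])
    then have "((\<lambda>s. norm (resolvent_L2 (?d s)) + norm (?d s - resolvent_L2 (?d s))) \<longlongrightarrow> 0) (at t within {0<..})"
      by simp
    moreover have "\<forall>\<^sub>F s in at t within {0<..}.
        norm (resolvent_L2 (?d s)) + norm (?d s - resolvent_L2 (?d s)) = H2_norm \<alpha> (u s - u t)"
      unfolding eventually_at_filter
    proof (intro always_eventually allI impI)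
      fix s :: real assume "s \<in> {0<..}"
      then have "u s - u t = resolvent_L2 (?d s)" using t u(3) by simp
      then show "norm (resolvent_L2 (?d s)) + norm (?d s - resolvent_L2 (?d s)) = H2_norm \<alpha> (u s - u t)"
        by (simp add: H2_norm_def opA_resolvent del: R_simps)
    qed
    ultimately show "((\<lambda>s. H2_norm \<alpha> (u s - u t)) \<longlongrightarrow> 0) (at t within {0<..})" by (rule Lim_transform_eventually)
  qed
  moreover have "\<forall>t>0. u t \<in> H2 \<alpha>" using u(3) by (simp add: H2_eq)
  ultimately show ?thesis using u(1,2,5,6) unfolding graph_L2 lim by blast
qed

theorem Hm1_problem:
  assumes u0: "u0 \<in> Hm1 \<alpha>"
  shows "\<exists>u. acp_solution (Hm1 \<alpha>) (Hm1_norm \<alpha>) (minus_calA_graph \<alpha>) u0 u \<and>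
        C1_in (Hm1 \<alpha>) (Hm1_norm \<alpha>) u \<and>
        (\<exists>v. (\<forall>t>0. v t \<in> H1 \<alpha> \<and> u t = embed_l2 \<alpha> (v t)) \<and> continuous_in (H1_norm \<alpha>) {0<..} v) \<and>
        (\<forall>w. acp_solution (Hm1 \<alpha>) (Hm1_norm \<alpha>) (minus_calA_graph \<alpha>) u0 w \<longrightarrow> (\<forall>t\<ge>0. w t = u t)) \<and>
        ((\<lambda>t. Hm1_norm \<alpha>
            (u t - embed_l2 \<alpha> (l2_const (1 / 2 ^ CARD('n) * u0 (l2_const 1))))) \<longlongrightarrow> 0) at_top"
proof -
  interpret evolution resolvent_W W represent "Hm1 \<alpha>" "Hm1_norm \<alpha>" by (rule evolution_W)
  let ?e = "(l2_const 1, 0) :: 'n l2 \<times> ('n l2 ^ 'n)"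
  have ee: "?e \<bullet> ?e = 2 ^ CARD('n)" by (simp add: norm_const)
  then have ne: "?e \<noteq> 0" by (metis inner_zero_left power_not_zero zero_neq_numeral)
  have ker: "\<forall>x\<in>W. resolvent_W x = x \<longrightarrow> (\<exists>c. x = c *\<^sub>R ?e)" using const_W(2) by blast
  from cauchy_problem[OF const_in_W const_W(1) ne ker u0]
  obtain u v where u: "acp_solution (Hm1 \<alpha>) (Hm1_norm \<alpha>) graph u0 u" "C1_in (Hm1 \<alpha>) (Hm1_norm \<alpha>) u"
    and uv: "\<forall>t>0. v t \<in> W \<and> u t = represent (resolvent_W (v t))" and v: "continuous_on {0<..} v"
    and lims: "\<forall>w. acp_solution (Hm1 \<alpha>) (Hm1_norm \<alpha>) graph u0 w \<longrightarrow> (\<forall>t\<ge>0. w t = u t)"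
    "((\<lambda>t. Hm1_norm \<alpha> (u t - represent ((V u0 \<bullet> ?e / (?e \<bullet> ?e)) *\<^sub>R ?e))) \<longlongrightarrow> 0) at_top"
    by (elim exE conjE) (rule that)
  have u3: "v t \<in> W" and u4: "u t = represent (resolvent_W (v t))" if "0 < t" for t using uv that by auto
  \<comment> \<open>Constants have no gradient part, so the pairing of u0 with 1 is an inner product
    with \<open>(l2_const 1, 0)\<close>.\<close>
  have Vu0: "V u0 \<bullet> ?e = u0 (l2_const 1)"
    using fun_cong[OF U_V[OF u0], of "l2_const 1"] by (simp add: represent_def const_in_H1 hat_const)
  have lim: "represent ((V u0 \<bullet> ?e / (?e \<bullet> ?e)) *\<^sub>R ?e) = embed_l2 \<alpha> (l2_const (1 / 2 ^ CARD('n) * u0 (l2_const 1)))"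
  proof -
    define c where "c = 1 / 2 ^ CARD('n) * u0 (l2_const 1)"
    have c: "c *\<^sub>R l2_const 1 \<in> H1 \<alpha>" "hat (c *\<^sub>R l2_const 1) = c *\<^sub>R ?e"
      by (simp_all add: H1_closed const_in_H1 hat_simps hat_const)
    have "resolvent_W (c *\<^sub>R ?e) = c *\<^sub>R ?e" using const_W(1) by (simp only: R_simps)
    then have "represent (c *\<^sub>R ?e) = embed_l2 \<alpha> (c *\<^sub>R l2_const 1)"
      using represent_resolvent_W(1)[OF c(1)] unfolding c(2) by simp
    then show ?thesis by (simp add: Vu0 norm_const c_def scale_const del: U_simps)
  qed
  \<comment> \<open>Since v t equals \<open>hat (fst (v t))\<close>, the resolvent relation shows
    that u t is the embedded first component; its Sobolev norm increments are the Hilbert norm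
    increments of v.\<close>
  have "u t = embed_l2 \<alpha> (fst (v t))" if "0 < t" for t
    using represent_resolvent_W(1)[OF fst_in_H1[OF u3[OF that]]] u4[OF that] by (simp add: hat_fst u3 that)
  moreover have "continuous_in (H1_norm \<alpha>) {0<..} (\<lambda>t. fst (v t))"
    unfolding continuous_in_def
  proof
    fix t :: real assume t: "t \<in> {0<..}"
    have "(v \<longlongrightarrow> v t) (at t within {0<..})" using v t unfolding continuous_on_def by blast
    then have "((\<lambda>s. norm (v s - v t)) \<longlongrightarrow> 0) (at t within {0<..})"
      by (rule tendsto_norm_zero[OF LIM_zero])
    moreover have "\<forall>\<^sub>F s in at t within {0<..}. norm (v s - v t) = H1_norm \<alpha> (fst (v s) - fst (v t))"
      unfolding eventually_at_filter
      using t u3 by (intro always_eventually) (auto simp: norm_hat[symmetric] hat_simps H1_closed fst_in_H1 hat_fst)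
    ultimately show "((\<lambda>s. H1_norm \<alpha> (fst (v s) - fst (v t))) \<longlongrightarrow> 0) (at t within {0<..})"
      by (rule Lim_transform_eventually)
  qed
  ultimately have "\<exists>v. (\<forall>t>0. v t \<in> H1 \<alpha> \<and> u t = embed_l2 \<alpha> (v t)) \<and> continuous_in (H1_norm \<alpha>) {0<..} v"
    using u3 fst_in_H1 by (intro exI[of _ "\<lambda>t. fst (v t)"]) auto
  then show ?thesis using u lims unfolding graph_W lim by blast
qed

end

theorem theorem3p6:
  fixes \<sigma> :: real and \<Gamma> :: "(real ^ 'n::finite) set" and \<alpha> :: "real ^ 'n \<Rightarrow> real"
  assumes "CARD('n) \<in> {1, 2}"
    and "admissible_interface \<Gamma>"
    and "0 \<le> \<sigma>" and "\<sigma> < 1"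
    and "\<alpha> \<in> weights \<sigma> \<Gamma>"
  shows
    "generates_analytic_contraction_semigroup UNIV norm (minus_A_graph \<alpha>) \<and>
     generates_analytic_contraction_semigroup (Hm1 \<alpha>) (Hm1_norm \<alpha>) (minus_calA_graph \<alpha>) \<and>
     (\<forall>u0. \<exists>u.
        acp_solution UNIV norm (minus_A_graph \<alpha>) u0 u \<and>
        C1_in UNIV norm u \<and>
        (\<forall>t>0. u t \<in> H2 \<alpha>) \<and> continuous_in (H2_norm \<alpha>) {0<..} u \<and>
        (\<forall>w. acp_solution UNIV norm (minus_A_graph \<alpha>) u0 w \<longrightarrow> (\<forall>t\<ge>0. w t = u t)) \<and>
        ((\<lambda>t. norm (u t - l2_const (1 / 2 ^ CARD('n) * embed_l2 \<alpha> u0 (l2_const 1)))) \<longlongrightarrow> 0) at_top) \<and>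
     (\<forall>u0\<in>Hm1 \<alpha>. \<exists>u.
        acp_solution (Hm1 \<alpha>) (Hm1_norm \<alpha>) (minus_calA_graph \<alpha>) u0 u \<and>
        C1_in (Hm1 \<alpha>) (Hm1_norm \<alpha>) u \<and>
        (\<exists>v. (\<forall>t>0. v t \<in> H1 \<alpha> \<and> u t = embed_l2 \<alpha> (v t)) \<and> continuous_in (H1_norm \<alpha>) {0<..} v) \<and>
        (\<forall>w. acp_solution (Hm1 \<alpha>) (Hm1_norm \<alpha>) (minus_calA_graph \<alpha>) u0 w \<longrightarrow>
             (\<forall>t\<ge>0. w t = u t)) \<and>
        ((\<lambda>t. Hm1_norm \<alpha>
            (u t - embed_l2 \<alpha> (l2_const (1 / 2 ^ CARD('n) * u0 (l2_const 1))))) \<longlongrightarrow> 0) at_top)"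
proof -
  interpret weight \<alpha> by (rule weights_weight[OF assms(2-5)])
  show ?thesis
    using evolution.generates[OF evolution_L2] evolution.generates[OF evolution_W] L2_problem Hm1_problem
    unfolding graph_L2 graph_W by blast
qed

end
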